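(* Assume that $a$, $\ell$ and $V$ satisfy the standing assumptions listed in the context. Then $\nu$ is a quasi-stationary distribution for the semigroup $(P_t)$; that is, for all $t>0$ and all bounded measurable $\phi:\mathbb{R}\to\mathbb{R}$, $$\int_{\mathbb{R}}\mathbb{E}_x\left(e^{\int_0^tV(X_s)\,ds}\phi(X_t)\right)\nu(dx)=e^{-\lambda_0t}\int_{\mathbb{R}}\phi(x)\,\nu(dx).$$ In particular, $$\frac{\int_{\mathbb{R}}\mathbb{E}_x\left(e^{\int_0^tV(X_s)\,ds}\phi(X_t)\right)\nu(dx)}{\int_{\mathbb{R}}\mathbb{E}_x\left(e^{\int_0^tV(X_s)\,ds}\right)\nu(dx)}=\int_{\mathbb{R}}\phi(x)\,\nu(dx).$$
   Context: Diffusion: $B$ is a one-dimensional Brownian motion and $X$ solves $dX_t=dB_t-a(X_t)\,dt$, with $X_0=x$ under $\mathbb{P}_x$. Put $\ell(x)=\int_0^x a(z)\,dz$ and $\rho(dy)=e^{-2\ell(y)}\,dy$. Standing assumptions: $a\in C^1(\mathbb{R})$; there are constants $\beta,\gamma$ with $|\ell(x)|\le\gamma+\beta|x|$ for all $x$; $a'-a^2$ is bounded from above; $V:\mathbb{R}\to\mathbb{R}$ is continuous, bounded above, $\lim_{|x|\to\infty}V(x)=-\infty$, and there are $E>0$, $x_0\ge 0$ such that $V(x)\le -E|x|$ for all $|x|\ge x_0$. Feynman-Kac semigroup: $P_tf(x)=\mathbb{E}_x\left(e^{\int_0^tV(X_s)\,ds}f(X_t)\right)$. Spectral data: let $\widetilde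 V=V+\frac12(a'-a^2)$. The operator $\widetilde{\mathscr{L}}u=\frac12u''+\widetilde Vu$ on $L^2(dx)$ is known to have discrete spectrum consisting of simple eigenvalues $-\lambda_0>-\lambda_1>\cdots>-\lambda_k>\cdots\to-\infty$, with a complete orthonormal system in $L^2(dx)$ of real $C^2$ eigenfunctions $(\Psi_k)_{k\ge0}$ decaying at $\pm\infty$ faster than $e^{-R|x|}$ for every $R>0$; $\Psi_0$ is chosen positive. Put $\Theta_0=e^{\ell}\Psi_0$, so that $\int\Theta_0^2\,d\rho=1$. The probability measure $\nu$ is $$\nu(dx)=\frac{\Theta_0(x)e^{-2\ell(x)}}{\int_{\mathbb{R}}\Theta_0(y)e^{-2\ell(y)}\,dy}\,dx .$$ *)

theory Defs
  imports "HOL-Probability.Probability" "HOL-Library.Landau_Symbols"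
begin

text \<open>Standard Brownian motion with time set \<open>[0, \<infinity>)\<close>; values at negative times are irrelevant.\<close>

definition brownian_motion :: "'w measure \<Rightarrow> (real \<Rightarrow> 'w \<Rightarrow> real) \<Rightarrow> bool" where
  "brownian_motion M B \<longleftrightarrow>
     prob_space M \<and>
     (\<forall>t\<ge>0. B t \<in> borel_measurable M) \<and>
     (\<forall>\<omega>\<in>space M. continuous_on {0..} (\<lambda>t. B t \<omega>)) \<and>
     (AE \<omega> in M. B 0 \<omega> = 0) \<and>
     (\<forall>s t. 0 \<le> s \<and> s < t \<longrightarrow>
        distributed M lborel (\<lambda>\<omega>. B t \<omega> - B s \<omega>) (normal_density 0 (sqrt (t - s)))) \<and>
     (\<forall>(n::nat) \<tau>. 0 \<le> \<tau> 0 \<and> (\<forall>i<n. \<tau> i < \<tau> (Suc i)) \<longrightarrow>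
        prob_space.indep_vars M (\<lambda>_. borel) (\<lambda>i \<omega>. B (\<tau> (Suc i)) \<omega> - B (\<tau> i) \<omega>) {..<n})"

text \<open>
  Under \<open>M\<close>, \<open>X\<close> solves \<open>dX\<^sub>t = dB\<^sub>t - a(X\<^sub>t) dt\<close> with \<open>X\<^sub>0 = x\<close>. The noise is additive, so the
  equation in integrated form involves no stochastic integral. The equation can only be
  required almost surely, because the same process \<open>X\<close> is used under all the laws
  \<open>P\<^sub>x\<close>; the paths are continuous everywhere, so that time integrals along \<open>X\<close> are measurable.
\<close>

definition solves_sde ::
  "(real \<Rightarrow> real) \<Rightarrow> real \<Rightarrow> 'w measure \<Rightarrow> (real \<Rightarrow> 'w \<Rightarrow> real) \<Rightarrow> (real \<Rightarrow> 'w \<Rightarrow> real) \<Rightarrow> bool" where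
  "solves_sde a x M B X \<longleftrightarrow>
     (\<forall>t\<ge>0. X t \<in> borel_measurable M) \<and>
     (\<forall>\<omega>\<in>space M. continuous_on {0..} (\<lambda>t. X t \<omega>)) \<and>
     (AE \<omega> in M. \<forall>t\<ge>0. X t \<omega> = x + B t \<omega> - (LBINT s:{0..t}. a (X s \<omega>)))"

definition feynman_kac ::
  "(real \<Rightarrow> real) \<Rightarrow> (real \<Rightarrow> 'w measure) \<Rightarrow> (real \<Rightarrow> 'w \<Rightarrow> real) \<Rightarrow> real \<Rightarrow> (real \<Rightarrow> real) \<Rightarrow> real \<Rightarrow> real" where
  "feynman_kac V P X t f x =
     (\<integral>\<omega>. exp (LBINT s:{0..t}. V (X s \<omega>)) * f (X t \<omega>) \<partial>P x)"

definition ell :: "(real \<Rightarrow> real) \<Rightarrow> real \<Rightarrow> real" where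
  "ell a x = (LBINT z=0..ereal x. a z)"

definition standing_assumptions :: "(real \<Rightarrow> real) \<Rightarrow> (real \<Rightarrow> real) \<Rightarrow> bool" where
  "standing_assumptions a V \<longleftrightarrow>
     a C1_differentiable_on UNIV \<and>
     (\<exists>\<beta> \<gamma>. \<forall>x. \<bar>ell a x\<bar> \<le> \<gamma> + \<beta> * \<bar>x\<bar>) \<and>
     bdd_above (range (\<lambda>x. deriv a x - (a x)\<^sup>2)) \<and>
     continuous_on UNIV V \<and>
     bdd_above (range V) \<and>
     filterlim V at_bot at_infinity \<and>
     (\<exists>E>0. \<exists>x0\<ge>0. \<forall>x. \<bar>x\<bar> \<ge> x0 \<longrightarrow> V x \<le> - E * \<bar>x\<bar>)"

definition square_integrable :: "(real \<Rightarrow> real) \<Rightarrow> bool" where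
  "square_integrable f \<longleftrightarrow> f \<in> borel_measurable lborel \<and> integrable lborel (\<lambda>x. (f x)\<^sup>2)"

definition V_tilde :: "(real \<Rightarrow> real) \<Rightarrow> (real \<Rightarrow> real) \<Rightarrow> real \<Rightarrow> real" where
  "V_tilde a V x = V x + (deriv a x - (a x)\<^sup>2) / 2"

text \<open>
  Graph of \<open>u \<mapsto> u''/2 + V_tilde u\<close> in \<open>L\<^sup>2(dx)\<close> on its maximal domain: \<open>u\<close> is differentiable, \<open>u'\<close> is
  locally absolutely continuous with almost everywhere derivative \<open>d2u\<close>, and both \<open>u\<close> and its
  image \<open>w\<close> are square integrable. As \<open>V_tilde\<close> is bounded above, this is the unique
  self-adjoint realisation. The function \<open>u\<close> is the \<open>C\<^sup>1\<close> representative of its class, whereas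
  \<open>w\<close> is determined almost everywhere only.
\<close>

definition L_tilde :: "(real \<Rightarrow> real) \<Rightarrow> (real \<Rightarrow> real) \<Rightarrow> ((real \<Rightarrow> real) \<times> (real \<Rightarrow> real)) set" where
  "L_tilde a V =
     {(u, w). square_integrable u \<and> square_integrable w \<and>
        (\<forall>x. u differentiable (at x)) \<and>
        (\<exists>d2u. (\<forall>x. interval_lebesgue_integrable lborel 0 (ereal x) d2u) \<and>
               (\<forall>x. deriv u x = deriv u 0 + (LBINT z=0..ereal x. d2u z)) \<and>
               (AE x in lborel. w x = d2u x / 2 + V_tilde a V x * u x))}"

text \<open>
  \<open>z\<close> is a resolvent value iff \<open>L_tilde u - z u = g\<close> is uniquely solvable for all \<open>g\<close> in \<open>L\<^sup>2\<close>,
  with a bounded solution operator. Since \<open>L_tilde\<close> is self-adjoint and real, its spectrum is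
  real, so only real \<open>z\<close> are considered.
\<close>

definition L_tilde_spectrum :: "(real \<Rightarrow> real) \<Rightarrow> (real \<Rightarrow> real) \<Rightarrow> real set" where
  "L_tilde_spectrum a V =
     {z. \<not> ((\<forall>g. square_integrable g \<longrightarrow> (\<exists>!u. (u, \<lambda>x. z * u x + g x) \<in> L_tilde a V)) \<and>
            (\<exists>C. \<forall>u g. square_integrable g \<and> (u, \<lambda>x. z * u x + g x) \<in> L_tilde a V \<longrightarrow>
                   (\<integral>x. (u x)\<^sup>2 \<partial>lborel) \<le> C * (\<integral>x. (g x)\<^sup>2 \<partial>lborel)))}"

definition spectral_data ::
  "(real \<Rightarrow> real) \<Rightarrow> (real \<Rightarrow> real) \<Rightarrow> (nat \<Rightarrow> real) \<Rightarrow> (nat \<Rightarrow> real \<Rightarrow> real) \<Rightarrow> bool" where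
  "spectral_data a V lam \<Psi> \<longleftrightarrow>
     L_tilde_spectrum a V = range (\<lambda>k. - lam k) \<and>
     strict_mono lam \<and> filterlim lam at_top sequentially \<and>
     (\<forall>k. \<Psi> k C1_differentiable_on UNIV \<and> deriv (\<Psi> k) C1_differentiable_on UNIV) \<and>
     (\<forall>k. (\<Psi> k, \<lambda>x. - lam k * \<Psi> k x) \<in> L_tilde a V) \<and>
     (\<forall>k u. (u, \<lambda>x. - lam k * u x) \<in> L_tilde a V \<longrightarrow> (\<exists>c. \<forall>x. u x = c * \<Psi> k x)) \<and>
     (\<forall>j k. (\<integral>x. \<Psi> j x * \<Psi> k x \<partial>lborel) = (if j = k then 1 else 0)) \<and>
     (\<forall>f. square_integrable f \<and> (\<forall>k. (\<integral>x. f x * \<Psi> k x \<partial>lborel) = 0) \<longrightarrow>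
        (AE x in lborel. f x = 0)) \<and>
     (\<forall>k. \<forall>R>0. \<Psi> k \<in> o[at_infinity](\<lambda>x. exp (- R * \<bar>x\<bar>))) \<and>
     (\<forall>x. \<Psi> 0 x > 0)"

definition Theta0 :: "(real \<Rightarrow> real) \<Rightarrow> (nat \<Rightarrow> real \<Rightarrow> real) \<Rightarrow> real \<Rightarrow> real" where
  "Theta0 a \<Psi> x = exp (ell a x) * \<Psi> 0 x"

definition qsd :: "(real \<Rightarrow> real) \<Rightarrow> (nat \<Rightarrow> real \<Rightarrow> real) \<Rightarrow> real measure" where
  "qsd a \<Psi> =
     density lborel (\<lambda>x. ennreal (Theta0 a \<Psi> x * exp (- 2 * ell a x) /
       (\<integral>y. Theta0 a \<Psi> y * exp (- 2 * ell a y) \<partial>lborel)))"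

end

theory Submission imports Defs
begin

text \<open>
  With \<open>\<Theta>\<^sub>k = exp \<ell> * \<Psi>\<^sub>k\<close> the eigenvalue equation of \<open>\<Psi>\<^sub>k\<close> becomes \<open>L \<Theta>\<^sub>k + V \<Theta>\<^sub>k = - \<lambda>\<^sub>k \<Theta>\<^sub>k\<close> for the generator
  \<open>L\<close> of \<open>X\<close>, so \<open>P\<^sub>t \<Theta>\<^sub>k = exp (- \<lambda>\<^sub>k t) \<Theta>\<^sub>k\<close>; likewise \<open>exp \<ell>\<close> is a supersolution, so
  \<open>P\<^sub>t (exp \<ell>) \<le> exp (C t) exp \<ell>\<close>. Since the noise is additive, neither fact needs a stochastic integral:
  the Euler scheme stopped outside \<open>[-R, R]\<close> converges pathwise to \<open>X\<close>, and its expectations are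
  controlled by the consistency of a single step.

  For \<open>f\<close> of class \<open>C\<^sup>2\<close> with compact support the expansion of \<open>f\<close> in the \<open>\<Psi>\<^sub>k\<close> converges uniformly.
  Multiplying by \<open>exp \<ell>\<close> and applying \<open>P\<^sub>t\<close> termwise expresses \<open>P\<^sub>t (exp \<ell> * f)\<close> as a limit of combinations
  of the \<open>\<Theta>\<^sub>k\<close>, which also shows that it is measurable in the starting point. As \<open>\<nu>\<close> annihilates every
  \<open>\<Theta>\<^sub>k\<close> with \<open>k \<noteq> 0\<close>, integration against \<open>\<nu>\<close> leaves the factor \<open>exp (- \<lambda>\<^sub>0 t)\<close>. Bounded pointwise limits
  extend the identity to all bounded measurable functions.
\<close>

section \<open>One step of the Euler scheme\<close>

text \<open>Two modes of convergence have to meet: completeness of the \<open>\<Psi> k\<close> is a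
  statement in L^2(dx), whereas the semigroup is given one starting point at a time. They meet
  because the sup norm of a combination of eigenfunctions is controlled by its L^2 norm and that of
  its image under the operator. The weight exp ell sets the scale of all errors: it may be
  unbounded, but it is integrable against \<nu> and grows at most exponentially under the semigroup.
  On the probabilistic side the drift is only locally Lipschitz, so everything is localised to paths
  staying in a compact interval, and the comparison is one-sided: a supersolution bounded below by
  -m loses at most a multiple of m times the exit probability. For bounded solutions this loss tends
  to 0, and equality follows by using f and -f; for nonnegative supersolutions it is absent from the
  start, so unbounded ones are covered.\<close>

text \<open>For small z this is Taylor's formula with the modulus of continuity of
  \<open>f2\<close>; for large z the boundedness of \<open>f\<close> wins, since every term is at
  most a multiple of z^4. The fourth power is chosen because a Gaussian increment of variance h has
  fourth moment 3 h^2, negligible against h, while \<epsilon> z^2 costs only \<epsilon> h.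
  Derivatives are asked for near [-R, R] only, so that \<open>f\<close> may be cut off further
  out.\<close>

lemma taylor_quartic_remainder:
  fixes f f1 f2 :: "real \<Rightarrow> real"
  assumes d1: "\<And>y. \<bar>y\<bar> \<le> R + 1 \<Longrightarrow> (f has_real_derivative f1 y) (at y)"
    and d2: "\<And>y. \<bar>y\<bar> \<le> R + 1 \<Longrightarrow> (f1 has_real_derivative f2 y) (at y)"
    and c2: "continuous_on {-R-1..R+1} f2"
    and bd: "\<And>y. \<bar>f y\<bar> \<le> M" and e: "\<epsilon> > 0"
  shows "\<exists>K\<ge>0. \<forall>y z. \<bar>y\<bar> \<le> R \<longrightarrow> \<bar>f (y + z) - f y - f1 y * z - f2 y * z\<^sup>2 / 2\<bar> \<le> \<epsilon> * z\<^sup>2 + K * z ^ 4"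
proof -
  have "uniformly_continuous_on {-R-1..R+1} f2"
    by (intro compact_uniformly_continuous c2) simp
  then obtain d where d: "d > 0" "\<And>u v. u \<in> {-R-1..R+1} \<Longrightarrow> v \<in> {-R-1..R+1} \<Longrightarrow> dist v u < d \<Longrightarrow> dist (f2 v) (f2 u) < \<epsilon>"
    using e unfolding uniformly_continuous_on_def by meson
  \<comment> \<open>The bound 1 keeps the intermediate Taylor point inside [-R-1, R+1], where the
    derivatives are known.\<close>
  define \<delta> where "\<delta> = min d 1"
  have \<delta>: "\<delta> > 0" "\<delta> \<le> 1" "\<delta> \<le> d" using d(1) by (auto simp: \<delta>_def)
  have c1: "continuous_on {-R-1..R+1} f1"
    by (intro continuous_at_imp_continuous_on ballI) (auto intro!: DERIV_isCont[OF d2])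
  have "bounded (f1 ` {-R-1..R+1})" "bounded (f2 ` {-R-1..R+1})"
    by (intro compact_imp_bounded compact_continuous_image c1 c2; simp)+
  then obtain F1 F2 where F: "\<And>y. \<bar>y\<bar> \<le> R \<Longrightarrow> \<bar>f1 y\<bar> \<le> F1" "\<And>y. \<bar>y\<bar> \<le> R \<Longrightarrow> \<bar>f2 y\<bar> \<le> F2"
    unfolding bounded_iff by (force simp: abs_le_iff)
  have M0: "M \<ge> 0" using bd[of 0] by linarith
  \<comment> \<open>With w = |z| / \<delta> \<ge> 1 the powers 1, w and w^2 are at most w^4; the
    three summands are the resulting coefficients of z^4 for the terms in \<open>f\<close>,
    \<open>f1\<close> and \<open>f2\<close>.\<close>
  define K where "K = 2*M/\<delta>^4 + \<bar>F1\<bar>/\<delta>^3 + \<bar>F2\<bar>/\<delta>^2"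
  have "K \<ge> 0" using M0 \<delta> by (auto simp: K_def)
  moreover have "\<bar>f (y + z) - f y - f1 y * z - f2 y * z\<^sup>2 / 2\<bar> \<le> \<epsilon> * z\<^sup>2 + K * z ^ 4" if y: "\<bar>y\<bar> \<le> R" for y z
  proof (cases "\<bar>z\<bar> < \<delta>")
    case True
    show ?thesis
    proof (cases "z = 0")
      case False
      define df where "df = (\<lambda>m::nat. if m = 0 then f else if m = 1 then f1 else f2)"
      have *: "\<forall>m t. m < 2 \<and> min y (y+z) \<le> t \<and> t \<le> max y (y+z) \<longrightarrow> DERIV (df m) t :> df (Suc m) t"
      proof (intro allI impI)
        fix m::nat and t assume a: "m < 2 \<and> min y (y+z) \<le> t \<and> t \<le> max y (y+z)"
        hence "\<bar>t\<bar> \<le> R + 1" using y True \<delta> by (auto simp: abs_le_iff min_def max_def split: if_splits)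
        with a show "DERIV (df m) t :> df (Suc m) t"
          using d1[of t] d2[of t] by (auto simp: df_def)
      qed
      from Taylor[of 2 df f "min y (y+z)" "max y (y+z)" y "y+z", OF _ _ *] False
      obtain t where t: "if y + z < y then y + z < t \<and> t < y else y < t \<and> t < y+z"
        "f (y+z) = (\<Sum>m<2. (df m y / fact m) * (y+z-y)^m) + (df 2 t / fact 2) * (y+z-y)^2"
        by (auto simp: df_def)
      have "f (y+z) = f y + f1 y * z + f2 t / 2 * z\<^sup>2"
        using t(2) by (simp add: df_def numeral_2_eq_2)
      hence eq: "f (y + z) - f y - f1 y * z - f2 y * z\<^sup>2 / 2 = (f2 t - f2 y) / 2 * z\<^sup>2"
        by (simp add: algebra_simps)
      have "dist (f2 t) (f2 y) < \<epsilon>" 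
        by (rule d(2)) (use t(1) y True \<delta> in \<open>auto simp: dist_real_def split: if_splits\<close>)
      hence "\<bar>(f2 t - f2 y) / 2\<bar> \<le> \<epsilon>" by (simp add: dist_real_def)
      hence "\<bar>(f2 t - f2 y) / 2 * z\<^sup>2\<bar> \<le> \<epsilon> * z\<^sup>2" 
        unfolding abs_mult by (intro mult_mono) auto
      thus ?thesis using \<open>K \<ge> 0\<close> unfolding eq by (simp add: add_increasing2)
    qed simp
  next
    case False
    define w where "w = \<bar>z\<bar> / \<delta>"
    have w: "w \<ge> 1" "\<bar>z\<bar> = w * \<delta>" using False \<delta> by (auto simp: w_def)
    have z: "z\<^sup>2 = w\<^sup>2 * \<delta>\<^sup>2" "z^4 = w^4 * \<delta>^4"
      using w(2) by (metis power2_abs power_mult_distrib, metis power_even_abs_numeral even_numeral power_mult_distrib)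
    have p: "1 \<le> w^4" "w \<le> w^4" "w\<^sup>2 \<le> w^4"
      using w(1) power_increasing[of 0 4 w] power_increasing[of 1 4 w] power_increasing[of 2 4 w] by auto
    have "\<bar>f (y + z) - f y - f1 y * z - f2 y * z\<^sup>2 / 2\<bar> \<le> \<bar>f (y+z)\<bar> + \<bar>f y\<bar> + \<bar>f1 y * z\<bar> + \<bar>f2 y * z\<^sup>2 / 2\<bar>" 
      by linarith
    also have "\<dots> \<le> M + M + \<bar>F1\<bar> * \<bar>z\<bar> + \<bar>F2\<bar> * z\<^sup>2"
    proof (intro add_mono bd)
      show "\<bar>f1 y * z\<bar> \<le> \<bar>F1\<bar> * \<bar>z\<bar>" using F(1)[OF y] by (auto simp: abs_mult intro!: mult_right_mono)
      have "\<bar>f2 y * z\<^sup>2 / 2\<bar> \<le> \<bar>f2 y\<bar> * z\<^sup>2" by (simp add: abs_mult)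
      also have "\<dots> \<le> \<bar>F2\<bar> * z\<^sup>2" using F(2)[OF y] by (auto intro!: mult_right_mono)
      finally show "\<bar>f2 y * z\<^sup>2 / 2\<bar> \<le> \<bar>F2\<bar> * z\<^sup>2" .
    qed
    also have "\<dots> = 2 * M * 1 + \<bar>F1\<bar> * \<delta> * w + \<bar>F2\<bar> * \<delta>\<^sup>2 * w\<^sup>2" using w z by simp
    also have "\<dots> \<le> 2 * M * w^4 + \<bar>F1\<bar> * \<delta> * w^4 + \<bar>F2\<bar> * \<delta>\<^sup>2 * w^4"
      using p M0 \<delta> by (intro add_mono mult_left_mono) auto
    also have "\<dots> = K * z^4" using \<delta>(1) unfolding K_def z
      by (simp add: field_simps power2_eq_square power3_eq_cube eval_nat_numeral)
    also have "\<dots> \<le> \<epsilon> * z\<^sup>2 + K * z^4" using e by simp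
    finally show ?thesis .
  qed
  ultimately show ?thesis by blast
qed

section \<open>Gaussian increments and the consistency of one Euler step\<close>

definition gauss :: "real \<Rightarrow> real measure" where
  "gauss h = density lborel (normal_density 0 (sqrt h))"

lemma sets_gauss [simp, measurable_cong]: "sets (gauss h) = sets borel"
  and space_gauss [simp]: "space (gauss h) = UNIV"
  by (simp_all add: gauss_def)

lemma prob_space_gauss: "h > 0 \<Longrightarrow> prob_space (gauss h)"
  unfolding gauss_def by (intro prob_space_normal_density) simp

lemma gauss_moments:
  assumes h: "h > 0"
  shows "has_bochner_integral (gauss h) (\<lambda>z. z) 0"
    "has_bochner_integral (gauss h) (\<lambda>z. z^2) h"
    "has_bochner_integral (gauss h) (\<lambda>z. z^3) 0"
    "has_bochner_integral (gauss h) (\<lambda>z. z^4) (3 * h\<^sup>2)"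
proof -
  have s: "sqrt h > 0" using h by simp
  have [simp]: "(sqrt h)\<^sup>2 = h" using h by simp
  show "has_bochner_integral (gauss h) (\<lambda>z. z) 0"
    "has_bochner_integral (gauss h) (\<lambda>z. z^2) h"
    "has_bochner_integral (gauss h) (\<lambda>z. z^3) 0"
    "has_bochner_integral (gauss h) (\<lambda>z. z^4) (3 * h\<^sup>2)"
    using normal_moment_odd[OF s, of 0 0] normal_moment_even[OF s, of 0 1]
       normal_moment_odd[OF s, of 0 1] normal_moment_even[OF s, of 0 2] h
    by (auto simp: gauss_def has_bochner_integral_density fact_numeral numeral_3_eq_3[symmetric] power_divide)
qed

text \<open>Here b is the displacement by the drift. Odd Gaussian moments vanish, which leaves b^2 +
  h and b^4 + 6 b^2 h + 3 h^2 as second and fourth moments of b + z. A cubic term is absent because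
  the Taylor bound has none.\<close>

lemma gauss_quartic:
  assumes h: "h > 0"
  shows "has_bochner_integral (gauss h) (\<lambda>z. c0 + c1 * (b + z) + c2 * (b + z)\<^sup>2 + c4 * (b + z)^4)
     (c0 + c1 * b + c2 * (b\<^sup>2 + h) + c4 * (b^4 + 6 * b\<^sup>2 * h + 3 * h\<^sup>2))"
proof -
  interpret prob_space "gauss h" by (rule prob_space_gauss[OF h])
  have 1: "has_bochner_integral (gauss h) (\<lambda>z. c) c" for c :: real
    using has_bochner_integral_integrable[of "gauss h" "\<lambda>_. c"] using prob_space by simp
  note m = gauss_moments[OF h]
  have "has_bochner_integral (gauss h) 
     (\<lambda>z. (c0 + c1 * b + c2 * b\<^sup>2 + c4 * b^4) + ((c1 + c2 * 2 * b + c4 * 4 * b^3) * z + ((c2 + c4 * 6 * b\<^sup>2) * z\<^sup>2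
       + ((c4 * 4 * b) * z^3 + c4 * z^4))))
     ((c0 + c1 * b + c2 * b\<^sup>2 + c4 * b^4) + ((c1 + c2 * 2 * b + c4 * 4 * b^3) * 0 + ((c2 + c4 * 6 * b\<^sup>2) * h
       + ((c4 * 4 * b) * 0 + c4 * (3 * h\<^sup>2)))))"
    by (intro has_bochner_integral_add has_bochner_integral_mult_right m 1)
  then show ?thesis by (simp add: algebra_simps power2_eq_square power3_eq_cube eval_nat_numeral)
qed

lemma continuous_on_interval_bounded:
  fixes g :: "real \<Rightarrow> real"
  assumes "continuous_on {-R..R} g"
  shows "\<exists>F. \<forall>y. \<bar>y\<bar> \<le> R \<longrightarrow> \<bar>g y\<bar> \<le> F"
proof -
  have "bounded (g ` {-R..R})" by (intro compact_imp_bounded compact_continuous_image assms) simp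
  then obtain F where "\<forall>y\<in>{-R..R}. \<bar>g y\<bar> \<le> F" unfolding bounded_iff by auto
  thus ?thesis by (intro exI[of _ F]) (simp add: abs_le_iff)
qed

lemma exp_mult_quadratic_bound:
  fixes h w A :: real
  assumes "0 \<le> h" "h \<le> 1" "\<bar>w\<bar> \<le> A"
  shows "\<bar>exp (h * w) - 1 - h * w\<bar> \<le> A\<^sup>2 * exp A * h\<^sup>2"
proof -
  obtain t where t: "\<bar>t\<bar> \<le> \<bar>h * w\<bar>" "exp (h * w) = (\<Sum>m<2. (h * w) ^ m / fact m) + exp t / fact 2 * (h * w)\<^sup>2"
    using Maclaurin_exp_le by blast
  have hw: "\<bar>h * w\<bar> \<le> A" using assms mult_mono[of "\<bar>h\<bar>" 1 "\<bar>w\<bar>" A] by (simp add: abs_mult)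
  have eq: "exp (h * w) - 1 - h * w = exp t / 2 * (h * w)\<^sup>2" using t(2) by (simp add: numeral_2_eq_2)
  have "\<bar>exp (h * w) - 1 - h * w\<bar> = exp t / 2 * w\<^sup>2 * h\<^sup>2" unfolding eq by (simp add: power_mult_distrib abs_mult del: abs_divide)
  also have "\<dots> \<le> exp A * A\<^sup>2 * h\<^sup>2"
  proof (intro mult_right_mono mult_mono)
    have "exp t \<le> exp A" using t(1) hw by simp
    thus "exp t / 2 \<le> exp A" using exp_gt_zero[of t] by linarith
    show "w\<^sup>2 \<le> A\<^sup>2" using power_mono[OF assms(3), of 2] by simp
  qed auto
  finally show ?thesis by (simp add: mult.commute)
qed

text \<open>The expected value expands as f + h (f''/2 - a f' + W f) plus errors, and the generator
  inequality disposes of the first-order term. The error is \<epsilon> h instead of O(h^2) since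
  \<open>f2\<close> is merely continuous; this is enough, because only t / h such errors are added
  up.\<close>

lemma euler_step_consistent:
  fixes a W f f1 f2 :: "real \<Rightarrow> real"
  assumes d1: "\<And>y. \<bar>y\<bar> \<le> R + 1 \<Longrightarrow> (f has_real_derivative f1 y) (at y)"
    and d2: "\<And>y. \<bar>y\<bar> \<le> R + 1 \<Longrightarrow> (f1 has_real_derivative f2 y) (at y)"
    and c2: "continuous_on {-R-1..R+1} f2"
    and fm[measurable]: "f \<in> borel_measurable borel" and bd: "\<And>y. \<bar>f y\<bar> \<le> M"
    and ca: "continuous_on UNIV a" and cW: "continuous_on UNIV W"
    and gen: "\<And>y. \<bar>y\<bar> \<le> R \<Longrightarrow> f2 y / 2 - a y * f1 y + W y * f y \<le> 0"
    and e: "\<epsilon> > 0"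
  shows "\<exists>h0>0. \<forall>h y. 0 < h \<and> h \<le> h0 \<and> \<bar>y\<bar> \<le> R \<longrightarrow>
     exp (h * W y) * (\<integral>z. f (y - h * a y + z) \<partial>gauss h) \<le> f y + \<epsilon> * h"
proof -
  have c1: "continuous_on {-R-1..R+1} f1"
    by (intro continuous_at_imp_continuous_on ballI) (auto intro!: DERIV_isCont[OF d2])
  have sub: "{-R..R} \<subseteq> {-R-1..R+1}" by auto
  obtain F1 where F1: "\<And>y. \<bar>y\<bar> \<le> R \<Longrightarrow> \<bar>f1 y\<bar> \<le> F1"
    using continuous_on_interval_bounded[OF continuous_on_subset[OF c1 sub]] by blast
  obtain F2 where F2: "\<And>y. \<bar>y\<bar> \<le> R \<Longrightarrow> \<bar>f2 y\<bar> \<le> F2"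
    using continuous_on_interval_bounded[OF continuous_on_subset[OF c2 sub]] by blast
  obtain F3 where F3: "\<And>y. \<bar>y\<bar> \<le> R \<Longrightarrow> \<bar>a y\<bar> \<le> F3"
    using continuous_on_interval_bounded[OF continuous_on_subset[OF ca subset_UNIV]] by blast
  obtain F4 where F4: "\<And>y. \<bar>y\<bar> \<le> R \<Longrightarrow> \<bar>W y\<bar> \<le> F4"
    using continuous_on_interval_bounded[OF continuous_on_subset[OF cW subset_UNIV]] by blast
  define A where "A = max 1 (max M (max F1 (max F2 (max F3 F4))))"
  have M0: "M \<ge> 0" using bd[of 0] by linarith
  have FA: "F1 \<le> A" "F2 \<le> A" "F3 \<le> A" "F4 \<le> A" "M \<le> A"
    unfolding A_def by (simp_all only: le_max_iff_disj order_refl simp_thms)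
  have A: "\<bar>f1 y\<bar> \<le> A" "\<bar>f2 y\<bar> \<le> A" "\<bar>a y\<bar> \<le> A" "\<bar>W y\<bar> \<le> A" "\<bar>f y\<bar> \<le> A" if "\<bar>y\<bar> \<le> R" for y
    by (rule order_trans[OF F1[OF that] FA(1)] order_trans[OF F2[OF that] FA(2)] order_trans[OF F3[OF that] FA(3)]
      order_trans[OF F4[OF that] FA(4)] order_trans[OF bd FA(5)])+
  have A1: "A \<ge> 1" unfolding A_def by (rule max.cobounded1)
  \<comment> \<open>The \<epsilon>' h of the Taylor remainder is later multiplied by exp (h W) \<le>
    exp A, which makes it \<epsilon> h / 2.\<close>
  define \<epsilon>' where "\<epsilon>' = \<epsilon> / (2 * exp A)"
  have e': "\<epsilon>' > 0" using e by (simp add: \<epsilon>'_def)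
  obtain K where K: "K \<ge> 0" "\<And>y z. \<bar>y\<bar> \<le> R \<Longrightarrow> \<bar>f (y + z) - f y - f1 y * z - f2 y * z\<^sup>2 / 2\<bar> \<le> \<epsilon>' * z\<^sup>2 + K * z ^ 4"
    using taylor_quartic_remainder[OF d1 d2 c2 bd e'] by blast
  \<comment> \<open>\<open>D\<close> collects the h^2 terms of the Gaussian expectation,
    \<open>D'\<close> those of expanding exp (h W). The choice of \<open>h0\<close> makes C h^2 at
    most \<epsilon> h / 2, the other half of the allowance.\<close>
  define D where "D = A * A\<^sup>2 / 2 + \<epsilon>' * A\<^sup>2 + K * (A^4 + 6 * A\<^sup>2 + 3)"
  define D' where "D' = A\<^sup>2 * exp A * A + (A + A\<^sup>2 * exp A) * (A / 2 + A * A)"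
  define C where "C = exp A * D + D'"
  have D0: "D \<ge> 0" unfolding D_def using A1 K(1) e' by (intro add_nonneg_nonneg mult_nonneg_nonneg) auto
  have D'0: "D' > 0" unfolding D'_def using A1 
    by (intro add_nonneg_pos mult_nonneg_nonneg mult_pos_pos add_pos_pos) auto
  have C0: "C > 0" unfolding C_def using D0 D'0 by (intro add_nonneg_pos) auto
  define h0 where "h0 = min 1 (\<epsilon> / (2 * C))"
  have h0: "h0 > 0" using C0 e by (simp add: h0_def)
  have "exp (h * W y) * (\<integral>z. f (y - h * a y + z) \<partial>gauss h) \<le> f y + \<epsilon> * h" 
    if h: "0 < h" "h \<le> h0" and y: "\<bar>y\<bar> \<le> R" for h y
  proof -
    note A = A[OF y]
    have h1: "h \<le> 1" "C * h \<le> \<epsilon> / 2" using h C0 by (auto simp: h0_def field_simps)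
    have h2: "h\<^sup>2 \<le> 1" "h^4 \<le> h\<^sup>2" "h^3 \<le> h\<^sup>2" using h(1) h1 power_decreasing[of 0 2 h] power_decreasing[of 2 4 h] power_decreasing[of 2 3 h] by auto
    define b where "b = - h * a y"
    have "\<bar>b\<bar> \<le> h * A" using A(3) h by (auto simp: b_def abs_mult intro!: mult_left_mono)
    hence "\<bar>b\<bar>\<^sup>2 \<le> (h * A)\<^sup>2" by (intro power_mono) auto
    hence b2: "b\<^sup>2 \<le> A\<^sup>2 * h\<^sup>2" by (simp add: power_mult_distrib mult.commute)
    have "b^4 = (b\<^sup>2)\<^sup>2" by simp
    also have "\<dots> \<le> (A\<^sup>2 * h\<^sup>2)\<^sup>2" by (intro power_mono b2) auto
    also have "\<dots> = A^4 * h^4" by (simp add: power_mult_distrib)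
    also have "\<dots> \<le> A^4 * h\<^sup>2" using h2 A1 by (intro mult_left_mono) auto
    finally have b4: "b^4 \<le> A^4 * h\<^sup>2" .
    have b2h: "b\<^sup>2 * h \<le> A\<^sup>2 * h\<^sup>2"
      using b2 h h1 mult_left_le[of h "b\<^sup>2"] by auto
    interpret prob_space "gauss h" by (rule prob_space_gauss[OF h(1)])
    have "(\<integral>z. f (y + (b + z)) \<partial>gauss h) \<le> (\<integral>z. f y + f1 y * (b + z) + (f2 y / 2 + \<epsilon>') * (b + z)\<^sup>2 + K * (b + z)^4 \<partial>gauss h)"
    proof (rule integral_mono)
      show "integrable (gauss h) (\<lambda>z. f (y + (b + z)))"
        by (rule integrable_const_bound[of _ M]) (auto simp: bd)
      show "integrable (gauss h) (\<lambda>z. f y + f1 y * (b + z) + (f2 y / 2 + \<epsilon>') * (b + z)\<^sup>2 + K * (b + z)^4)"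
        using gauss_quartic[OF h(1)] by (rule has_bochner_integral_iff[THEN iffD1, THEN conjunct1])
      show "f (y + (b + z)) \<le> f y + f1 y * (b + z) + (f2 y / 2 + \<epsilon>') * (b + z)\<^sup>2 + K * (b + z)^4" for z
        using K(2)[OF y, of "b+z"] unfolding abs_le_iff by (simp add: algebra_simps)
    qed
    also have "\<dots> = f y + f1 y * b + (f2 y / 2 + \<epsilon>') * (b\<^sup>2 + h) + K * (b^4 + 6 * b\<^sup>2 * h + 3 * h\<^sup>2)"
      by (rule has_bochner_integral_integral_eq[OF gauss_quartic[OF h(1)]])
    also have "\<dots> = (f y + h * (f2 y / 2 - a y * f1 y)) + (\<epsilon>' * h + (f2 y / 2 * b\<^sup>2 + \<epsilon>' * b\<^sup>2 + K * (b^4 + 6 * (b\<^sup>2 * h) + 3 * h\<^sup>2)))"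
      unfolding b_def by (simp add: algebra_simps)
    finally have I0: "(\<integral>z. f (y + (b + z)) \<partial>gauss h) \<le> \<dots>" .
    have "f2 y / 2 * b\<^sup>2 + \<epsilon>' * b\<^sup>2 + K * (b^4 + 6 * (b\<^sup>2 * h) + 3 * h\<^sup>2)
       \<le> A / 2 * (A\<^sup>2 * h\<^sup>2) + \<epsilon>' * (A\<^sup>2 * h\<^sup>2) + K * (A^4 * h\<^sup>2 + 6 * (A\<^sup>2 * h\<^sup>2) + 3 * h\<^sup>2)"
      proof (intro add_mono)
      show "f2 y / 2 * b\<^sup>2 \<le> A / 2 * (A\<^sup>2 * h\<^sup>2)" using A A1 b2 by (intro mult_mono) auto
      show "\<epsilon>' * b\<^sup>2 \<le> \<epsilon>' * (A\<^sup>2 * h\<^sup>2)" using e' b2 by simp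
      show "K * (b^4 + 6 * (b\<^sup>2 * h) + 3 * h\<^sup>2) \<le> K * (A^4 * h\<^sup>2 + 6 * (A\<^sup>2 * h\<^sup>2) + 3 * h\<^sup>2)"
        using K(1) b4 b2h by (intro mult_left_mono) auto
    qed
    also have "\<dots> = D * h\<^sup>2"
      unfolding D_def by (simp add: algebra_simps)
    finally have I1: "(\<integral>z. f (y + (b + z)) \<partial>gauss h) \<le> (f y + h * (f2 y / 2 - a y * f1 y)) + (\<epsilon>' * h + D * h\<^sup>2)"
      using I0 by linarith
    have "y + (b + z) = y - h * a y + z" for z by (simp add: b_def)
    with I1 have I: "(\<integral>z. f (y - h * a y + z) \<partial>gauss h) \<le> (f y + h * (f2 y / 2 - a y * f1 y)) + (\<epsilon>' * h + D * h\<^sup>2)"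
      by simp
    define r where "r = exp (h * W y) - 1 - h * W y"
    have r: "\<bar>r\<bar> \<le> A\<^sup>2 * exp A * h\<^sup>2" unfolding r_def by (rule exp_mult_quadratic_bound) (use h h1 A in auto)
    have E: "exp (h * W y) \<le> exp A" 
    proof -
      have "h * W y \<le> h * A" using A(4) h by (intro mult_left_mono) auto
      also have "\<dots> \<le> 1 * A" using h1 A1 by (intro mult_right_mono) auto
      finally show ?thesis by simp
    qed
    define g where "g = f2 y / 2 - a y * f1 y"
    have "\<bar>f2 y / 2\<bar> \<le> A / 2" using A by auto
    moreover have "\<bar>a y * f1 y\<bar> \<le> A * A" unfolding abs_mult using A A1 by (intro mult_mono) auto
    ultimately have g: "\<bar>g\<bar> \<le> A / 2 + A * A" unfolding g_def by linarith
    have "exp (h * W y) * (\<integral>z. f (y - h * a y + z) \<partial>gauss h) \<le> exp (h * W y) * ((f y + h * g) + (\<epsilon>' * h + D * h\<^sup>2))"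
      using I by (intro mult_left_mono) (auto simp: g_def)
    also have "\<dots> = exp (h * W y) * (f y + h * g) + exp (h * W y) * (\<epsilon>' * h + D * h\<^sup>2)" by (rule distrib_left)
    finally have J: "exp (h * W y) * (\<integral>z. f (y - h * a y + z) \<partial>gauss h) \<le> \<dots>" .
    have "exp (h * W y) * (\<epsilon>' * h + D * h\<^sup>2) \<le> exp A * (\<epsilon>' * h + D * h\<^sup>2)"
      using E D0 e' h by (intro mult_right_mono) auto
    also have "\<dots> = \<epsilon> / 2 * h + exp A * D * h\<^sup>2" by (simp add: \<epsilon>'_def algebra_simps)
    finally have J1: "exp (h * W y) * (\<epsilon>' * h + D * h\<^sup>2) \<le> \<epsilon> / 2 * h + exp A * D * h\<^sup>2" .
    \<comment> \<open>Write exp (h W) = 1 + h W + r: the leading value, h times the generator with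
      potential, and a rest of order h^2.\<close>
    have J2: "exp (h * W y) * (f y + h * g) = f y + h * (g + W y * f y) + (r * f y + (h * W y + r) * (h * g))"
      unfolding r_def by (simp add: algebra_simps)
    have J3: "h * (g + W y * f y) \<le> 0" using gen[OF y] h by (auto simp: g_def intro!: mult_nonneg_nonpos)
    have J4: "r * f y + (h * W y + r) * (h * g) \<le> D' * h\<^sup>2"
    proof -
      have "\<bar>r * f y\<bar> \<le> (A\<^sup>2 * exp A * h\<^sup>2) * A" unfolding abs_mult using r A A1 by (intro mult_mono) auto
      moreover have "\<bar>(h * W y + r) * (h * g)\<bar> \<le> ((A + A\<^sup>2 * exp A) * h) * (h * (A / 2 + A * A))"
        unfolding abs_mult[of "h * W y + r"]
      proof (rule mult_mono)
        have "\<bar>h * W y\<bar> \<le> h * A" using A h by (auto simp: abs_mult)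
        moreover have "\<bar>r\<bar> \<le> A\<^sup>2 * exp A * h" 
        proof -
          have "A\<^sup>2 * exp A * h\<^sup>2 \<le> A\<^sup>2 * exp A * h"
            using h h1 mult_left_le[of h h] by (intro mult_left_mono) (auto simp: power2_eq_square)
          with r show ?thesis by linarith
        qed
        ultimately show "\<bar>h * W y + r\<bar> \<le> (A + A\<^sup>2 * exp A) * h" by (simp add: algebra_simps)
        show "\<bar>h * g\<bar> \<le> h * (A / 2 + A * A)" using g h by (auto simp: abs_mult intro!: mult_left_mono)
      qed (use A1 h in auto)
      ultimately have "r * f y + (h * W y + r) * (h * g) \<le> (A\<^sup>2 * exp A * h\<^sup>2) * A + ((A + A\<^sup>2 * exp A) * h) * (h * (A / 2 + A * A))" by linarith
      also have "\<dots> = D' * h\<^sup>2" unfolding D'_def by (simp add: algebra_simps power2_eq_square)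
      finally show ?thesis .
    qed
    have "C * h * h = exp A * D * h\<^sup>2 + D' * h\<^sup>2" by (simp add: C_def algebra_simps power2_eq_square)
    moreover have "C * h * h \<le> \<epsilon> / 2 * h" using h h1 by (intro mult_right_mono) auto
    ultimately show ?thesis using J J1 J2 J3 J4 by linarith
  qed
  with h0 show ?thesis by blast
qed


section \<open>The stopped Euler scheme\<close>

text \<open>Position and weight freeze together: a frozen state keeps its value of weight times f,
  so the one-step inequality persists after the exit, and only values of a and W on [-R, R]
  enter.\<close>

definition euler_step :: "(real \<Rightarrow> real) \<Rightarrow> (real \<Rightarrow> real) \<Rightarrow> real \<Rightarrow> real \<Rightarrow> real \<times> real \<Rightarrow> real \<Rightarrow> real \<times> real" where
  "euler_step a W R h p z =
     (if \<bar>fst p\<bar> \<le> R then (fst p - h * a (fst p) + z, snd p * exp (h * W (fst p))) else p)"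

text \<open>Euler scheme of step \<open>h\<close> with noise \<open>z\<close>, frozen after leaving \<open>[-R, R]\<close>; the second component is the discretised Feynman-Kac weight.\<close>

primrec euler :: "(real \<Rightarrow> real) \<Rightarrow> (real \<Rightarrow> real) \<Rightarrow> real \<Rightarrow> real \<Rightarrow> real \<Rightarrow> (nat \<Rightarrow> real) \<Rightarrow> nat \<Rightarrow> real \<times> real" where
  "euler a W R h x z 0 = (x, 1)"
| "euler a W R h x z (Suc i) = euler_step a W R h (euler a W R h x z i) (z i)"

lemma euler_cong: "(\<And>j. j < i \<Longrightarrow> z j = z' j) \<Longrightarrow> euler a W R h x z i = euler a W R h x z' i"
  by (induction i) auto

lemma euler_weight_bounds:
  assumes "\<And>y. W y \<le> w" "h \<ge> 0" "w \<ge> 0"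
  shows "0 \<le> snd (euler a W R h x z i)" "snd (euler a W R h x z i) \<le> exp (w * h * real i)"
proof (induction i)
  case (Suc i)
  { case 1 show ?case using Suc by (simp add: euler_step_def) }
  { case 2 
    have "snd (euler a W R h x z i) * exp (h * W y) \<le> exp (w * h * real i) * exp (h * w)" for y
      using Suc assms by (intro mult_mono) (auto intro!: mult_left_mono)
    moreover have "exp (w * h * real i) \<le> exp (w * h * real (Suc i))" using assms by (auto intro!: mult_left_mono)
    moreover have "exp (w * h * real i) * exp (h * w) = exp (w * h * real (Suc i))"
      by (simp add: exp_add[symmetric] algebra_simps)
    ultimately show ?case using Suc(2) 
      by (cases "\<bar>fst (euler a W R h x z i)\<bar> \<le> R") (auto simp: euler_step_def simp del: of_nat_Suc intro: order_trans) }
qed auto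

lemma euler_step_measurable:
  assumes [measurable]: "a \<in> borel_measurable borel" "W \<in> borel_measurable borel"
  shows "(\<lambda>q. euler_step a W R h (fst q) (snd q)) \<in> measurable ((borel \<Otimes>\<^sub>M borel) \<Otimes>\<^sub>M borel) (borel \<Otimes>\<^sub>M borel)"
  unfolding euler_step_def by measurable

lemma euler_measurable:
  assumes a: "a \<in> borel_measurable borel" "W \<in> borel_measurable borel" and "i \<le> n"
  shows "(\<lambda>z. euler a W R h x z i) \<in> measurable (PiM {..<n} (\<lambda>_. borel)) (borel \<Otimes>\<^sub>M borel)"
  using \<open>i \<le> n\<close>
proof (induction i)
  case (Suc i)
  hence [measurable]: "(\<lambda>z. euler a W R h x z i) \<in> measurable (PiM {..<n} (\<lambda>_. borel)) (borel \<Otimes>\<^sub>M borel)" by simp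
  have [measurable]: "(\<lambda>z. z i) \<in> measurable (PiM {..<n} (\<lambda>_. borel)) (borel :: real measure)"
    using Suc by (intro measurable_component_singleton) auto
  show ?case 
    using measurable_compose[OF _ euler_step_measurable[OF a], 
       of "\<lambda>z. (euler a W R h x z i, z i)" "PiM {..<n} (\<lambda>_. borel)"] by simp
qed simp

text \<open>Takes the place of conditioning on \<open>U\<close>: by independence the joint law is a
  product, and Fubini's theorem integrates \<open>\<xi>\<close> out with the past held
  fixed.\<close>

lemma (in prob_space) expectation_indep_integrate_out:
  fixes F :: "'b \<times> 'b \<Rightarrow> real"
  assumes ind: "indep_var S U T \<xi>" and F[measurable]: "F \<in> borel_measurable (S \<Otimes>\<^sub>M T)"
    and bd: "\<And>\<omega>. \<omega> \<in> space M \<Longrightarrow> \<bar>F (U \<omega>, \<xi> \<omega>)\<bar> \<le> C"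
    and G[measurable]: "G \<in> borel_measurable S" and Gi: "integrable M (\<lambda>\<omega>. G (U \<omega>))"
    and FG: "\<And>u. u \<in> space S \<Longrightarrow> expectation (\<lambda>\<omega>. F (u, \<xi> \<omega>)) \<le> G u"
  shows "expectation (\<lambda>\<omega>. F (U \<omega>, \<xi> \<omega>)) \<le> expectation (\<lambda>\<omega>. G (U \<omega>))"
proof -
  have rv[measurable]: "random_variable S U" "random_variable T \<xi>" 
    and eq: "distr M S U \<Otimes>\<^sub>M distr M T \<xi> = distr M (S \<Otimes>\<^sub>M T) (\<lambda>x. (U x, \<xi> x))"
    using ind unfolding indep_var_distribution_eq by auto
  interpret A: prob_space "distr M S U" by (rule prob_space_distr) fact
  interpret B: prob_space "distr M T \<xi>" by (rule prob_space_distr) fact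
  interpret AB: pair_prob_space "distr M S U" "distr M T \<xi>" ..
  have "integrable M (\<lambda>\<omega>. F (U \<omega>, \<xi> \<omega>))"
    by (rule integrable_const_bound[of _ C]) (use bd in auto)
  hence int: "integrable (distr M S U \<Otimes>\<^sub>M distr M T \<xi>) F"
    unfolding eq by (subst integrable_distr_eq) auto
  have "expectation (\<lambda>\<omega>. F (U \<omega>, \<xi> \<omega>)) = (\<integral>p. F p \<partial>(distr M S U \<Otimes>\<^sub>M distr M T \<xi>))"
    unfolding eq by (subst integral_distr) auto
  also have "\<dots> = (\<integral>u. \<integral>z. F (u, z) \<partial>distr M T \<xi> \<partial>distr M S U)"
    by (rule AB.integral_fst'[OF int, symmetric])
  also have "\<dots> \<le> (\<integral>u. G u \<partial>distr M S U)"
  proof (rule integral_mono)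
    show "integrable (distr M S U) (\<lambda>u. \<integral>z. F (u, z) \<partial>distr M T \<xi>)" by (rule AB.integrable_fst'[OF int])
    show "integrable (distr M S U) G" using Gi by (subst integrable_distr_eq) auto
    fix u assume u: "u \<in> space (distr M S U)"
    hence [measurable]: "(\<lambda>z. F (u, z)) \<in> borel_measurable T" by simp
    have "(\<integral>z. F (u, z) \<partial>distr M T \<xi>) = expectation (\<lambda>\<omega>. F (u, \<xi> \<omega>))" by (rule integral_distr) auto
    also have "\<dots> \<le> G u" using FG u by simp
    finally show "(\<integral>z. F (u, z) \<partial>distr M T \<xi>) \<le> G u" .
  qed
  also have "\<dots> = expectation (\<lambda>\<omega>. G (U \<omega>))" by (subst integral_distr) auto
  finally show ?thesis .
qed

text \<open>Up to an error c per step, weight times f along the scheme is a supermartingale. Each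
  error is multiplied by a weight of at most exp (w h n), and there are n of them.\<close>

lemma (in prob_space) euler_expectation:
  fixes f :: "real \<Rightarrow> real" and x :: real
  assumes ind: "indep_vars (\<lambda>_. borel) \<xi> {..<n}" and law: "\<And>i. i < n \<Longrightarrow> distr M borel (\<xi> i) = gauss h"
    and h: "h > 0"
    and am[measurable]: "a \<in> borel_measurable borel" "W \<in> borel_measurable borel" "f \<in> borel_measurable borel"
    and bd: "\<And>y. \<bar>f y\<bar> \<le> C" and W: "\<And>y. W y \<le> w" and w: "w \<ge> 0" and c: "c \<ge> 0"
    and step: "\<And>y. \<bar>y\<bar> \<le> R \<Longrightarrow> exp (h * W y) * (\<integral>z. f (y - h * a y + z) \<partial>gauss h) \<le> f y + c"
  defines "Y \<equiv> \<lambda>i \<omega>. euler a W R h x (\<lambda>j. \<xi> j \<omega>) i"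
  shows "expectation (\<lambda>\<omega>. snd (Y n \<omega>) * f (fst (Y n \<omega>))) \<le> f x + real n * (c * exp (w * h * real n))"
proof -
  have \<xi>m: "random_variable borel (\<xi> i)" if "i < n" for i
    using ind that by (auto simp: indep_vars_def)
  have Ym: "Y i \<in> measurable M (borel \<Otimes>\<^sub>M borel)" if "i \<le> n" for i
  proof -
    have "(\<lambda>\<omega>. restrict (\<lambda>j. \<xi> j \<omega>) {..<i}) \<in> measurable M (PiM {..<i} (\<lambda>_. borel))"
      using \<xi>m that by (intro measurable_restrict) auto
    from measurable_compose[OF this euler_measurable[OF am(1,2) order_refl]]
    show ?thesis unfolding Y_def
      by (rule measurable_cong[THEN iffD1, rotated]) (auto intro!: euler_cong)
  qed
  have Yb: "0 \<le> snd (Y i \<omega>)" "snd (Y i \<omega>) \<le> exp (w * h * real i)" for i \<omega>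
    unfolding Y_def using euler_weight_bounds[of W w h] W w h by auto
  have C: "C \<ge> 0" using bd[of 0] by linarith
  have prodb: "\<bar>snd (Y i \<omega>) * f y\<bar> \<le> exp (w * h * real i) * C" for i \<omega> y
    unfolding abs_mult using Yb[of i \<omega>] bd C by (intro mult_mono) auto
  have int: "integrable M (\<lambda>\<omega>. snd (Y i \<omega>) * f (fst (Y i \<omega>)))" "integrable M (\<lambda>\<omega>. snd (Y i \<omega>) * c)" 
     if "i \<le> n" for i
  proof -
    note [measurable] = Ym[OF that]
    show "integrable M (\<lambda>\<omega>. snd (Y i \<omega>) * f (fst (Y i \<omega>)))"
      by (rule integrable_const_bound[of _ "exp (w * h * real i) * C"]) (use prodb in auto)
    show "integrable M (\<lambda>\<omega>. snd (Y i \<omega>) * c)"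
      using Yb[of i] by (intro integrable_mult_left integrable_const_bound[of _ "exp (w * h * real i)"]) auto
  qed
  have "expectation (\<lambda>\<omega>. snd (Y i \<omega>) * f (fst (Y i \<omega>))) \<le> f x + real i * (c * exp (w * h * real n))" if "i \<le> n" for i
    using that
  proof (induction i)
    case 0 show ?case by (simp add: Y_def prob_space)
  next
    case (Suc i)
    hence i: "i \<le> n" "i < n" by auto
    note [measurable] = Ym[OF i(1)] Ym[OF Suc.prems] \<xi>m[OF i(2)]
    define F where "F = (\<lambda>q. snd (euler_step a W R h (fst q) (snd q)) * f (fst (euler_step a W R h (fst q) (snd q))))"
    note [measurable] = euler_step_measurable[OF am(1,2)]
    have Fm: "F \<in> borel_measurable ((borel \<Otimes>\<^sub>M borel) \<Otimes>\<^sub>M borel)" unfolding F_def by measurable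
    \<comment> \<open>The past and the next noise are disjoint blocks of an independent family, and
      the i-th state is a function of the first block alone.\<close>
    have ind': "indep_var (PiM {..<i} (\<lambda>_. borel)) (\<lambda>\<omega>. restrict (\<lambda>j. \<xi> j \<omega>) {..<i}) (PiM {i} (\<lambda>_. borel)) (\<lambda>\<omega>. restrict (\<lambda>j. \<xi> j \<omega>) {i})"
        by (rule indep_var_restrict[OF ind]) (use i in auto)
    define E where "E = (\<lambda>z. euler a W R h x z i)"
    have Em[measurable]: "E \<in> measurable (PiM {..<i} (\<lambda>_. borel)) (borel \<Otimes>\<^sub>M borel)"
      unfolding E_def by (rule euler_measurable[OF am(1,2) order_refl])
    have EY: "E (restrict (\<lambda>j. \<xi> j \<omega>) {..<i}) = Y i \<omega>" for \<omega>
      unfolding Y_def E_def by (auto intro!: euler_cong)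
    have pm[measurable]: "(\<lambda>z. z i) \<in> measurable (PiM {i} (\<lambda>_. borel)) (borel :: real measure)"
      by (auto intro!: measurable_component_singleton)
    have lawE: "expectation (\<lambda>\<omega>. g (\<xi> i \<omega>)) = (\<integral>z. g z \<partial>gauss h)" if [measurable]: "g \<in> borel_measurable borel" for g :: "real \<Rightarrow> real"
      unfolding law[OF i(2), symmetric] by (rule integral_distr[symmetric]) auto
    \<comment> \<open>The one-step bound is multiplied by the weight, which has to be nonnegative
      for this. The guard makes the inequality available for every value of the past, and it always
      holds along the scheme.\<close>
    define G where "G = (\<lambda>p::real \<times> real. if 0 \<le> snd p then snd p * f (fst p) + snd p * c else 0)"
    have Gm: "G \<in> borel_measurable (borel \<Otimes>\<^sub>M borel)" unfolding G_def by measurable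
    have eqF: "F (Y i \<omega>, \<xi> i \<omega>) = snd (Y (Suc i) \<omega>) * f (fst (Y (Suc i) \<omega>))" for \<omega>
      by (simp add: F_def Y_def)
    have "expectation (\<lambda>\<omega>. snd (Y (Suc i) \<omega>) * f (fst (Y (Suc i) \<omega>))) = expectation (\<lambda>\<omega>. F (Y i \<omega>, \<xi> i \<omega>))"
      using eqF by simp
    also have "\<dots> = expectation (\<lambda>\<omega>. (\<lambda>(z,z'). if snd (E z) \<ge> 0 then F (E z, z' i) else 0)
        (restrict (\<lambda>j. \<xi> j \<omega>) {..<i}, restrict (\<lambda>j. \<xi> j \<omega>) {i}))"
      using Yb by (simp add: EY)
    also have "\<dots> \<le> expectation (\<lambda>\<omega>. (\<lambda>z. G (E z)) (restrict (\<lambda>j. \<xi> j \<omega>) {..<i}))"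
      using ind'
    proof (rule expectation_indep_integrate_out)
      note [measurable] = Fm Gm
      show "(\<lambda>(z,z'). if snd (E z) \<ge> 0 then F (E z, z' i) else 0) \<in> borel_measurable (PiM {..<i} (\<lambda>_. borel) \<Otimes>\<^sub>M PiM {i} (\<lambda>_. borel))"
        by measurable
      show "\<bar>case (restrict (\<lambda>j. \<xi> j \<omega>) {..<i}, restrict (\<lambda>j. \<xi> j \<omega>) {i}) of (z,z') \<Rightarrow> if 0 \<le> snd (E z) then F (E z, z' i) else 0\<bar>
         \<le> exp (w * h * real (Suc i)) * C" for \<omega>
        using prodb[of "Suc i" \<omega>] Yb by (simp add: eqF EY)
      show "integrable M (\<lambda>\<omega>. G (E (restrict (\<lambda>j. \<xi> j \<omega>) {..<i})))" unfolding G_def EY using int[OF i(1)] Yb by simp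
      show "(\<lambda>z. G (E z)) \<in> borel_measurable (PiM {..<i} (\<lambda>_. borel))" by measurable
      fix v :: "nat \<Rightarrow> real"
      define u where "u = E v"
      have law_u: "expectation (\<lambda>\<omega>. F (u, \<xi> i \<omega>)) = (\<integral>z. F (u, z) \<partial>gauss h)"
        by (rule lawE, rule measurable_Pair2[OF Fm]) (simp add: space_pair_measure)
      have "expectation (\<lambda>\<omega>. if 0 \<le> snd u then F (u, \<xi> i \<omega>) else 0) \<le> G u"
      proof (cases "snd u \<ge> 0")
        case True
        interpret g: prob_space "gauss h" by (rule prob_space_gauss[OF h])
        show ?thesis
        proof (cases "\<bar>fst u\<bar> \<le> R")
          case R: True
          have "(\<integral>z. F (u, z) \<partial>gauss h) = (\<integral>z. snd u * exp (h * W (fst u)) * f (fst u - h * a (fst u) + z) \<partial>gauss h)"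
            by (simp add: F_def euler_step_def R)
          also have "\<dots> = snd u * (exp (h * W (fst u)) * (\<integral>z. f (fst u - h * a (fst u) + z) \<partial>gauss h))" by simp
          also have "\<dots> \<le> snd u * (f (fst u) + c)" using step[OF R] True by (rule mult_left_mono)
          finally show ?thesis using True law_u by (simp add: G_def algebra_simps)
        next
          case False
          then show ?thesis using True c prob_space by (simp add: F_def euler_step_def G_def)
        qed
      next
        case False
        then show ?thesis unfolding G_def by simp
      qed
      thus "expectation (\<lambda>\<omega>. case (v, restrict (\<lambda>j. \<xi> j \<omega>) {i}) of (z,z') \<Rightarrow> if 0 \<le> snd (E z) then F (E z, z' i) else 0) \<le> G (E v)"
        by (simp add: u_def cong: if_cong)
    qed
    also have "\<dots> = expectation (\<lambda>\<omega>. snd (Y i \<omega>) * f (fst (Y i \<omega>))) + expectation (\<lambda>\<omega>. snd (Y i \<omega>) * c)"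
      unfolding G_def EY using int[OF i(1)] Yb by simp
    finally have J: "expectation (\<lambda>\<omega>. snd (Y (Suc i) \<omega>) * f (fst (Y (Suc i) \<omega>))) \<le> \<dots>" .
    have "expectation (\<lambda>\<omega>. snd (Y i \<omega>) * c) \<le> expectation (\<lambda>\<omega>. c * exp (w * h * real n))"
    proof (rule integral_mono[OF int(2)[OF i(1)]])
      fix \<omega>
      have "snd (Y i \<omega>) \<le> exp (w * h * real n)" 
        using Yb(2)[of i \<omega>] by (rule order_trans) (use w h i in \<open>auto intro!: mult_left_mono\<close>)
      thus "snd (Y i \<omega>) * c \<le> c * exp (w * h * real n)" using c by (simp add: mult.commute mult_left_mono)
    qed auto
    also have "\<dots> = c * exp (w * h * real n)" by (simp add: prob_space)
    finally show ?case using Suc.IH[OF i(1)] J by (simp add: algebra_simps)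
  qed
  thus ?thesis by blast
qed

section \<open>Riemann sums and pathwise convergence of the scheme\<close>

lemma integral_near_constant:
  fixes g :: "real \<Rightarrow> real"
  assumes "u \<le> v" "continuous_on {u..v} g" "\<And>s. s \<in> {u..v} \<Longrightarrow> \<bar>g s - c\<bar> \<le> \<eta>"
  shows "\<bar>integral {u..v} g - (v - u) * c\<bar> \<le> (v - u) * \<eta>"
proof -
  have "integral {u..v} g - (v - u) * c = integral {u..v} (\<lambda>s. g s - c)"
    using assms by (subst integral_diff) (auto intro: integrable_continuous_interval)
  moreover have "norm (integral {u..v} (\<lambda>s. g s - c)) \<le> \<eta> * (v - u)"
    using assms by (intro integral_bound continuous_intros) auto
  ultimately show ?thesis by (simp add: mult.commute)
qed

text \<open>The sampled values \<open>c j\<close> only have to be close to \<open>g\<close> on each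
  cell. This covers exact samples of \<open>g\<close> and also, for the weight, values of W taken
  along the Euler scheme in place of the path.\<close>

lemma riemann_sum_error:
  fixes g :: "real \<Rightarrow> real"
  assumes h: "h > 0" "real n * h = t" and g: "continuous_on {0..t} g"
    and c: "\<And>j s. j < n \<Longrightarrow> s \<in> {real j * h..real (Suc j) * h} \<Longrightarrow> \<bar>g s - c j\<bar> \<le> \<eta>"
  shows "\<bar>(\<Sum>j<n. h * c j) - integral {0..t} g\<bar> \<le> t * \<eta>"
proof -
  have "\<bar>(\<Sum>j<i. h * c j) - integral {0..real i * h} g\<bar> \<le> real i * h * \<eta>" if "i \<le> n" for i
    using that
  proof (induction i)
    case (Suc i)
    define t0 t1 where "t0 = real i * h" and "t1 = real (Suc i) * h"
    have t01: "0 \<le> t0" "t0 < t1" "t1 - t0 = h" using h by (auto simp: t0_def t1_def algebra_simps)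
    have t1: "t1 \<le> t" unfolding t1_def h(2)[symmetric] using Suc.prems h(1) by (intro mult_right_mono) auto
    have "integral {0..t1} g = integral {0..t0} g + integral {t0..t1} g"
      using t01 t1 by (intro Henstock_Kurzweil_Integration.integral_combine[symmetric])
         (auto intro!: integrable_continuous_interval continuous_on_subset[OF g])
    moreover have "\<bar>integral {t0..t1} g - (t1 - t0) * c i\<bar> \<le> (t1 - t0) * \<eta>"
    proof (rule integral_near_constant)
      show "continuous_on {t0..t1} g" by (rule continuous_on_subset[OF g]) (use t01 t1 in auto)
    qed (use t01 c[of i] Suc.prems in \<open>auto simp: t0_def t1_def\<close>)
    moreover have "real (Suc i) * h * \<eta> = real i * h * \<eta> + h * \<eta>" by (simp add: algebra_simps)
    ultimately show ?case using Suc.IH Suc.prems unfolding t01(3) t0_def[symmetric] t1_def[symmetric] by simp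
  qed simp
  from this[of n] show ?thesis by (simp add: h(2))
qed

lemma uniform_modulus_on_grid:
  fixes g :: "real \<Rightarrow> real"
  assumes t: "t > 0" and g: "continuous_on {0..t} g" and "\<epsilon> > 0"
  shows "\<exists>N>0. \<forall>n\<ge>N. \<forall>i<n. \<forall>s\<in>{real i * (t / real n)..real (Suc i) * (t / real n)}. \<bar>g s - g (real i * (t / real n))\<bar> \<le> \<epsilon>"
proof -
  define h where "h = (\<lambda>n. t / real n)"
  have "uniformly_continuous_on {0..t} g" by (intro compact_uniformly_continuous g) simp
  with \<open>\<epsilon> > 0\<close> obtain d where d: "d > 0" "\<And>u v. u \<in> {0..t} \<Longrightarrow> v \<in> {0..t} \<Longrightarrow> dist v u < d \<Longrightarrow> dist (g v) (g u) < \<epsilon>"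
    unfolding uniformly_continuous_on_def by meson
  obtain N where N: "real N > t / d" using reals_Archimedean2 by blast
  have "\<exists>N>0. \<forall>n\<ge>N. \<forall>i<n. \<forall>s\<in>{real i * h n..real (Suc i) * h n}. \<bar>g s - g (real i * h n)\<bar> \<le> \<epsilon>"
  proof (intro exI[of _ "max N 1"] conjI allI impI ballI)
    fix n i s assume n: "max N 1 \<le> n" and i: "i < n" and s: "s \<in> {real i * h n..real (Suc i) * h n}"
    have "real N \<le> real n" using n by simp
    hence "t / d < real n" using N by linarith
    hence h: "0 < h n" "h n < d" using n N t d(1) by (auto simp: h_def divide_less_eq mult.commute)
    have "real (Suc i) * h n \<le> real n * h n" using i h by (intro mult_right_mono) auto
    also have "\<dots> = t" using n by (simp add: h_def)
    finally have "real (Suc i) * h n \<le> t" .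
    moreover have "0 \<le> real i * h n" using h by simp
    moreover have "real (Suc i) * h n = real i * h n + h n" by (simp add: algebra_simps)
    moreover have "0 \<le> s" using s \<open>0 \<le> real i * h n\<close> by (meson atLeastAtMost_iff order_trans)
    ultimately have "dist (g s) (g (real i * h n)) < \<epsilon>" using s h
      by (intro d(2)) (auto simp: dist_real_def)
    thus "\<bar>g s - g (real i * h n)\<bar> \<le> \<epsilon>" by (simp add: dist_real_def)
  qed simp
  thus ?thesis unfolding h_def .
qed

text \<open>Displays a time integral along a path as a limit of finite sums of the process at fixed
  times; the measurability of the Feynman-Kac weight rests on this.\<close>

lemma riemann_sums_tendsto:
  fixes g :: "real \<Rightarrow> real"
  assumes t: "t > 0" and g: "continuous_on {0..t} g"
  shows "(\<lambda>n. \<Sum>j<n. t / real n * g (real j * (t / real n))) \<longlonglongrightarrow> integral {0..t} g"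
proof (rule LIMSEQ_I)
  fix r :: real assume r: "r > 0"
  have "r / (2 * t) > 0" using r t by simp
  from uniform_modulus_on_grid[OF t g this] obtain N where N: "N > 0"
    "\<And>n i s. n \<ge> N \<Longrightarrow> i < n \<Longrightarrow> s \<in> {real i * (t / real n)..real (Suc i) * (t / real n)} \<Longrightarrow>
        \<bar>g s - g (real i * (t / real n))\<bar> \<le> r / (2 * t)" by blast
  have "norm ((\<Sum>j<n. t / real n * g (real j * (t / real n))) - integral {0..t} g) < r" if n: "n \<ge> N" for n
  proof -
    have "\<bar>(\<Sum>j<n. t / real n * g (real j * (t / real n))) - integral {0..t} g\<bar> \<le> t * (r / (2 * t))"
      by (rule riemann_sum_error) (use N n t g in auto)
    also have "\<dots> < r" using r t by (simp add: field_simps)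
    finally show ?thesis by simp
  qed
  thus "\<exists>no. \<forall>n\<ge>no. norm ((\<Sum>j<n. t / real n * g (real j * (t / real n))) - integral {0..t} g) < r" by blast
qed

lemma set_integral_eq_integral_Icc:
  fixes g :: "real \<Rightarrow> real"
  assumes "continuous_on {u..v} g"
  shows "(LBINT s:{u..v}. g s) = integral {u..v} g"
  using borel_integrable_atLeastAtMost'[OF assms] by (rule set_borel_integral_eq_integral(2))

lemma gronwall_factor_le:
  fixes L \<epsilon> h t :: real
  assumes "L \<ge> 0" "\<epsilon> \<ge> 0" "h \<ge> 0" "real i * h \<le> t"
  shows "exp (L * h * real i) * (L * \<epsilon> * h * real i) \<le> exp (L * t) * (L * \<epsilon> * t)"
proof (rule mult_mono)
  have "L * h * real i = L * (real i * h)" "L * \<epsilon> * h * real i = (L * \<epsilon>) * (real i * h)" by simp_all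
  then show "exp (L * h * real i) \<le> exp (L * t)" "L * \<epsilon> * h * real i \<le> L * \<epsilon> * t"
    using assms by (auto simp only: exp_le_cancel_iff intro!: mult_left_mono mult_nonneg_nonneg)
qed (use assms in auto)

text \<open>Gronwall-type induction: as long as the scheme stays in \<open>[-R, R]\<close>, the error after \<open>i\<close> steps is at
  most \<open>e\<^sup>L\<^sup>h\<^sup>i L \<epsilon> h i\<close>, which in turn keeps the scheme there.\<close>

lemma euler_error:
  fixes X b a W :: "real \<Rightarrow> real"
  assumes h: "h > 0" and T: "real n * h \<le> t"
    and cX: "continuous_on {0..t} X" and ca: "continuous_on UNIV a"
    and sde: "\<And>s. s \<in> {0..t} \<Longrightarrow> X s = x + b s - integral {0..s} (\<lambda>r. a (X r))" and b0: "b 0 = 0"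
    and bd: "\<And>s. s \<in> {0..t} \<Longrightarrow> \<bar>X s\<bar> \<le> R - 1"
    and L: "L \<ge> 0" "\<And>y y'. \<bar>y\<bar> \<le> R \<Longrightarrow> \<bar>y'\<bar> \<le> R \<Longrightarrow> \<bar>a y - a y'\<bar> \<le> L * \<bar>y - y'\<bar>"
    and mod: "\<And>i s. i < n \<Longrightarrow> s \<in> {real i * h..real (Suc i) * h} \<Longrightarrow> \<bar>X s - X (real i * h)\<bar> \<le> \<epsilon>"
    and e: "\<epsilon> \<ge> 0" "exp (L * t) * (L * \<epsilon> * t) \<le> 1"
  defines "Y \<equiv> \<lambda>i. fst (euler a W R h x (\<lambda>j. b (real (Suc j) * h) - b (real j * h)) i)"
  assumes i: "i \<le> n"
  shows "\<bar>Y i - X (real i * h)\<bar> \<le> exp (L * h * real i) * (L * \<epsilon> * h * real i)"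
  using i
proof (induction i)
  case 0
  have "t \<ge> 0" using T h by (meson mult_nonneg_nonneg of_nat_0_le_iff less_imp_le order_trans)
  hence "X 0 = x" using sde[of 0] b0 by simp
  thus ?case by (simp add: Y_def)
next
  case (Suc i)
  define t0 t1 where "t0 = real i * h" and "t1 = real (Suc i) * h"
  have t01: "0 \<le> t0" "t0 < t1" "t1 - t0 = h" using h by (auto simp: t0_def t1_def algebra_simps)
  have "t1 \<le> real n * h" unfolding t1_def using Suc.prems h by (intro mult_right_mono) auto
  hence t1: "t1 \<le> t" using T by linarith
  have IH: "\<bar>Y i - X t0\<bar> \<le> exp (L * h * real i) * (L * \<epsilon> * h * real i)"
    using Suc by (simp add: t0_def)
  also have "\<dots> \<le> exp (L * t) * (L * \<epsilon> * t)"
    by (rule gronwall_factor_le) (use L e h t01 t1 in \<open>auto simp: t0_def\<close>)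
  \<comment> \<open>The path keeps distance 1 from the boundary, so an error of at most 1 leaves the
    scheme unfrozen and the next step is a genuine Euler step.\<close>
  finally have le1: "\<bar>Y i - X t0\<bar> \<le> 1" using e by linarith
  have "\<bar>X t0\<bar> \<le> R - 1" using bd t01 t1 by auto
  hence YR: "\<bar>Y i\<bar> \<le> R" using le1 by linarith
  have step: "Y (Suc i) = Y i - h * a (Y i) + (b t1 - b t0)"
    using YR by (simp add: Y_def euler_step_def t0_def t1_def)
  have caX: "continuous_on {0..t} (\<lambda>r. a (X r))"
    by (intro continuous_on_compose2[OF ca cX]) auto
  have "integral {0..t1} (\<lambda>r. a (X r)) = integral {0..t0} (\<lambda>r. a (X r)) + integral {t0..t1} (\<lambda>r. a (X r))"
    using t01 t1 by (intro Henstock_Kurzweil_Integration.integral_combine[symmetric])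
       (auto intro!: integrable_continuous_interval continuous_on_subset[OF caX])
  hence Xstep: "X t1 = X t0 + (b t1 - b t0) - integral {t0..t1} (\<lambda>r. a (X r))"
    using sde[of t0] sde[of t1] t01 t1 by simp
  have "\<bar>integral {t0..t1} (\<lambda>r. a (X r)) - (t1 - t0) * a (Y i)\<bar> \<le> (t1 - t0) * (L * (\<epsilon> + \<bar>Y i - X t0\<bar>))"
  proof (rule integral_near_constant)
    fix s assume s: "s \<in> {t0..t1}"
    have "\<bar>X s\<bar> \<le> R - 1" using bd s t01 t1 by auto
    hence "\<bar>a (X s) - a (Y i)\<bar> \<le> L * \<bar>X s - Y i\<bar>" using YR by (intro L) auto
    also have "\<dots> \<le> L * (\<epsilon> + \<bar>Y i - X t0\<bar>)"
      using mod[of i s] s Suc.prems L by (intro mult_left_mono) (auto simp: t0_def t1_def)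
    finally show "\<bar>a (X s) - a (Y i)\<bar> \<le> L * (\<epsilon> + \<bar>Y i - X t0\<bar>)" .
  qed (use t01 t1 in \<open>auto intro!: continuous_on_subset[OF caX]\<close>)
  hence "\<bar>Y (Suc i) - X t1\<bar> \<le> \<bar>Y i - X t0\<bar> + h * (L * (\<epsilon> + \<bar>Y i - X t0\<bar>))"
    using step Xstep t01 by simp
  also have "\<dots> = (1 + L * h) * \<bar>Y i - X t0\<bar> + L * \<epsilon> * h" by (simp add: algebra_simps)
  \<comment> \<open>The new defect is inflated by a factor of at least 1, so that it merges with the
    propagated error into the bound for i + 1.\<close>
  also have "\<dots> \<le> exp (L * h) * (exp (L * h * real i) * (L * \<epsilon> * h * real i)) + exp (L * h * real (Suc i)) * (L * \<epsilon> * h)"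
  proof (rule add_mono, rule mult_mono[OF _ IH])
    show "1 + L * h \<le> exp (L * h)" by (rule exp_ge_add_one_self)
    have "1 \<le> exp (L * h * real (Suc i))" using L h by simp
    from mult_right_mono[OF this, of "L * \<epsilon> * h"]
    show "L * \<epsilon> * h \<le> exp (L * h * real (Suc i)) * (L * \<epsilon> * h)" using L h e by simp
  qed (use L h in auto)
  also have "\<dots> = exp (L * h * real (Suc i)) * (L * \<epsilon> * h * real (Suc i))"
    by (simp add: algebra_simps exp_add)
  finally show ?case by (simp add: t1_def)
qed

lemma euler_weight_eq:
  assumes "\<And>j. j < i \<Longrightarrow> \<bar>fst (euler a W R h x z j)\<bar> \<le> R"
  shows "snd (euler a W R h x z i) = exp (\<Sum>j<i. h * W (fst (euler a W R h x z j)))"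
  using assms by (induction i) (auto simp: euler_step_def exp_add)

text \<open>The increments of b enter the scheme and the equation identically and cancel in the
  difference, which leaves the Lipschitz drift; hence the convergence is pathwise. The weight
  converges as a Riemann sum sampled along the scheme, which for large n stays in [-R, R] and so is
  never frozen.\<close>

lemma euler_converges:
  fixes X b a W :: "real \<Rightarrow> real"
  assumes t: "t > 0" and cX: "continuous_on {0..t} X" and ca: "continuous_on UNIV a" and cW: "continuous_on UNIV W"
    and sde: "\<And>s. s \<in> {0..t} \<Longrightarrow> X s = x + b s - integral {0..s} (\<lambda>r. a (X r))" and b0: "b 0 = 0"
    and bd: "\<And>s. s \<in> {0..t} \<Longrightarrow> \<bar>X s\<bar> \<le> R - 1"
    and L: "L \<ge> 0" "\<And>y y'. \<bar>y\<bar> \<le> R \<Longrightarrow> \<bar>y'\<bar> \<le> R \<Longrightarrow> \<bar>a y - a y'\<bar> \<le> L * \<bar>y - y'\<bar>"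
  defines "Y \<equiv> \<lambda>n. euler a W R (t / real n) x (\<lambda>j. b (real (Suc j) * (t / real n)) - b (real j * (t / real n))) n"
  shows "(\<lambda>n. fst (Y n)) \<longlonglongrightarrow> X t" "(\<lambda>n. snd (Y n)) \<longlonglongrightarrow> exp (integral {0..t} (\<lambda>s. W (X s)))"
proof -
  define h where "h = (\<lambda>n. t / real n)"
  define Z where "Z = (\<lambda>n. euler a W R (h n) x (\<lambda>j. b (real (Suc j) * h n) - b (real j * h n)))"
  have YZ: "Y n = Z n n" for n by (simp add: Y_def Z_def h_def)
  have modulus: "\<exists>N>0. \<forall>n\<ge>N. \<forall>i<n. \<forall>s\<in>{real i * h n..real (Suc i) * h n}. \<bar>X s - X (real i * h n)\<bar> \<le> \<epsilon>" if "\<epsilon> > 0" for \<epsilon>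
    unfolding h_def by (rule uniform_modulus_on_grid[OF t cX that])
  have close: "\<exists>N>0. \<forall>n\<ge>N. \<forall>i\<le>n. \<bar>fst (Z n i) - X (real i * h n)\<bar> \<le> \<eta>" if \<eta>: "\<eta> > 0" "\<eta> \<le> 1" for \<eta>
  proof -
    \<comment> \<open>L + 1 instead of L keeps c positive when L = 0; \<epsilon> is tuned so that
      the Gronwall bound is at most \<eta>.\<close>
    define c where "c = exp (L * t) * (L + 1) * t"
    define \<epsilon> where "\<epsilon> = \<eta> / c"
    have c: "c > 0" using t L by (simp add: c_def)
    hence e: "\<epsilon> > 0" using \<eta> by (simp add: \<epsilon>_def)
    have e2: "exp (L * t) * (L * \<epsilon> * t) \<le> \<eta>"
    proof -
      have "exp (L * t) * (L * \<epsilon> * t) \<le> exp (L * t) * ((L + 1) * \<epsilon> * t)"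
        using e t by (intro mult_left_mono mult_right_mono) auto
      also have "\<dots> = c * \<epsilon>" by (simp add: c_def mult_ac)
      also have "\<dots> = \<eta>" using c by (simp add: \<epsilon>_def)
      finally show ?thesis .
    qed
    from modulus[OF e] obtain N where N: "N > 0" "\<And>n i s. n \<ge> N \<Longrightarrow> i < n \<Longrightarrow> s \<in> {real i * h n..real (Suc i) * h n} \<Longrightarrow> \<bar>X s - X (real i * h n)\<bar> \<le> \<epsilon>"
      by blast
    have "\<bar>fst (Z n i) - X (real i * h n)\<bar> \<le> \<eta>" if n: "n \<ge> N" and i: "i \<le> n" for n i
    proof -
      have hn: "h n > 0" "real n * h n = t" using n N t by (auto simp: h_def)
      have "\<bar>fst (Z n i) - X (real i * h n)\<bar> \<le> exp (L * h n * real i) * (L * \<epsilon> * h n * real i)"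
        unfolding Z_def
        by (rule euler_error[of "h n" n t X a x b R L \<epsilon>]) (use hn cX ca sde b0 bd L N(2)[OF n] e e2 \<eta> i in \<open>auto\<close>)
      also have "\<dots> \<le> exp (L * t) * (L * \<epsilon> * t)"
      proof (rule gronwall_factor_le)
        show "real i * h n \<le> t" unfolding hn(2)[symmetric] using i hn by (intro mult_right_mono) auto
      qed (use L e hn in auto)
      also note e2
      finally show ?thesis .
    qed
    with N(1) show ?thesis by blast
  qed
  show "(\<lambda>n. fst (Y n)) \<longlonglongrightarrow> X t"
  proof (rule LIMSEQ_I)
    fix r :: real assume r: "r > 0"
    from close[of "min (r/2) 1"] r obtain N where N: "N > 0" "\<And>n i. n \<ge> N \<Longrightarrow> i \<le> n \<Longrightarrow> \<bar>fst (Z n i) - X (real i * h n)\<bar> \<le> min (r/2) 1"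
      by auto
    have "norm (fst (Y n) - X t) < r" if n: "n \<ge> N" for n
      using N(2)[OF n order_refl] r n N(1) by (simp add: YZ h_def)
    thus "\<exists>no. \<forall>n\<ge>no. norm (fst (Y n) - X t) < r" by blast
  qed
  define S where "S = (\<lambda>n i. \<Sum>j<i. h n * W (fst (Z n j)))"
  have XR: "\<bar>X s\<bar> \<le> R" if "s \<in> {0..t}" for s using bd[OF that] by linarith
  have ucW: "uniformly_continuous_on {-R..R} W" 
    by (intro compact_uniformly_continuous continuous_on_subset[OF cW]) auto
  have cWX: "continuous_on {0..t} (\<lambda>r. W (X r))"
    by (intro continuous_on_compose2[OF cW cX]) auto
  have Sconv: "\<exists>N>0. \<forall>n\<ge>N. (\<forall>i\<le>n. \<bar>fst (Z n i)\<bar> \<le> R) \<and> \<bar>S n n - integral {0..t} (\<lambda>s. W (X s))\<bar> \<le> t * \<eta>" if "\<eta> > 0" for \<eta>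
  proof -
    from ucW that obtain d where d: "d > 0" "\<And>u v. u \<in> {-R..R} \<Longrightarrow> v \<in> {-R..R} \<Longrightarrow> dist v u < d \<Longrightarrow> dist (W v) (W u) < \<eta>"
      unfolding uniformly_continuous_on_def by meson
    \<comment> \<open>The oscillation of the path on a cell and the error of the scheme each cost
      \<epsilon>; together they must stay below the distance d of uniform continuity of W.\<close>
    define \<epsilon> where "\<epsilon> = min (d / 4) 1"
    have e: "\<epsilon> > 0" "\<epsilon> \<le> 1" "\<epsilon> + \<epsilon> < d" using d(1) by (auto simp: \<epsilon>_def)
    from modulus[OF e(1)] obtain N1 where N1: "N1 > 0" "\<And>n i s. n \<ge> N1 \<Longrightarrow> i < n \<Longrightarrow> s \<in> {real i * h n..real (Suc i) * h n} \<Longrightarrow> \<bar>X s - X (real i * h n)\<bar> \<le> \<epsilon>"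
      by blast
    from close[OF e(1,2)] obtain N2 where N2: "N2 > 0" "\<And>n i. n \<ge> N2 \<Longrightarrow> i \<le> n \<Longrightarrow> \<bar>fst (Z n i) - X (real i * h n)\<bar> \<le> \<epsilon>"
      by blast
    have "(\<forall>i\<le>n. \<bar>fst (Z n i)\<bar> \<le> R) \<and> \<bar>S n n - integral {0..t} (\<lambda>s. W (X s))\<bar> \<le> t * \<eta>" if n: "n \<ge> max N1 N2" for n
    proof -
      have hn: "h n > 0" "real n * h n = t" using n N1(1) t by (auto simp: h_def)
      have it: "real i * h n \<in> {0..t}" if "i \<le> n" for i 
        using hn that by (auto simp flip: hn(2))
      have ZR: "\<bar>fst (Z n i)\<bar> \<le> R" if "i \<le> n" for i
        using N2(2)[of n i] that n e(2) bd[OF it[OF that]] by force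
      have "\<bar>S n n - integral {0..t} (\<lambda>s. W (X s))\<bar> \<le> t * \<eta>"
        unfolding S_def
      proof (rule riemann_sum_error[OF hn cWX])
        fix i s assume i: "i < n" and s: "s \<in> {real i * h n..real (Suc i) * h n}"
        have "\<bar>X s - X (real i * h n)\<bar> \<le> \<epsilon>" "\<bar>fst (Z n i) - X (real i * h n)\<bar> \<le> \<epsilon>"
          using N1(2)[of n i s] N2(2)[of n i] n s i by auto
        hence "dist (X s) (fst (Z n i)) < d" using e(3) by (simp add: dist_real_def)
        moreover have "s \<in> {0..t}" using s it[of i] it[of "Suc i"] i by auto
        hence "X s \<in> {-R..R}" "fst (Z n i) \<in> {-R..R}"
          using XR[of s] ZR[of i] i by (auto simp: abs_le_iff)
        ultimately show "\<bar>W (X s) - W (fst (Z n i))\<bar> \<le> \<eta>"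
          using d(2)[of "fst (Z n i)" "X s"] by (simp add: dist_real_def)
      qed
      with ZR show ?thesis by blast
    qed
    with N1(1) show ?thesis by (intro exI[of _ "max N1 N2"]) auto
  qed
  have "(\<lambda>n. S n n) \<longlonglongrightarrow> integral {0..t} (\<lambda>s. W (X s))"
  proof (rule LIMSEQ_I)
    fix r :: real assume r: "r > 0"
    have "r / (2 * t) > 0" using r t by simp
    from Sconv[OF this] obtain N where "\<And>n. n \<ge> N \<Longrightarrow> \<bar>S n n - integral {0..t} (\<lambda>s. W (X s))\<bar> \<le> t * (r / (2 * t))" by blast
    moreover have "t * (r / (2 * t)) < r" using r t by (simp add: field_simps)
    ultimately show "\<exists>no. \<forall>n\<ge>no. norm (S n n - integral {0..t} (\<lambda>s. W (X s))) < r"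
      by (metis order_le_less_trans real_norm_def)
  qed
  hence "(\<lambda>n. exp (S n n)) \<longlonglongrightarrow> exp (integral {0..t} (\<lambda>s. W (X s)))" by (rule tendsto_exp)
  moreover have "eventually (\<lambda>n. exp (S n n) = snd (Y n)) sequentially"
  proof -
    from Sconv[of 1] obtain N where "\<And>n i. n \<ge> N \<Longrightarrow> i \<le> n \<Longrightarrow> \<bar>fst (Z n i)\<bar> \<le> R" by auto
    hence "\<And>n. n \<ge> N \<Longrightarrow> exp (S n n) = snd (Y n)"
      unfolding S_def YZ Z_def by (subst euler_weight_eq) auto
    thus ?thesis by (auto simp: eventually_sequentially)
  qed
  ultimately show "(\<lambda>n. snd (Y n)) \<longlonglongrightarrow> exp (integral {0..t} (\<lambda>s. W (X s)))"
    by (rule Lim_transform_eventually)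
qed


section \<open>Feynman-Kac functionals of the diffusion\<close>

text \<open>Reduces an uncountable family of conditions to a countable one, which makes the event of
  staying in an interval measurable. Since t > 0, the rational points of the open interval are dense
  in the closed one.\<close>

lemma continuous_on_bounded_by_rationals:
  fixes g :: "real \<Rightarrow> real"
  assumes t: "t > 0" and g: "continuous_on {0..t} g" and q: "\<And>s. s \<in> \<rat> \<inter> {0..t} \<Longrightarrow> \<bar>g s\<bar> \<le> K" and s: "s \<in> {0..t}"
  shows "\<bar>g s\<bar> \<le> K"
proof -
  have "{0<..<t} = {0<..<t} \<inter> closure \<rat>" by (simp add: Rats_closure_real)
  also have "\<dots> \<subseteq> closure ({0<..<t} \<inter> \<rat>)" by (rule open_Int_closure_subset) simp
  finally have "closure {0<..<t} \<subseteq> closure ({0<..<t} \<inter> \<rat>)" by (metis closure_mono closure_closure)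
  hence sub: "{0..t} \<subseteq> closure ({0<..<t} \<inter> \<rat>)" using t by simp
  moreover have "closure ({0<..<t} \<inter> \<rat>) \<subseteq> {0..t}" by (rule closure_minimal) auto
  ultimately have eq: "closure ({0<..<t} \<inter> \<rat>) = {0..t}" by blast
  show ?thesis
    by (rule continuous_le_on_closure[of "{0<..<t} \<inter> \<rat>" "\<lambda>s. \<bar>g s\<bar>"])
       (use eq g s q in \<open>auto intro!: continuous_intros\<close>)
qed

text \<open>Localisation by an event about the whole path on [0, t]; it takes the part that an exit
  time would play.\<close>

definition stays_below :: "'w measure \<Rightarrow> (real \<Rightarrow> 'w \<Rightarrow> real) \<Rightarrow> real \<Rightarrow> real \<Rightarrow> 'w set" where
  "stays_below M X t K = {\<omega> \<in> space M. \<forall>s\<in>{0..t}. \<bar>X s \<omega>\<bar> \<le> K}"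

locale diffusion =
  fixes a :: "real \<Rightarrow> real" and x :: real and M :: "'w measure" and B X :: "real \<Rightarrow> 'w \<Rightarrow> real"
  assumes a_C1: "a C1_differentiable_on UNIV"
    and bm: "brownian_motion M B" and sde: "solves_sde a x M B X"

sublocale diffusion \<subseteq> prob_space M
  using bm by (simp add: brownian_motion_def)

context diffusion
begin

lemma a_continuous: "continuous_on UNIV a"
  using a_C1 C1_differentiable_imp_continuous_on by blast

lemma a_lipschitz: "\<exists>L\<ge>0. \<forall>y y'. \<bar>y\<bar> \<le> R \<longrightarrow> \<bar>y'\<bar> \<le> R \<longrightarrow> \<bar>a y - a y'\<bar> \<le> L * \<bar>y - y'\<bar>"
proof -
  obtain D where D: "\<And>y. (a has_vector_derivative D y) (at y)" "continuous_on UNIV D"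
    using a_C1 unfolding C1_differentiable_on_def by auto
  obtain L where L: "\<And>y. \<bar>y\<bar> \<le> R \<Longrightarrow> \<bar>D y\<bar> \<le> L"
    using continuous_on_interval_bounded[OF continuous_on_subset[OF D(2) subset_UNIV], of R] by blast
  have "\<bar>a y - a y'\<bar> \<le> \<bar>L\<bar> * \<bar>y - y'\<bar>" if "\<bar>y\<bar> \<le> R" "\<bar>y'\<bar> \<le> R" for y y'
  proof -
    have "norm (a y - a y') \<le> \<bar>L\<bar> * norm (y - y')"
    proof (rule field_differentiable_bound[of "{-R..R}"])
      show "(a has_field_derivative D z) (at z within {-R..R})" for z
        using D(1)[of z] by (simp add: has_real_derivative_iff_has_vector_derivative has_vector_derivative_at_within)
      show "norm (D z) \<le> \<bar>L\<bar>" if "z \<in> {-R..R}" for z using L[of z] that by (auto simp: abs_le_iff)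
    qed (use that in auto)
    thus ?thesis by simp
  qed
  thus ?thesis by (intro exI[of _ "\<bar>L\<bar>"]) auto
qed

lemma X_measurable[measurable]: "t \<ge> 0 \<Longrightarrow> X t \<in> borel_measurable M"
  and X_continuous: "\<omega> \<in> space M \<Longrightarrow> continuous_on {0..t} (\<lambda>t. X t \<omega>)"
  and B_measurable[measurable]: "t \<ge> 0 \<Longrightarrow> B t \<in> borel_measurable M"
  using sde bm unfolding solves_sde_def brownian_motion_def
  by (blast, meson atLeastatMost_subset_iff atLeast_iff continuous_on_subset atLeastAtMost_iff subsetI, blast)

lemma B_indep_increments:
  fixes \<tau> :: "nat \<Rightarrow> real"
  assumes "0 \<le> \<tau> 0 \<and> (\<forall>i<n. \<tau> i < \<tau> (Suc i))"
  shows "indep_vars (\<lambda>_. borel) (\<lambda>i \<omega>. B (\<tau> (Suc i)) \<omega> - B (\<tau> i) \<omega>) {..<n}"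
  using bm[unfolded brownian_motion_def, THEN conjunct2, THEN conjunct2, THEN conjunct2, THEN conjunct2, THEN conjunct2,
    THEN spec, THEN spec, THEN mp, OF assms] .

lemma B_increment_law:
  "0 \<le> s \<Longrightarrow> s < t \<Longrightarrow> distributed M lborel (\<lambda>\<omega>. B t \<omega> - B s \<omega>) (normal_density 0 (sqrt (t - s)))"
  using bm[unfolded brownian_motion_def, THEN conjunct2, THEN conjunct2, THEN conjunct2, THEN conjunct2, THEN conjunct1,
    THEN spec, THEN spec, THEN mp, OF conjI] .

lemma sde_integral:
  "AE \<omega> in M. B 0 \<omega> = 0 \<and> (\<forall>s\<in>{0..t}. X s \<omega> = x + B s \<omega> - integral {0..s} (\<lambda>r. a (X r \<omega>)))"
proof -
  have "AE \<omega> in M. B 0 \<omega> = 0" "AE \<omega> in M. \<forall>t\<ge>0. X t \<omega> = x + B t \<omega> - (LBINT s:{0..t}. a (X s \<omega>))"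
    using sde bm by (auto simp: solves_sde_def brownian_motion_def)
  with AE_space show ?thesis
  proof eventually_elim
    case (elim \<omega>)
    have "(LBINT s:{0..u}. a (X s \<omega>)) = integral {0..u} (\<lambda>r. a (X r \<omega>))" for u
      by (intro set_integral_eq_integral_Icc continuous_on_compose2[OF a_continuous X_continuous[OF elim(1)]]) auto
    with elim show ?case by simp
  qed
qed

lemma weight_eq:
  fixes W :: "real \<Rightarrow> real"
  assumes "continuous_on UNIV W" "\<omega> \<in> space M"
  shows "(LBINT s:{0..t}. W (X s \<omega>)) = integral {0..t} (\<lambda>r. W (X r \<omega>))"
  by (intro set_integral_eq_integral_Icc continuous_on_compose2[OF assms(1) X_continuous[OF assms(2)]]) auto

lemma weight_measurable[measurable]:
  fixes W :: "real \<Rightarrow> real"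
  assumes W: "continuous_on UNIV W" and t: "t > 0"
  shows "(\<lambda>\<omega>. LBINT s:{0..t}. W (X s \<omega>)) \<in> borel_measurable M"
proof -
  have [measurable]: "W \<in> borel_measurable borel" using W by (rule borel_measurable_continuous_onI)
  have "(\<lambda>\<omega>. integral {0..t} (\<lambda>r. W (X r \<omega>))) \<in> borel_measurable M"
  proof (rule borel_measurable_LIMSEQ_real)
    show "(\<lambda>n. \<Sum>j<n. t / real n * W (X (real j * (t / real n)) \<omega>)) \<longlonglongrightarrow> integral {0..t} (\<lambda>r. W (X r \<omega>))" if "\<omega> \<in> space M" for \<omega>
      by (intro riemann_sums_tendsto[OF t] continuous_on_compose2[OF W X_continuous[OF that]]) auto
    show "(\<lambda>\<omega>. \<Sum>j<n. t / real n * W (X (real j * (t / real n)) \<omega>)) \<in> borel_measurable M" for n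
      using t by (intro borel_measurable_sum borel_measurable_times measurable_compose[OF X_measurable]) auto
  qed
  thus ?thesis by (rule measurable_cong[THEN iffD1, rotated]) (simp add: weight_eq[OF W])
qed

lemma weight_le:
  fixes W :: "real \<Rightarrow> real"
  assumes W: "continuous_on UNIV W" "\<And>y. W y \<le> w" and t: "t \<ge> 0" and \<omega>: "\<omega> \<in> space M"
  shows "(LBINT s:{0..t}. W (X s \<omega>)) \<le> w * t"
proof -
  have "integral {0..t} (\<lambda>r. W (X r \<omega>)) \<le> integral {0..t} (\<lambda>_. w)"
    using W t by (intro integral_le integrable_continuous_interval continuous_on_compose2[OF W(1) X_continuous[OF \<omega>]]) auto
  thus ?thesis using t by (simp add: weight_eq[OF W(1) \<omega>] mult.commute)
qed

lemma stays_below_sets[measurable]: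
  assumes "t > 0"
  shows "stays_below M X t K \<in> sets M"
proof -
  have "stays_below M X t K = {\<omega> \<in> space M. \<forall>s\<in>\<rat> \<inter> {0..t}. \<bar>X s \<omega>\<bar> \<le> K}"
    unfolding stays_below_def
    using continuous_on_bounded_by_rationals[OF assms X_continuous] by fast
  also have "\<dots> = space M - (\<Union>s\<in>\<rat> \<inter> {0..t}. {\<omega> \<in> space M. \<not> \<bar>X s \<omega>\<bar> \<le> K})" by auto
  also have "\<dots> \<in> sets M"
  proof (intro sets.Diff sets.top sets.countable_UN'')
    show "countable (\<rat> \<inter> {0..t})" by (simp add: countable_rat countable_Int1)
    fix s assume "s \<in> \<rat> \<inter> {0..t}"
    hence [measurable]: "X s \<in> borel_measurable M" by (intro X_measurable) simp
    show "{\<omega> \<in> space M. \<not> \<bar>X s \<omega>\<bar> \<le> K} \<in> sets M" by measurable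
  qed
  finally show ?thesis .
qed

lemma eventually_stays_below:
  "\<omega> \<in> space M \<Longrightarrow> \<exists>K0. \<forall>K\<ge>K0. \<omega> \<in> stays_below M X t K"
proof -
  assume \<omega>: "\<omega> \<in> space M"
  have "bounded ((\<lambda>s. X s \<omega>) ` {0..t})"
    by (intro compact_imp_bounded compact_continuous_image X_continuous[OF \<omega>]) simp
  then obtain K0 where "\<forall>s\<in>{0..t}. \<bar>X s \<omega>\<bar> \<le> K0" unfolding bounded_iff by auto
  thus ?thesis using \<omega> by (intro exI[of _ K0]) (force simp: stays_below_def)
qed

text \<open>On \<open>A\<close> the path keeps away from the freezing region, so the scheme
  converges there. Off \<open>A\<close> its limit is not controlled, but weight times f is at least
  -m exp (w t); restricting to \<open>A\<close> therefore raises the expectation by at most m exp (w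
  t) times the probability of leaving. This error involves only the lower bound of f and is zero for
  nonnegative f.\<close>

lemma supersolution_localized:
  fixes W f f1 f2 :: "real \<Rightarrow> real"
  assumes t: "t > 0" and W: "continuous_on UNIV W" "\<And>y. W y \<le> w" and w: "w \<ge> 0"
    and d1: "\<And>y. \<bar>y\<bar> \<le> R + 1 \<Longrightarrow> (f has_real_derivative f1 y) (at y)"
    and d2: "\<And>y. \<bar>y\<bar> \<le> R + 1 \<Longrightarrow> (f1 has_real_derivative f2 y) (at y)"
    and c2: "continuous_on {-R-1..R+1} f2"
    and fm[measurable]: "f \<in> borel_measurable borel" and bd: "\<And>y. \<bar>f y\<bar> \<le> C"
    and lower: "\<And>y. - m \<le> f y" "m \<ge> 0"
    and gen: "\<And>y. \<bar>y\<bar> \<le> R \<Longrightarrow> f2 y / 2 - a y * f1 y + W y * f y \<le> 0"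
  defines "A \<equiv> stays_below M X t (R - 1)"
  shows "expectation (\<lambda>\<omega>. indicator A \<omega> * (exp (LBINT s:{0..t}. W (X s \<omega>)) * f (X t \<omega>)))
     \<le> f x + m * exp (w * t) * (1 - prob A)"
proof -
  have Am[measurable]: "A \<in> sets M" unfolding A_def using t by (rule stays_below_sets)
  have C: "C \<ge> 0" using bd[of 0] by linarith
  have am[measurable]: "a \<in> borel_measurable borel" "W \<in> borel_measurable borel"
    by (intro borel_measurable_continuous_onI a_continuous W)+
  define h where "h = (\<lambda>n. t / real n)"
  define \<xi> where "\<xi> = (\<lambda>n (j::nat) \<omega>. B (real (Suc j) * h n) \<omega> - B (real j * h n) \<omega>)"
  define Y where "Y = (\<lambda>n \<omega>. euler a W R (h n) x (\<lambda>j. \<xi> n j \<omega>) n)"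
  define Z where "Z = (\<lambda>n \<omega>. snd (Y n \<omega>) * f (fst (Y n \<omega>)))"
  have h: "h n > 0" "real n * h n = t" if "n > 0" for n using that t by (auto simp: h_def)
  have \<xi>m: "\<xi> n j \<in> borel_measurable M" for n j
    unfolding \<xi>_def using t by (intro borel_measurable_diff B_measurable) (auto simp: h_def)
  have Ym[measurable]: "Y n \<in> measurable M (borel \<Otimes>\<^sub>M borel)" for n
  proof -
    have "(\<lambda>\<omega>. restrict (\<lambda>j. \<xi> n j \<omega>) {..<n}) \<in> measurable M (PiM {..<n} (\<lambda>_. borel))"
      using \<xi>m by (intro measurable_restrict) auto
    from measurable_compose[OF this euler_measurable[OF am order_refl]]
    show ?thesis unfolding Y_def
      by (rule measurable_cong[THEN iffD1, rotated]) (auto intro!: euler_cong)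
  qed
  have Zm[measurable]: "Z n \<in> borel_measurable M" for n unfolding Z_def by measurable
  have Yb: "0 \<le> snd (Y n \<omega>)" "snd (Y n \<omega>) \<le> exp (w * t)" if "n > 0" for n \<omega>
  proof -
    have "w * h n * real n = w * t" using h(2)[OF that] by (metis mult.assoc mult.commute)
    with euler_weight_bounds[of W w "h n" a R x "\<lambda>j. \<xi> n j \<omega>" n] W w h(1)[OF that]
    show "0 \<le> snd (Y n \<omega>)" "snd (Y n \<omega>) \<le> exp (w * t)" unfolding Y_def by auto
  qed
  have Zb: "\<bar>Z n \<omega>\<bar> \<le> exp (w * t) * C" if "n > 0" for n \<omega>
    unfolding Z_def abs_mult using Yb[OF that, of \<omega>] bd C by (intro mult_mono) auto
  have Zi: "integrable M (Z n)" if "n > 0" for n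
    by (rule integrable_const_bound[of _ "exp (w * t) * C"]) (use Zb[OF that] in auto)
  have Zl: "Z n \<omega> \<ge> - (m * exp (w * t))" if "n > 0" for n \<omega>
  proof -
    have "snd (Y n \<omega>) * - m \<le> Z n \<omega>" unfolding Z_def using Yb[OF that] lower by (intro mult_left_mono) auto
    moreover have "snd (Y n \<omega>) * m \<le> exp (w * t) * m" using Yb[OF that] lower by (intro mult_right_mono) auto
    ultimately show ?thesis by (simp add: mult.commute)
  qed
  have Ai: "integrable M (indicat_real A)" by (rule integrable_real_indicator) (auto simp: emeasure_eq_measure)
  have EZ: "eventually (\<lambda>n. expectation (Z n) \<le> f x + e) sequentially" if e: "e > 0" for e
  proof -
    \<comment> \<open>Each of the t / h steps loses at most \<epsilon> h exp (w t); this choice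
      makes the total equal to e.\<close>
    define \<epsilon> where "\<epsilon> = e / (t * exp (w * t))"
    have "\<epsilon> > 0" using e t by (simp add: \<epsilon>_def)
    from euler_step_consistent[OF d1 d2 c2 fm bd a_continuous W(1) gen this]
    obtain h0 where h0: "h0 > 0" "\<And>h y. 0 < h \<Longrightarrow> h \<le> h0 \<Longrightarrow> \<bar>y\<bar> \<le> R \<Longrightarrow>
       exp (h * W y) * (\<integral>z. f (y - h * a y + z) \<partial>gauss h) \<le> f y + \<epsilon> * h" by blast
    obtain N where N: "real N > t / h0" using reals_Archimedean2 by blast
    have "expectation (Z n) \<le> f x + e" if n: "n > max N 1" for n
    proof -
      have n0: "n > 0" using n by simp
      have "real N \<le> real n" using n by simp
      hence "t / h0 < real n" using N by linarith
      hence hn: "h n \<le> h0" using n h0(1) by (simp add: h_def divide_le_eq divide_less_eq mult.commute)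
      have "expectation (\<lambda>\<omega>. snd (euler a W R (h n) x (\<lambda>j. \<xi> n j \<omega>) n) * f (fst (euler a W R (h n) x (\<lambda>j. \<xi> n j \<omega>) n)))
         \<le> f x + real n * (\<epsilon> * h n * exp (w * h n * real n))"
      proof (rule euler_expectation[where \<xi> = "\<xi> n"])
        have "0 \<le> real 0 * h n \<and> (\<forall>i<n. real i * h n < real (Suc i) * h n)"
          using h(1)[OF n0] by (simp add: algebra_simps)
        with B_indep_increments[of "\<lambda>i. real i * h n" n] show "indep_vars (\<lambda>_. borel) (\<xi> n) {..<n}"
          unfolding \<xi>_def by simp
        show "distr M borel (\<xi> n i) = gauss (h n)" for i
        proof -
          have "distributed M lborel (\<lambda>\<omega>. B (real (Suc i) * h n) \<omega> - B (real i * h n) \<omega>) (normal_density 0 (sqrt (real (Suc i) * h n - real i * h n)))"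
            using h(1)[OF n0] by (intro B_increment_law) simp_all
          moreover have "real (Suc i) * h n - real i * h n = h n" by (simp add: algebra_simps)
          ultimately have "distr M lborel (\<xi> n i) = gauss (h n)"
            unfolding gauss_def \<xi>_def by (metis distributed_def)
          moreover have "distr M borel (\<xi> n i) = distr M lborel (\<xi> n i)" by (rule distr_cong) auto
          ultimately show ?thesis by simp
        qed
      qed (use h[OF n0] am bd W w hn h0 \<open>\<epsilon> > 0\<close> fm in auto)
      also have "real n * (\<epsilon> * h n * exp (w * h n * real n)) = \<epsilon> * (real n * h n) * exp (w * (real n * h n))" by (simp add: mult_ac)
      also have "\<dots> = e" unfolding h(2)[OF n0] using t by (simp add: \<epsilon>_def)
      finally show ?thesis by (simp add: Z_def Y_def)
    qed
    thus ?thesis unfolding eventually_sequentially by (metis Suc_le_eq)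
  qed
  define F where "F = (\<lambda>\<omega>. indicator A \<omega> * (exp (LBINT s:{0..t}. W (X s \<omega>)) * f (X t \<omega>)))"
  have [measurable]: "X t \<in> borel_measurable M" "(\<lambda>\<omega>. LBINT s:{0..t}. W (X s \<omega>)) \<in> borel_measurable M"
    using t W by auto
  \<comment> \<open>The sequence is shifted by one because the step size t / n and the bounds on the
    scheme make sense for n > 0 only.\<close>
  have conv: "(\<lambda>n. expectation (\<lambda>\<omega>. indicator A \<omega> * Z (Suc n) \<omega>)) \<longlonglongrightarrow> expectation F"
  proof (rule integral_dominated_convergence[where w="\<lambda>_. exp (w * t) * C"])
    show "F \<in> borel_measurable M" unfolding F_def by measurable
    show "AE \<omega> in M. (\<lambda>n. indicator A \<omega> * Z (Suc n) \<omega>) \<longlonglongrightarrow> F \<omega>"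
      using sde_integral[of t] AE_space
    proof eventually_elim
      case (elim \<omega>)
      show ?case
      proof (cases "\<omega> \<in> A")
        case True
        hence XR: "\<And>s. s \<in> {0..t} \<Longrightarrow> \<bar>X s \<omega>\<bar> \<le> R - 1" by (simp add: A_def stays_below_def)
        obtain L where L: "L \<ge> 0" "\<And>y y'. \<bar>y\<bar> \<le> R \<Longrightarrow> \<bar>y'\<bar> \<le> R \<Longrightarrow> \<bar>a y - a y'\<bar> \<le> L * \<bar>y - y'\<bar>"
          using a_lipschitz by blast
        have c: "(\<lambda>n. fst (Y n \<omega>)) \<longlonglongrightarrow> X t \<omega>" "(\<lambda>n. snd (Y n \<omega>)) \<longlonglongrightarrow> exp (integral {0..t} (\<lambda>s. W (X s \<omega>)))"
          unfolding Y_def \<xi>_def h_def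
          by (rule euler_converges[OF t X_continuous a_continuous W(1) _ _ XR L]; use elim in simp)+
        \<comment> \<open>Continuity of \<open>f\<close> is known on [-R-1, R+1] only; on
          \<open>A\<close> the endpoint of the path lies there.\<close>
        have "\<bar>X t \<omega>\<bar> \<le> R + 1" using XR[of t] t by simp
        hence "isCont f (X t \<omega>)" using DERIV_isCont[OF d1] by blast
        hence "(\<lambda>n. f (fst (Y n \<omega>))) \<longlonglongrightarrow> f (X t \<omega>)" using c(1) by (rule isCont_tendsto_compose)
        hence "(\<lambda>n. Z n \<omega>) \<longlonglongrightarrow> exp (LBINT s:{0..t}. W (X s \<omega>)) * f (X t \<omega>)"
          unfolding Z_def using elim W c(2) by (intro tendsto_mult) (auto simp: weight_eq)
        hence "(\<lambda>n. Z (Suc n) \<omega>) \<longlonglongrightarrow> exp (LBINT s:{0..t}. W (X s \<omega>)) * f (X t \<omega>)"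
          by (rule LIMSEQ_Suc)
        thus ?thesis using True by (simp add: F_def)
      qed (simp add: F_def)
    qed
    show "AE \<omega> in M. norm (indicator A \<omega> * Z (Suc n) \<omega>) \<le> exp (w * t) * C" for n
      using Zb[of "Suc n"] C by (auto simp: indicator_def)
  qed auto
  have le: "expectation (\<lambda>\<omega>. indicator A \<omega> * Z n \<omega>) \<le> expectation (Z n) + m * exp (w * t) * (1 - prob A)" if n: "n > 0" for n
  proof -
    have "expectation (\<lambda>\<omega>. indicator A \<omega> * Z n \<omega>) \<le> expectation (\<lambda>\<omega>. Z n \<omega> + m * exp (w * t) * (1 - indicator A \<omega>))"
    proof (rule integral_mono)
      show "integrable M (\<lambda>\<omega>. indicator A \<omega> * Z n \<omega>)"
        using integrable_mult_indicator[OF Am Zi[OF n]] by simp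
      show "integrable M (\<lambda>\<omega>. Z n \<omega> + m * exp (w * t) * (1 - indicator A \<omega>))"
        using Zi[OF n] Ai by (intro Bochner_Integration.integrable_add integrable_mult_right Bochner_Integration.integrable_diff) auto
      show "indicator A \<omega> * Z n \<omega> \<le> Z n \<omega> + m * exp (w * t) * (1 - indicator A \<omega>)" for \<omega>
        using Zl[OF n, of \<omega>] by (auto simp: indicator_def)
    qed
    also have "\<dots> = expectation (Z n) + m * exp (w * t) * (1 - prob A)"
      using Zi[OF n] Ai by (simp add: prob_space)
    finally show ?thesis .
  qed
  show ?thesis unfolding F_def[symmetric]
  proof (rule field_le_epsilon)
    fix e :: real assume e: "e > 0"
    show "expectation F \<le> f x + m * exp (w * t) * (1 - prob A) + e"
    proof (rule tendsto_upperbound[OF conv])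
      have "eventually (\<lambda>n. expectation (Z (Suc n)) \<le> f x + e) sequentially"
        using EZ[OF e] by (rule eventually_sequentially_Suc[of "\<lambda>n. expectation (Z n) \<le> f x + e", THEN iffD2])
      thus "eventually (\<lambda>n. expectation (\<lambda>\<omega>. indicator A \<omega> * Z (Suc n) \<omega>) \<le> f x + m * exp (w * t) * (1 - prob A) + e) sequentially"
      proof eventually_elim
        case (elim n) thus ?case using le[of "Suc n"] by simp
      qed
    qed simp
  qed
qed

end

section \<open>Removing the localisation\<close>

lemma exp_cancel: "exp (- l * t) * (exp (l * t) * z) = z" for l t z :: real
  by (simp add: mult.assoc[symmetric] exp_add[symmetric])

context diffusion
begin

lemma stays_belowD: "\<omega> \<in> stays_below M X t K \<Longrightarrow> 0 \<le> s \<Longrightarrow> s \<le> t \<Longrightarrow> \<bar>X s \<omega>\<bar> \<le> K"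
  by (simp add: stays_below_def)

lemma stays_below_indicator_tendsto:
  assumes "\<omega> \<in> space M"
  shows "(\<lambda>n. indicat_real (stays_below M X t (real n - 1)) \<omega>) \<longlonglongrightarrow> 1"
proof -
  obtain K0 where K0: "\<And>K. K \<ge> K0 \<Longrightarrow> \<omega> \<in> stays_below M X t K"
    using eventually_stays_below[OF assms] by blast
  have "eventually (\<lambda>n. indicat_real (stays_below M X t (real n - 1)) \<omega> = 1) sequentially"
    using eventually_ge_at_top[of "nat \<lceil>K0 + 1\<rceil>"]
  proof eventually_elim
    case (elim n)
    hence "real n - 1 \<ge> K0" by linarith
    thus ?case using K0 by simp
  qed
  thus ?thesis by (rule tendsto_eventually)
qed

lemma prob_stays_below_tendsto:
  assumes t: "t > 0"
  shows "(\<lambda>n. prob (stays_below M X t (real n - 1))) \<longlonglongrightarrow> 1"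
proof -
  have [measurable]: "stays_below M X t K \<in> sets M" for K using t by (rule stays_below_sets)
  have "(\<lambda>n. expectation (indicat_real (stays_below M X t (real n - 1)))) \<longlonglongrightarrow> expectation (\<lambda>_. 1)"
    by (rule integral_dominated_convergence[where w="\<lambda>_. 1"])
       (auto simp: stays_below_indicator_tendsto intro!: AE_I2 split: split_indicator)
  thus ?thesis by (simp add: prob_space)
qed

lemma weight_add_const:
  assumes V: "continuous_on UNIV V" and t: "t \<ge> 0" and \<omega>: "\<omega> \<in> space M"
  shows "(LBINT s:{0..t}. V (X s \<omega>) + c) = (LBINT s:{0..t}. V (X s \<omega>)) + c * t"
proof -
  have "continuous_on {0..t} (\<lambda>s. V (X s \<omega>))"
    by (intro continuous_on_compose2[OF V X_continuous[OF \<omega>]]) auto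
  moreover have "continuous_on UNIV (\<lambda>y. V y + c)" using V by (intro continuous_intros)
  ultimately show ?thesis
    using weight_eq[OF V \<omega>, of t] weight_eq[of "\<lambda>y. V y + c" \<omega> t] \<omega> t
    by (simp add: Henstock_Kurzweil_Integration.integral_add integrable_continuous_interval)
qed

lemma weight_exp_add_const:
  assumes V: "continuous_on UNIV V" and t: "t \<ge> 0" and \<omega>: "\<omega> \<in> space M"
  shows "exp (LBINT s:{0..t}. V (X s \<omega>) + c) = exp (c * t) * exp (LBINT s:{0..t}. V (X s \<omega>))"
  by (simp add: weight_add_const[OF assms] exp_add)

text \<open>The eigenvalue is absorbed into the potential: with V + l in place of V the equation has
  right-hand side 0, and the constant reappears as the factor exp (l t). Every path is bounded on
  [0, t], so the probability of leaving [-(n-1), n-1] tends to 0 and takes the localisation error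
  with it.\<close>

lemma bounded_solution_le:
  fixes V f f1 f2 :: "real \<Rightarrow> real"
  assumes t: "t > 0" and V: "continuous_on UNIV V" "\<And>y. V y \<le> v"
    and d1: "\<And>y. (f has_real_derivative f1 y) (at y)"
    and d2: "\<And>y. (f1 has_real_derivative f2 y) (at y)"
    and c2: "continuous_on UNIV f2" and bd: "\<And>y. \<bar>f y\<bar> \<le> C"
    and gen: "\<And>y. f2 y / 2 - a y * f1 y + V y * f y = - l * f y"
  shows "expectation (\<lambda>\<omega>. exp (LBINT s:{0..t}. V (X s \<omega>)) * f (X t \<omega>)) \<le> exp (- l * t) * f x"
proof -
  define A where "A = (\<lambda>n. stays_below M X t (real n - 1))"
  have Am[measurable]: "A n \<in> sets M" for n unfolding A_def using t by (rule stays_below_sets)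
  define F where "F = (\<lambda>\<omega>. exp (LBINT s:{0..t}. V (X s \<omega>)) * f (X t \<omega>))"
  define w where "w = max 0 (v + l)"
  have cf: "continuous_on UNIV f" by (intro continuous_at_imp_continuous_on ballI DERIV_isCont[OF d1])
  have fm[measurable]: "f \<in> borel_measurable borel" by (rule borel_measurable_continuous_onI[OF cf])
  have [measurable]: "X t \<in> borel_measurable M" "(\<lambda>\<omega>. LBINT s:{0..t}. V (X s \<omega>)) \<in> borel_measurable M"
    using t V by auto
  have Fm[measurable]: "F \<in> borel_measurable M" unfolding F_def by measurable
  have C: "C \<ge> 0" using bd[of 0] by linarith
  have Fb: "\<bar>F \<omega>\<bar> \<le> exp (v * t) * C" if "\<omega> \<in> space M" for \<omega>
    unfolding F_def abs_mult using weight_le[OF V _ that, of t] t bd C by (intro mult_mono) auto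
  have le: "exp (l * t) * expectation (\<lambda>\<omega>. indicator (A n) \<omega> * F \<omega>) \<le> f x + C * exp (w * t) * (1 - prob (A n))" for n
  proof -
    have "exp (l * t) * expectation (\<lambda>\<omega>. indicator (A n) \<omega> * F \<omega>) =
        expectation (\<lambda>\<omega>. exp (l * t) * (indicator (A n) \<omega> * F \<omega>))" by simp
    also have "\<dots> = expectation (\<lambda>\<omega>. indicator (A n) \<omega> * (exp (LBINT s:{0..t}. V (X s \<omega>) + l) * f (X t \<omega>)))"
      using t by (intro Bochner_Integration.integral_cong refl) (simp add: F_def weight_exp_add_const[OF V(1)])
    also have "\<dots> \<le> f x + C * exp (w * t) * (1 - prob (A n))"
      unfolding A_def
    proof (rule supersolution_localized[OF t, where ?f1.0 = f1 and ?f2.0 = f2 and W = "\<lambda>y. V y + l"])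
      show "continuous_on UNIV (\<lambda>y. V y + l)" using V by (intro continuous_intros)
      show "V y + l \<le> w" for y using V(2)[of y] by (simp add: w_def)
      show "continuous_on {- real n - 1..real n + 1} f2" using c2 by (rule continuous_on_subset) simp
      show "f2 y / 2 - a y * f1 y + (V y + l) * f y \<le> 0" for y using gen[of y] by (simp add: algebra_simps)
      show "- C \<le> f y" for y using bd[of y] by linarith
    qed (use d1 d2 bd C in \<open>auto simp: w_def\<close>)
    finally show ?thesis .
  qed
  have "(\<lambda>n. expectation (\<lambda>\<omega>. indicator (A n) \<omega> * F \<omega>)) \<longlonglongrightarrow> expectation F"
  proof (rule integral_dominated_convergence[where w="\<lambda>_. exp (v * t) * C"])
    show "AE \<omega> in M. (\<lambda>n. indicator (A n) \<omega> * F \<omega>) \<longlonglongrightarrow> F \<omega>"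
    proof (rule AE_I2)
      fix \<omega> assume "\<omega> \<in> space M"
      from tendsto_mult[OF stays_below_indicator_tendsto[OF this, of t] tendsto_const[of "F \<omega>"]]
      show "(\<lambda>n. indicator (A n) \<omega> * F \<omega>) \<longlonglongrightarrow> F \<omega>" by (simp add: A_def)
    qed
    show "AE \<omega> in M. norm (indicator (A n) \<omega> * F \<omega>) \<le> exp (v * t) * C" for n
      using Fb C by (auto simp: indicator_def)
  qed auto
  hence 1: "(\<lambda>n. exp (l * t) * expectation (\<lambda>\<omega>. indicator (A n) \<omega> * F \<omega>)) \<longlonglongrightarrow> exp (l * t) * expectation F"
    by (rule tendsto_mult_left)
  have "(\<lambda>n. f x + C * exp (w * t) * (1 - prob (A n))) \<longlonglongrightarrow> f x + C * exp (w * t) * (1 - 1)"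
    unfolding A_def by (intro tendsto_intros prob_stays_below_tendsto t)
  from LIMSEQ_le[OF 1 this] have "exp (l * t) * expectation F \<le> f x + C * exp (w * t) * (1 - 1)"
    using le by blast
  hence "exp (- l * t) * (exp (l * t) * expectation F) \<le> exp (- l * t) * f x" by (intro mult_left_mono) auto
  thus ?thesis unfolding exp_cancel by (simp add: F_def)
qed

text \<open>Both \<open>f\<close> and its negative solve the same linear equation, so the one-sided
  bound applies to each.\<close>

lemma bounded_eigenfunction:
  fixes V f f1 f2 :: "real \<Rightarrow> real"
  assumes t: "t > 0" and V: "continuous_on UNIV V" "\<And>y. V y \<le> v"
    and d1: "\<And>y. (f has_real_derivative f1 y) (at y)"
    and d2: "\<And>y. (f1 has_real_derivative f2 y) (at y)"
    and c2: "continuous_on UNIV f2" and bd: "\<And>y. \<bar>f y\<bar> \<le> C"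
    and gen: "\<And>y. f2 y / 2 - a y * f1 y + V y * f y = - l * f y"
  shows "expectation (\<lambda>\<omega>. exp (LBINT s:{0..t}. V (X s \<omega>)) * f (X t \<omega>)) = exp (- l * t) * f x"
proof (rule antisym)
  show "expectation (\<lambda>\<omega>. exp (LBINT s:{0..t}. V (X s \<omega>)) * f (X t \<omega>)) \<le> exp (- l * t) * f x"
    by (rule bounded_solution_le[OF assms])
  have "expectation (\<lambda>\<omega>. exp (LBINT s:{0..t}. V (X s \<omega>)) * - f (X t \<omega>)) \<le> exp (- l * t) * - f x"
  proof (rule bounded_solution_le[OF t V, where ?f1.0 = "\<lambda>y. - f1 y" and ?f2.0 = "\<lambda>y. - f2 y"])
    show "- f2 y / 2 - a y * - f1 y + V y * - f y = - l * - f y" for y using gen[of y] by (simp add: algebra_simps)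
  qed (use d1 d2 c2 bd in \<open>auto intro!: derivative_intros continuous_intros\<close>)
  thus "exp (- l * t) * f x \<le> expectation (\<lambda>\<omega>. exp (LBINT s:{0..t}. V (X s \<omega>)) * f (X t \<omega>))" by simp
qed

text \<open>As \<open>g\<close> may be unbounded, it is cut off far out. Nonnegativity makes the
  exit error vanish, so the localised bound holds for each large n without loss, and Fatou's lemma
  yields integrability and the bound together.\<close>

lemma nonneg_supersolution:
  fixes V g g1 g2 :: "real \<Rightarrow> real"
  assumes t: "t > 0" and V: "continuous_on UNIV V" "\<And>y. V y \<le> v"
    and d1: "\<And>y. (g has_real_derivative g1 y) (at y)"
    and d2: "\<And>y. (g1 has_real_derivative g2 y) (at y)"
    and c2: "continuous_on UNIV g2" and pos: "\<And>y. g y \<ge> 0"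
    and gen: "\<And>y. g2 y / 2 - a y * g1 y + V y * g y \<le> c * g y"
  shows "integrable M (\<lambda>\<omega>. exp (LBINT s:{0..t}. V (X s \<omega>)) * g (X t \<omega>))"
    and "expectation (\<lambda>\<omega>. exp (LBINT s:{0..t}. V (X s \<omega>)) * g (X t \<omega>)) \<le> exp (c * t) * g x"
proof -
  define A where "A = (\<lambda>n. stays_below M X t (real n - 1))"
  have Am[measurable]: "A n \<in> sets M" for n unfolding A_def using t by (rule stays_below_sets)
  define F where "F = (\<lambda>\<omega>. exp (LBINT s:{0..t}. V (X s \<omega>)) * g (X t \<omega>))"
  define w where "w = max 0 (v - c)"
  have cg: "continuous_on UNIV g" by (intro continuous_at_imp_continuous_on ballI DERIV_isCont[OF d1])
  have gm[measurable]: "g \<in> borel_measurable borel" by (rule borel_measurable_continuous_onI[OF cg])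
  have [measurable]: "X t \<in> borel_measurable M" "(\<lambda>\<omega>. LBINT s:{0..t}. V (X s \<omega>)) \<in> borel_measurable M"
    using t V by auto
  have Fm[measurable]: "F \<in> borel_measurable M" unfolding F_def by measurable
  have F0: "F \<omega> \<ge> 0" for \<omega> using pos by (simp add: F_def)
  have le: "(\<integral>\<^sup>+\<omega>. ennreal (indicator (A n) \<omega> * F \<omega>) \<partial>M) \<le> ennreal (exp (c * t) * g x)" if x: "\<bar>x\<bar> \<le> real n" for n
  proof -
    \<comment> \<open>The cut at n + 2 lies strictly outside |y| \<le> n + 1, where derivatives are
      required; neither a starting point with |x| \<le> n nor a path in \<open>A n\<close> is
      affected by it.\<close>
    define f where "f = (\<lambda>y. if \<bar>y\<bar> < real n + 2 then g y else 0)"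
    obtain C where C: "\<And>y. \<bar>y\<bar> \<le> real n + 2 \<Longrightarrow> \<bar>g y\<bar> \<le> C"
      using continuous_on_interval_bounded[OF continuous_on_subset[OF cg subset_UNIV]] by blast
    have C0: "C \<ge> 0" using C[of 0] by linarith
    have fm[measurable]: "f \<in> borel_measurable borel" unfolding f_def by measurable
    have fb: "\<bar>f y\<bar> \<le> C" for y using C[of y] C0 by (simp add: f_def)
    have "expectation (\<lambda>\<omega>. indicator (A n) \<omega> * (exp (LBINT s:{0..t}. V (X s \<omega>) + - c) * f (X t \<omega>)))
        \<le> f x + 0 * exp (w * t) * (1 - prob (A n))"
      unfolding A_def
    proof (rule supersolution_localized[OF t, where ?f1.0 = g1 and ?f2.0 = g2 and W = "\<lambda>y. V y + - c"])
      show "continuous_on UNIV (\<lambda>y. V y + - c)" using V by (intro continuous_intros)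
      show "V y + - c \<le> w" for y using V(2)[of y] by (simp add: w_def)
      show "continuous_on {- real n - 1..real n + 1} g2" using c2 by (rule continuous_on_subset) simp
      show "(f has_real_derivative g1 y) (at y)" if "\<bar>y\<bar> \<le> real n + 1" for y
      proof (rule has_field_derivative_transform_within_open[OF d1[of y], of "{- (real n + 2)<..<real n + 2}"])
        show "y \<in> {- (real n + 2)<..<real n + 2}" using that by auto
        show "g z = f z" if "z \<in> {- (real n + 2)<..<real n + 2}" for z using that by (auto simp: f_def)
      qed simp
      show "g2 y / 2 - a y * g1 y + (V y + - c) * f y \<le> 0" if "\<bar>y\<bar> \<le> real n" for y
        using gen[of y] that by (simp add: algebra_simps f_def)
      show "- 0 \<le> f y" for y using pos by (simp add: f_def)
    qed (use d2 fb in \<open>auto simp: w_def\<close>)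
    also have "f x + 0 * exp (w * t) * (1 - prob (A n)) = g x" using x by (simp add: f_def)
    also have "expectation (\<lambda>\<omega>. indicator (A n) \<omega> * (exp (LBINT s:{0..t}. V (X s \<omega>) + - c) * f (X t \<omega>)))
       = expectation (\<lambda>\<omega>. exp (- c * t) * (indicator (A n) \<omega> * F \<omega>))"
    proof (intro Bochner_Integration.integral_cong refl)
      fix \<omega> assume \<omega>: "\<omega> \<in> space M"
      have "f (X t \<omega>) = g (X t \<omega>)" if "\<omega> \<in> A n"
        using stays_belowD[of \<omega> t "real n - 1" t] that t by (simp add: f_def A_def)
      thus "indicator (A n) \<omega> * (exp (LBINT s:{0..t}. V (X s \<omega>) + - c) * f (X t \<omega>)) = exp (- c * t) * (indicator (A n) \<omega> * F \<omega>)"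
        unfolding weight_exp_add_const[OF V(1) less_imp_le[OF t] \<omega>] by (auto simp: F_def indicator_def)
    qed
    finally have E: "exp (- c * t) * expectation (\<lambda>\<omega>. indicator (A n) \<omega> * F \<omega>) \<le> g x" by simp
    have "expectation (\<lambda>\<omega>. indicator (A n) \<omega> * F \<omega>) \<le> exp (c * t) * g x"
      using mult_left_mono[OF E, of "exp (c * t)"] by (simp add: mult.assoc[symmetric] exp_add[symmetric])
    moreover have "integrable M (\<lambda>\<omega>. indicator (A n) \<omega> * F \<omega>)"
    proof (rule integrable_const_bound[of _ "exp (v * t) * C"])
      show "AE \<omega> in M. norm (indicator (A n) \<omega> * F \<omega>) \<le> exp (v * t) * C"
      proof (rule AE_I2)
        fix \<omega> assume \<omega>: "\<omega> \<in> space M"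
        show "norm (indicator (A n) \<omega> * F \<omega>) \<le> exp (v * t) * C"
        proof (cases "\<omega> \<in> A n")
          case True
          hence "\<bar>X t \<omega>\<bar> \<le> real n + 2" using stays_belowD[of \<omega> t "real n - 1" t] t by (simp add: A_def)
          from C[OF this] weight_le[OF V _ \<omega>, of t] t have "\<bar>F \<omega>\<bar> \<le> exp (v * t) * C"
            unfolding F_def abs_mult by (intro mult_mono) auto
          thus ?thesis using True by simp
        qed (use C0 in simp)
      qed
    qed simp
    ultimately show ?thesis using F0 by (subst nn_integral_eq_integral) (auto intro: ennreal_leI)
  qed
  have "(\<integral>\<^sup>+\<omega>. ennreal (F \<omega>) \<partial>M) = (\<integral>\<^sup>+\<omega>. liminf (\<lambda>n. ennreal (indicator (A n) \<omega> * F \<omega>)) \<partial>M)"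
  proof (rule nn_integral_cong)
    fix \<omega> assume "\<omega> \<in> space M"
    from tendsto_mult[OF stays_below_indicator_tendsto[OF this, of t] tendsto_const[of "F \<omega>"]]
    have "(\<lambda>n. ennreal (indicator (A n) \<omega> * F \<omega>)) \<longlonglongrightarrow> ennreal (F \<omega>)"
      by (intro tendsto_ennrealI) (simp add: A_def)
    thus "ennreal (F \<omega>) = liminf (\<lambda>n. ennreal (indicator (A n) \<omega> * F \<omega>))"
      by (simp add: lim_imp_Liminf)
  qed
  also have "\<dots> \<le> liminf (\<lambda>n. \<integral>\<^sup>+\<omega>. ennreal (indicator (A n) \<omega> * F \<omega>) \<partial>M)"
    by (rule nn_integral_liminf) simp
  also have "\<dots> \<le> liminf (\<lambda>n::nat. ennreal (exp (c * t) * g x))"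
  proof (rule Liminf_mono)
    show "eventually (\<lambda>n. (\<integral>\<^sup>+\<omega>. ennreal (indicator (A n) \<omega> * F \<omega>) \<partial>M) \<le> ennreal (exp (c * t) * g x)) sequentially"
      using eventually_ge_at_top[of "nat \<lceil>\<bar>x\<bar>\<rceil>"]
    proof eventually_elim
      case (elim n) thus ?case by (intro le) linarith
    qed
  qed
  also have "\<dots> = ennreal (exp (c * t) * g x)" by (simp add: Liminf_const)
  finally have *: "(\<integral>\<^sup>+\<omega>. ennreal (F \<omega>) \<partial>M) \<le> ennreal (exp (c * t) * g x)" .
  have i: "integrable M F"
    using * F0 by (intro integrableI_nonneg) (auto simp: ennreal_less_top order_le_less_trans)
  thus "integrable M (\<lambda>\<omega>. exp (LBINT s:{0..t}. V (X s \<omega>)) * g (X t \<omega>))" by (simp add: F_def)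
  have "expectation F \<le> exp (c * t) * g x"
    using * nn_integral_eq_integral[OF i] F0 pos[of x] by (simp add: ennreal_le_iff)
  thus "expectation (\<lambda>\<omega>. exp (LBINT s:{0..t}. V (X s \<omega>)) * g (X t \<omega>)) \<le> exp (c * t) * g x" by (simp add: F_def)
qed

end


section \<open>Eigenfunction expansions\<close>

lemma integrable_exp_neg_abs: "integrable lborel (\<lambda>x::real. exp (- \<bar>x\<bar>))"
proof -
  have "(\<integral>\<^sup>+x. ennreal (exponential_density 1 x) \<partial>lborel) = 1"
    using prob_space.emeasure_space_1[OF prob_space_exponential_density[of 1]]
    by (simp add: emeasure_density)
  hence i: "integrable lborel (exponential_density 1)"
    by (intro integrableI_nonneg) (auto simp: exponential_density_nonneg)
  have "integrable lborel (\<lambda>x. exponential_density 1 (0 + (- 1) * x))"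
    by (rule lborel_integrable_real_affine[OF i]) simp
  with i have "integrable lborel (\<lambda>x. exponential_density 1 x + exponential_density 1 (0 + (- 1) * x))"
    by (rule Bochner_Integration.integrable_add)
  thus ?thesis
    by (rule Bochner_Integration.integrable_bound) (auto simp: exponential_density_def)
qed

section \<open>From L^2 bounds to sup bounds\<close>

text \<open>Moving to the right, the derivative can drop by at most the integral of
  \<open>k\<close>. Were it larger than this integral plus e at some point, it would exceed e from
  there on and \<open>h\<close> would outgrow its bound. Moving to the left treats negative
  values.\<close>

lemma bounded_derivative_of_almost_convex:
  fixes h h1 h2 k :: "real \<Rightarrow> real"
  assumes h1: "\<And>x. (h has_real_derivative h1 x) (at x)"
    and h2: "\<And>x. (h1 has_real_derivative h2 x) (at x)"
    and bd: "\<And>x. 0 \<le> h x" "\<And>x. h x \<le> H"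
    and k: "\<And>x. - k x \<le> h2 x" "\<And>x. k x \<ge> 0" "continuous_on UNIV k" "integrable lborel k"
  shows "\<bar>h1 x\<bar> \<le> integral\<^sup>L lborel k"
proof -
  have mono: "h1 y - h1 x \<ge> - integral\<^sup>L lborel k" if "x \<le> y" for x y
  proof -
    have ck: "continuous_on {x..y} k" using k(3) by (rule continuous_on_subset) simp
    have 1: "(k has_integral integral {x..y} k) {x..y}" 
      by (intro integrable_integral integrable_continuous_interval ck)
    have 2: "(h2 has_integral (h1 y - h1 x)) {x..y}"
      using that has_field_derivative_at_within[OF h2]
      by (intro fundamental_theorem_of_calculus) (simp_all only: has_real_derivative_iff_has_vector_derivative)
    from has_integral_le[OF has_integral_neg[OF 1] 2] have "- integral {x..y} k \<le> h1 y - h1 x"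
      using k(1) by blast
    moreover have "integral {x..y} k = (LBINT s:{x..y}. k s)"
      using borel_integrable_atLeastAtMost'[OF ck] by (rule set_borel_integral_eq_integral(2)[symmetric])
    moreover have "(LBINT s:{x..y}. k s) \<le> integral\<^sup>L lborel k"
      unfolding set_lebesgue_integral_def
      using k(2) by (intro integral_mono integrable_mult_indicator k(4)) (auto simp: indicator_def)
    ultimately show ?thesis by linarith
  qed
  have H: "H \<ge> 0" using bd[of 0] by linarith
  have "h1 x \<le> integral\<^sup>L lborel k + e" if "e > 0" for e
  proof -
    \<comment> \<open>Over this length an increase of at most H forces a point of slope at most e;
      the added 1 keeps T positive when H = 0.\<close>
    define T where "T = H / e + 1"
    have T: "T > 0" using H that by (simp add: T_def add_nonneg_pos)
    obtain z where z: "x < z" "z < x + T" "h (x + T) - h x = (x + T - x) * h1 z"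
      using MVT2[of x "x + T" h h1] T h1 by auto
    have "T * h1 z \<le> H" using z(3) bd(1)[of x] bd(2)[of "x+T"] by simp
    also have "H \<le> T * e" using that by (simp add: T_def field_simps)
    finally have "h1 z \<le> e" using T by simp
    thus ?thesis using mono[of x z] z by linarith
  qed
  hence 1: "h1 x \<le> integral\<^sup>L lborel k" by (rule field_le_epsilon)
  have "- h1 x \<le> integral\<^sup>L lborel k + e" if "e > 0" for e
  proof -
    define T where "T = H / e + 1"
    have T: "T > 0" using H that by (simp add: T_def add_nonneg_pos)
    obtain z where z: "x - T < z" "z < x" "h x - h (x - T) = (x - (x - T)) * h1 z"
      using MVT2[of "x - T" x h h1] T h1 by auto
    have "T * - h1 z \<le> H" using z(3) bd(1)[of x] bd(2)[of "x-T"] by simp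
    also have "H \<le> T * e" using that by (simp add: T_def field_simps)
    finally have "- h1 z \<le> e" using T by (simp only: mult_le_cancel_left_pos)
    thus ?thesis using mono[of z x] z by linarith
  qed
  hence 2: "- h1 x \<le> integral\<^sup>L lborel k" by (rule field_le_epsilon)
  from 1 2 show ?thesis by linarith
qed

text \<open>Where \<open>Q \<le> C\<close>, the function \<open>u\<^sup>2\<close> is convex up to an integrable error.\<close>

lemma sup_bound_schroedinger:
  fixes u u1 u2 w Q :: "real \<Rightarrow> real"
  assumes u1: "\<And>x. (u has_real_derivative u1 x) (at x)"
    and u2: "\<And>x. (u1 has_real_derivative u2 x) (at x)"
    and eq: "\<And>x. u2 x / 2 + Q x * u x = w x" and Q: "\<And>x. Q x \<le> C" "C \<ge> 0"
    and bd: "\<And>x. \<bar>u x\<bar> \<le> H" and cw: "continuous_on UNIV w"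
    and int: "integrable lborel (\<lambda>x. (u x)\<^sup>2)" "integrable lborel (\<lambda>x. (w x)\<^sup>2)"
  shows "(u x)\<^sup>2 \<le> (4 * C + 3) * (\<integral>x. (u x)\<^sup>2 \<partial>lborel) + 2 * (\<integral>x. (w x)\<^sup>2 \<partial>lborel)"
proof -
  \<comment> \<open>The equation gives 2 u u'' = 4 u w - 4 Q u^2; with 2 u w \<ge> -u^2 - w^2 and Q
    \<le> C this yields (u^2)'' \<ge> -k.\<close>
  define k where "k = (\<lambda>x. (4 * C + 2) * (u x)\<^sup>2 + 2 * (w x)\<^sup>2)"
  define K where "K = integral\<^sup>L lborel k"
  have cu: "continuous_on UNIV u" by (intro continuous_at_imp_continuous_on ballI DERIV_isCont[OF u1])
  have ik: "integrable lborel k" unfolding k_def using int by auto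
  have K: "K = (4 * C + 2) * (\<integral>x. (u x)\<^sup>2 \<partial>lborel) + 2 * (\<integral>x. (w x)\<^sup>2 \<partial>lborel)"
    unfolding K_def k_def using int by simp
  have K0: "K \<ge> 0" unfolding K_def k_def using Q(2) by (intro Bochner_Integration.integral_nonneg) auto
  have der: "\<bar>2 * u y * u1 y\<bar> \<le> K" for y
    unfolding K_def
  proof (rule bounded_derivative_of_almost_convex[where h = "\<lambda>x. (u x)\<^sup>2" and ?h1.0 = "\<lambda>x. 2 * u x * u1 x" and ?h2.0 = "\<lambda>x. 2 * (u1 x)\<^sup>2 + 2 * u x * u2 x"])
    show "((\<lambda>x. (u x)\<^sup>2) has_real_derivative 2 * u x * u1 x) (at x)" for x
      using u1 by (auto intro!: derivative_eq_intros)
    show "((\<lambda>x. 2 * u x * u1 x) has_real_derivative 2 * (u1 x)\<^sup>2 + 2 * u x * u2 x) (at x)" for x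
      using u1 u2 by (auto intro!: derivative_eq_intros simp: power2_eq_square algebra_simps)
    show "(u x)\<^sup>2 \<le> H\<^sup>2" for x using power_mono[OF bd[of x], of 2] by simp
    show "- k x \<le> 2 * (u1 x)\<^sup>2 + 2 * u x * u2 x" for x
    proof -
      have "u2 x = 2 * (w x - Q x * u x)" using eq[of x] by simp
      hence "2 * u x * u2 x = 4 * (u x * w x) - 4 * (Q x * (u x)\<^sup>2)"
        by (simp only: right_diff_distrib power2_eq_square mult_ac)
      moreover have "Q x * (u x)\<^sup>2 \<le> C * (u x)\<^sup>2" using Q by (intro mult_right_mono) auto
      moreover have "0 \<le> (u x + w x)\<^sup>2" by simp
      hence "- (u x)\<^sup>2 - (w x)\<^sup>2 \<le> 2 * (u x * w x)" by (simp add: power2_sum algebra_simps)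
      moreover have "k x = 4 * (C * (u x)\<^sup>2) + 2 * (u x)\<^sup>2 + 2 * (w x)\<^sup>2" by (simp add: k_def algebra_simps)
      moreover have "0 \<le> (u1 x)\<^sup>2" by simp
      ultimately show ?thesis by linarith
    qed
    show "continuous_on UNIV k" unfolding k_def by (intro continuous_intros cu cw)
    show "0 \<le> k x" for x unfolding k_def using Q(2) by simp
  qed (use ik in auto)
  \<comment> \<open>The derivative of u^2 is at most K in modulus, so u^2 stays above its value at x
    minus K on a unit interval. Integrating over this interval turns a point value into an L^2 norm,
    and adds the last unit in 4 C + 3.\<close>
  have near: "(u x)\<^sup>2 - K \<le> (u s)\<^sup>2" if "s \<in> {x..x+1}" for s
  proof (cases "s = x")
    case False
    with that have "x < s" "s - x \<le> 1" by auto
    have "((\<lambda>x. (u x)\<^sup>2) has_real_derivative 2 * u y * u1 y) (at y)" for y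
      using u1 by (auto intro!: derivative_eq_intros)
    from MVT2[OF \<open>x < s\<close> this] obtain z where z: "(u s)\<^sup>2 - (u x)\<^sup>2 = (s - x) * (2 * u z * u1 z)"
      by blast
    have "\<bar>(s - x) * (2 * u z * u1 z)\<bar> \<le> 1 * K" unfolding abs_mult[of "s - x"]
      using der[of z] \<open>x < s\<close> \<open>s - x \<le> 1\<close> K0 by (intro mult_mono) auto
    thus ?thesis using z by linarith
  qed (use K0 in simp)
  have "(\<integral>s. indicator {x..x+1} s *\<^sub>R ((u x)\<^sup>2 - K) \<partial>lborel) \<le> (\<integral>s. (u s)\<^sup>2 \<partial>lborel)"
  proof (rule integral_mono)
    show "integrable lborel (\<lambda>s. indicator {x..x+1} s *\<^sub>R ((u x)\<^sup>2 - K))" by simp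
    show "indicator {x..x+1} s *\<^sub>R ((u x)\<^sup>2 - K) \<le> (u s)\<^sup>2" for s
      using near[of s] by (simp add: indicator_def)
  qed (rule int(1))
  hence "(u x)\<^sup>2 - K \<le> (\<integral>s. (u s)\<^sup>2 \<partial>lborel)" by simp
  thus ?thesis unfolding K by (simp add: algebra_simps)
qed

lemma continuous_AE_zero:
  fixes d :: "real \<Rightarrow> real"
  assumes "continuous_on UNIV d" "AE x in lborel. d x = 0"
  shows "d x = 0"
proof (rule ccontr)
  assume "d x \<noteq> 0"
  have o: "open {x. d x \<noteq> 0}"
    using open_Collect_neq[OF assms(1), of "\<lambda>_. 0"] by simp
  have "{x. d x \<noteq> 0} \<in> null_sets lborel"
    using AE_iff_null[of lborel "\<lambda>x. d x = 0"] assms(2) o by simp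
  hence "negligible {x. d x \<noteq> 0}" by (simp add: negligible_iff_null_sets null_sets_completionI)
  with open_not_negligible[OF o] \<open>d x \<noteq> 0\<close> show False by auto
qed

lemma diff_square_le: "(x - y)\<^sup>2 \<le> 2 * x\<^sup>2 + 2 * y\<^sup>2" for x y :: real
proof -
  have "0 \<le> (x + y)\<^sup>2" by simp
  thus ?thesis by (simp add: power2_sum power2_diff)
qed

lemma integrable_zero_outside_interval:
  fixes f :: "real \<Rightarrow> real"
  assumes "continuous_on UNIV f" "\<And>x. \<bar>x\<bar> \<ge> R \<Longrightarrow> f x = 0"
  shows "integrable lborel f"
proof -
  have "integrable lborel (\<lambda>x. indicator {-R..R} x *\<^sub>R f x)"
    using borel_integrable_atLeastAtMost'[OF continuous_on_subset[OF assms(1)], of "-R" R]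
    by (simp add: set_integrable_def)
  moreover have "f x = 0" if "x \<notin> {-R..R}" for x by (rule assms(2)) (use that in auto)
  hence "(\<lambda>x. indicator {-R..R} x *\<^sub>R f x) = f" by (auto simp: indicator_def fun_eq_iff)
  ultimately show ?thesis by simp
qed

section \<open>Expansions in an orthonormal eigenbasis\<close>

locale schroedinger_eigenbasis =
  fixes Q :: "real \<Rightarrow> real" and C :: real and lam :: "nat \<Rightarrow> real" and \<Psi> \<Psi>1 \<Psi>2 :: "nat \<Rightarrow> real \<Rightarrow> real"
  assumes d1: "\<And>k x. (\<Psi> k has_real_derivative \<Psi>1 k x) (at x)"
    and d2: "\<And>k x. (\<Psi>1 k has_real_derivative \<Psi>2 k x) (at x)"
    and eigen: "\<And>k x. \<Psi>2 k x / 2 + Q x * \<Psi> k x = - lam k * \<Psi> k x"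
    and Q_cont: "continuous_on UNIV Q" and Q_le: "\<And>x. Q x \<le> C" and C_nonneg: "C \<ge> 0"
    and ortho: "\<And>j k. (\<integral>x. \<Psi> j x * \<Psi> k x \<partial>lborel) = (if j = k then 1 else 0)"
    and complete: "\<And>f. square_integrable f \<Longrightarrow> (\<And>k. (\<integral>x. f x * \<Psi> k x \<partial>lborel) = 0) \<Longrightarrow> AE x in lborel. f x = 0"
    and decay: "\<And>k. \<exists>D. \<forall>x. \<bar>\<Psi> k x\<bar> \<le> D * exp (- \<bar>x\<bar>)"
begin

lemma \<Psi>_continuous: "continuous_on A (\<Psi> k)"
  by (intro continuous_at_imp_continuous_on ballI DERIV_isCont[OF d1])

lemma \<Psi>_measurable[measurable]: "\<Psi> k \<in> borel_measurable borel"
  by (rule borel_measurable_continuous_onI[OF \<Psi>_continuous])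

lemma \<Psi>_integrable: "integrable lborel (\<Psi> k)"
proof -
  obtain D where D: "\<And>x. \<bar>\<Psi> k x\<bar> \<le> D * exp (- \<bar>x\<bar>)" using decay by blast
  have "integrable lborel (\<lambda>x. D * exp (- \<bar>x\<bar>))" by (intro integrable_mult_right integrable_exp_neg_abs)
  thus ?thesis by (rule Bochner_Integration.integrable_bound) (auto intro!: AE_I2 order_trans[OF D abs_ge_self])
qed

lemma \<Psi>_bounded: "\<exists>D. \<forall>x. \<bar>\<Psi> k x\<bar> \<le> D"
proof -
  obtain D where D: "\<And>x. \<bar>\<Psi> k x\<bar> \<le> D * exp (- \<bar>x\<bar>)" using decay by blast
  have "D \<ge> 0" using D[of 0] by simp
  hence "D * exp (- \<bar>x\<bar>) \<le> D" for x by (intro mult_left_le) auto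
  with D show ?thesis by (meson order_trans)
qed

lemma mult_\<Psi>_integrable:
  fixes f :: "real \<Rightarrow> real"
  assumes "integrable lborel f"
  shows "integrable lborel (\<lambda>x. f x * \<Psi> k x)"
proof -
  obtain D where D: "\<And>x. \<bar>\<Psi> k x\<bar> \<le> D" using \<Psi>_bounded by blast
  have [measurable]: "f \<in> borel_measurable borel" using assms by simp
  have D0: "D \<ge> 0" using D[of 0] by linarith
  have "integrable lborel (\<lambda>x. D * f x)" using assms by simp
  thus ?thesis
  proof (rule Bochner_Integration.integrable_bound)
    show "AE x in lborel. norm (f x * \<Psi> k x) \<le> norm (D * f x)"
      using D D0 by (auto simp: abs_mult mult.commute[of D] intro!: mult_left_mono AE_I2)
  qed simp
qed

lemma \<Psi>_mult_integrable: "integrable lborel (\<lambda>x. \<Psi> j x * \<Psi> k x)"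
  by (rule mult_\<Psi>_integrable[OF \<Psi>_integrable])

definition lincomb :: "(nat \<Rightarrow> real) \<Rightarrow> nat set \<Rightarrow> real \<Rightarrow> real" where
  "lincomb c I x = (\<Sum>k\<in>I. c k * \<Psi> k x)"

lemma lincomb_continuous: "continuous_on A (lincomb c I)"
  unfolding lincomb_def by (intro continuous_intros \<Psi>_continuous)

lemma lincomb_square:
  assumes "finite I"
  shows "has_bochner_integral lborel (\<lambda>x. (lincomb c I x)\<^sup>2) (\<Sum>k\<in>I. (c k)\<^sup>2)"
proof -
  have "has_bochner_integral lborel (\<lambda>x. \<Sum>j\<in>I. \<Sum>k\<in>I. (c j * c k) * (\<Psi> j x * \<Psi> k x)) 
     (\<Sum>j\<in>I. \<Sum>k\<in>I. (c j * c k) * (if j = k then 1 else 0))"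
    by (intro has_bochner_integral_sum has_bochner_integral_mult_right)
       (simp only: has_bochner_integral_iff ortho \<Psi>_mult_integrable simp_thms)
  moreover have "(\<lambda>x. \<Sum>j\<in>I. \<Sum>k\<in>I. (c j * c k) * (\<Psi> j x * \<Psi> k x)) = (\<lambda>x. (lincomb c I x)\<^sup>2)"
    by (simp add: lincomb_def power2_eq_square sum_product mult_ac)
  moreover have "(\<Sum>j\<in>I. \<Sum>k\<in>I. (c j * c k) * (if j = k then 1 else 0)) = (\<Sum>k\<in>I. (c k)\<^sup>2)"
    using assms by (simp add: power2_eq_square if_distrib cong: if_cong)
  ultimately show ?thesis by (simp only:)
qed

lemma lincomb_mult_\<Psi>:
  assumes "finite I"
  shows "has_bochner_integral lborel (\<lambda>x. lincomb c I x * \<Psi> j x) (if j \<in> I then c j else 0)"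
proof -
  have "has_bochner_integral lborel (\<lambda>x. \<Sum>k\<in>I. c k * (\<Psi> k x * \<Psi> j x)) (\<Sum>k\<in>I. c k * (if k = j then 1 else 0))"
    by (intro has_bochner_integral_sum has_bochner_integral_mult_right)
       (simp only: has_bochner_integral_iff ortho \<Psi>_mult_integrable simp_thms)
  moreover have "(\<lambda>x. \<Sum>k\<in>I. c k * (\<Psi> k x * \<Psi> j x)) = (\<lambda>x. lincomb c I x * \<Psi> j x)"
    by (simp add: lincomb_def sum_distrib_right sum_distrib_left mult_ac)
  moreover have "(\<Sum>k\<in>I. c k * (if k = j then 1 else 0)) = (if j \<in> I then c j else 0)"
    using assms by (simp add: if_distrib cong: if_cong)
  ultimately show ?thesis by (simp only:)
qed

text \<open>The operator multiplies the k-th coefficient by -\<open>lam k\<close>, so the L^2 norms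
  in the sup bound become sums of squares. Tails of an expansion are thus small uniformly in x as
  soon as two numerical series converge.\<close>

lemma lincomb_sup_bound:
  assumes I: "finite I"
  shows "(lincomb c I x)\<^sup>2 \<le> (4 * C + 3) * (\<Sum>k\<in>I. (c k)\<^sup>2) + 2 * (\<Sum>k\<in>I. (lam k * c k)\<^sup>2)"
proof -
  define w where "w = lincomb (\<lambda>k. - lam k * c k) I"
  obtain D where D: "\<And>k x. \<bar>\<Psi> k x\<bar> \<le> D k" using \<Psi>_bounded by metis
  have "(lincomb c I x)\<^sup>2 \<le> (4 * C + 3) * (\<integral>x. (lincomb c I x)\<^sup>2 \<partial>lborel) + 2 * (\<integral>x. (w x)\<^sup>2 \<partial>lborel)"
  proof (rule sup_bound_schroedinger[where ?u1.0 = "\<lambda>x. \<Sum>k\<in>I. c k * \<Psi>1 k x" and ?u2.0 = "\<lambda>x. \<Sum>k\<in>I. c k * \<Psi>2 k x" and Q = Q])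
    show "(lincomb c I has_real_derivative (\<Sum>k\<in>I. c k * \<Psi>1 k x)) (at x)" for x
      unfolding lincomb_def[abs_def] by (intro derivative_intros DERIV_cmult d1)
    show "((\<lambda>x. \<Sum>k\<in>I. c k * \<Psi>1 k x) has_real_derivative (\<Sum>k\<in>I. c k * \<Psi>2 k x)) (at x)" for x
      by (intro derivative_intros DERIV_cmult d2)
    show "(\<Sum>k\<in>I. c k * \<Psi>2 k x) / 2 + Q x * lincomb c I x = w x" for x
    proof -
      have "(\<Sum>k\<in>I. c k * \<Psi>2 k x) / 2 + Q x * lincomb c I x = (\<Sum>k\<in>I. c k * (\<Psi>2 k x / 2 + Q x * \<Psi> k x))"
        by (simp add: lincomb_def sum_divide_distrib sum_distrib_left sum.distrib[symmetric] algebra_simps)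
      also have "\<dots> = w x" unfolding eigen by (simp add: w_def lincomb_def mult_ac)
      finally show ?thesis .
    qed
    show "\<bar>lincomb c I x\<bar> \<le> (\<Sum>k\<in>I. \<bar>c k\<bar> * D k)" for x
      unfolding lincomb_def by (intro order_trans[OF sum_abs] sum_mono) (simp add: abs_mult D mult_left_mono)
    show "continuous_on UNIV w" unfolding w_def by (rule lincomb_continuous)
    show "integrable lborel (\<lambda>x. (lincomb c I x)\<^sup>2)" "integrable lborel (\<lambda>x. (w x)\<^sup>2)"
      unfolding w_def using lincomb_square[OF I] by (auto simp: has_bochner_integral_iff)
  qed (use Q_le C_nonneg in auto)
  also have "(\<integral>x. (lincomb c I x)\<^sup>2 \<partial>lborel) = (\<Sum>k\<in>I. (c k)\<^sup>2)"
    by (rule has_bochner_integral_integral_eq[OF lincomb_square[OF I]])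
  also have "(\<integral>x. (w x)\<^sup>2 \<partial>lborel) = (\<Sum>k\<in>I. (lam k * c k)\<^sup>2)"
    unfolding w_def using has_bochner_integral_integral_eq[OF lincomb_square[OF I, of "\<lambda>k. - lam k * c k"]] by simp
  finally show ?thesis .
qed

lemma bessel:
  assumes I: "finite I" and f: "f \<in> borel_measurable borel" "integrable lborel f" "integrable lborel (\<lambda>x. (f x)\<^sup>2)"
  shows "(\<Sum>k\<in>I. (\<integral>x. f x * \<Psi> k x \<partial>lborel)\<^sup>2) \<le> (\<integral>x. (f x)\<^sup>2 \<partial>lborel)"
proof -
  define c where "c = (\<lambda>k. \<integral>x. f x * \<Psi> k x \<partial>lborel)"
  have 1: "has_bochner_integral lborel (\<lambda>x. f x * \<Psi> k x) (c k)" for k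
    unfolding c_def by (rule has_bochner_integral_integrable[OF mult_\<Psi>_integrable[OF f(2)]])
  have "has_bochner_integral lborel (\<lambda>x. \<Sum>k\<in>I. c k * (f x * \<Psi> k x)) (\<Sum>k\<in>I. c k * c k)"
    by (intro has_bochner_integral_sum has_bochner_integral_mult_right 1)
  moreover have "(\<lambda>x. \<Sum>k\<in>I. c k * (f x * \<Psi> k x)) = (\<lambda>x. f x * lincomb c I x)"
    by (simp add: lincomb_def sum_distrib_left mult_ac)
  ultimately have 2: "has_bochner_integral lborel (\<lambda>x. f x * lincomb c I x) (\<Sum>k\<in>I. (c k)\<^sup>2)"
    by (simp add: power2_eq_square)
  have "has_bochner_integral lborel (\<lambda>x. (f x)\<^sup>2 - 2 * (f x * lincomb c I x) + (lincomb c I x)\<^sup>2)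
     ((\<integral>x. (f x)\<^sup>2 \<partial>lborel) - 2 * (\<Sum>k\<in>I. (c k)\<^sup>2) + (\<Sum>k\<in>I. (c k)\<^sup>2))"
    by (intro has_bochner_integral_add has_bochner_integral_diff has_bochner_integral_mult_right 2 
       lincomb_square I has_bochner_integral_integrable f)
  hence "(\<integral>x. (f x)\<^sup>2 - 2 * (f x * lincomb c I x) + (lincomb c I x)\<^sup>2 \<partial>lborel) = 
      (\<integral>x. (f x)\<^sup>2 \<partial>lborel) - (\<Sum>k\<in>I. (c k)\<^sup>2)" by (simp add: has_bochner_integral_iff)
  moreover have "(\<integral>x. (f x)\<^sup>2 - 2 * (f x * lincomb c I x) + (lincomb c I x)\<^sup>2 \<partial>lborel) = (\<integral>x. (f x - lincomb c I x)\<^sup>2 \<partial>lborel)"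
    by (simp add: power2_diff algebra_simps)
  moreover have "0 \<le> (\<integral>x. (f x - lincomb c I x)\<^sup>2 \<partial>lborel)" by simp
  ultimately show ?thesis unfolding c_def by linarith
qed

text \<open>Symmetry of the operator: the difference of the two second-order terms is the derivative
  of the Wronskian f' \<Psi> - f \<Psi>', which vanishes off the support of f. The operator
  therefore multiplies the k-th coefficient by -\<open>lam k\<close> also for functions outside the
  span of the basis.\<close>

lemma green_identity:
  fixes f f1 f2 :: "real \<Rightarrow> real"
  assumes f1: "\<And>x. (f has_real_derivative f1 x) (at x)"
    and f2: "\<And>x. (f1 has_real_derivative f2 x) (at x)"
    and c2: "continuous_on UNIV f2" and supp: "\<And>x. \<bar>x\<bar> \<ge> R \<Longrightarrow> f x = 0"
  shows "(\<integral>x. (f2 x / 2 + Q x * f x) * \<Psi> k x \<partial>lborel) = - lam k * (\<integral>x. f x * \<Psi> k x \<partial>lborel)"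
    and "\<And>x. \<bar>x\<bar> \<ge> R + 1 \<Longrightarrow> f2 x = 0"
proof -
  have f1z: "f1 x = 0" if "\<bar>x\<bar> > R" for x
  proof -
    have "((\<lambda>_. 0) has_real_derivative f1 x) (at x)"
    proof (rule has_field_derivative_transform_within_open[OF f1])
      show "open {x. \<bar>x\<bar> > R}" by (intro open_Collect_less continuous_intros)
    qed (use that supp in auto)
    from DERIV_unique[OF this DERIV_const] show ?thesis by simp
  qed
  have f2z: "f2 x = 0" if "\<bar>x\<bar> > R" for x
  proof -
    have "((\<lambda>_. 0) has_real_derivative f2 x) (at x)"
    proof (rule has_field_derivative_transform_within_open[OF f2])
      show "open {x. \<bar>x\<bar> > R}" by (intro open_Collect_less continuous_intros)
    qed (use that f1z in auto)
    from DERIV_unique[OF this DERIV_const] show ?thesis by simp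
  qed
  thus f2z': "f2 x = 0" if "\<bar>x\<bar> \<ge> R + 1" for x using that by force
  have cf: "continuous_on UNIV f" by (intro continuous_at_imp_continuous_on ballI DERIV_isCont[OF f1])
  \<comment> \<open>The derivatives are shown to vanish for |x| > R only, a strict inequality, and R
    may be negative; this choice deals with both.\<close>
  define S where "S = \<bar>R\<bar> + 1"
  define g where "g = (\<lambda>x. f2 x * \<Psi> k x - f x * \<Psi>2 k x)"
  have \<Psi>2: "\<Psi>2 k x = 2 * (- lam k * \<Psi> k x - Q x * \<Psi> k x)" for x using eigen[of k x] by simp
  have cg: "continuous_on UNIV g" unfolding g_def \<Psi>2 by (intro continuous_intros c2 cf \<Psi>_continuous Q_cont)
  have gz: "g x = 0" if "\<bar>x\<bar> \<ge> S" for x using that supp[of x] f2z[of x] by (simp add: g_def S_def)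
  have "(\<integral>x. g x * indicator {-S..S} x \<partial>lborel) = (f1 S * \<Psi> k S - f S * \<Psi>1 k S) - (f1 (- S) * \<Psi> k (- S) - f (- S) * \<Psi>1 k (- S))"
  proof (rule integral_FTC_Icc_real[where F = "\<lambda>x. f1 x * \<Psi> k x - f x * \<Psi>1 k x"])
    show "((\<lambda>x. f1 x * \<Psi> k x - f x * \<Psi>1 k x) has_real_derivative g x) (at x)" for x
      unfolding g_def using f1 f2 d1 d2 by (auto intro!: derivative_eq_intros simp: algebra_simps)
    show "isCont g x" for x using cg by (simp add: continuous_on_eq_continuous_at)
  qed (simp add: S_def)
  also have "\<dots> = 0" using f1z[of S] f1z[of "-S"] supp[of S] supp[of "-S"] by (simp add: S_def)
  also have "(\<lambda>x. g x * indicator {-S..S} x) = g"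
  proof
    fix x
    have "g x = 0" if "x \<notin> {-S..S}" by (rule gz) (use that in auto)
    thus "g x * indicator {-S..S} x = g x" by (auto simp: indicator_def)
  qed
  finally have g0: "integral\<^sup>L lborel g = 0" .
  have ig: "integrable lborel g" using integrable_zero_outside_interval[OF cg gz] .
  have ifi: "integrable lborel (\<lambda>x. f x * \<Psi> k x)"
    by (intro mult_\<Psi>_integrable integrable_zero_outside_interval[OF cf supp])
  have "(f2 x / 2 + Q x * f x) * \<Psi> k x = g x / 2 + (- lam k) * (f x * \<Psi> k x)" for x
    unfolding g_def \<Psi>2 by (simp add: field_simps)
  hence "(\<integral>x. (f2 x / 2 + Q x * f x) * \<Psi> k x \<partial>lborel) = (\<integral>x. g x / 2 + (- lam k) * (f x * \<Psi> k x) \<partial>lborel)" by simp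
  also have "\<dots> = integral\<^sup>L lborel g / 2 + (- lam k) * (\<integral>x. f x * \<Psi> k x \<partial>lborel)"
    using ig ifi by simp
  finally show "(\<integral>x. (f2 x / 2 + Q x * f x) * \<Psi> k x \<partial>lborel) = - lam k * (\<integral>x. f x * \<Psi> k x \<partial>lborel)"
    by (simp add: g0)
qed

end

context schroedinger_eigenbasis
begin

text \<open>Bessel's inequality for f and for its image w bounds the sums of c_k^2 and of (lam_k
  c_k)^2, so by the sup bound the partial sums are uniformly Cauchy. Their continuous limit has the
  same coefficients as f; completeness identifies the two almost everywhere, continuity
  everywhere.\<close>

theorem eigen_expansion_uniform:
  fixes f f1 f2 :: "real \<Rightarrow> real"
  assumes f1: "\<And>x. (f has_real_derivative f1 x) (at x)"
    and f2: "\<And>x. (f1 has_real_derivative f2 x) (at x)"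
    and c2: "continuous_on UNIV f2" and supp: "\<And>x. \<bar>x\<bar> \<ge> R \<Longrightarrow> f x = 0" and e: "\<epsilon> > 0"
  shows "\<exists>N. \<forall>n\<ge>N. \<forall>x. \<bar>f x - lincomb (\<lambda>k. \<integral>y. f y * \<Psi> k y \<partial>lborel) {..<n} x\<bar> \<le> \<epsilon>"
proof -
  define c where "c = (\<lambda>k. \<integral>y. f y * \<Psi> k y \<partial>lborel)"
  define S where "S = (\<lambda>n. lincomb c {..<n})"
  define w where "w = (\<lambda>x. f2 x / 2 + Q x * f x)"
  have cf: "continuous_on UNIV f" by (intro continuous_at_imp_continuous_on ballI DERIV_isCont[OF f1])
  have fm[measurable]: "f \<in> borel_measurable borel" by (rule borel_measurable_continuous_onI[OF cf])
  have fi: "integrable lborel f" by (rule integrable_zero_outside_interval[OF cf supp])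
  have fi2: "integrable lborel (\<lambda>x. (f x)\<^sup>2)"
    by (rule integrable_zero_outside_interval[of _ R]) (auto intro!: continuous_intros cf simp: supp)
  have wc: "continuous_on UNIV w" unfolding w_def by (intro continuous_intros c2 cf Q_cont) simp
  have wz: "w x = 0" if "\<bar>x\<bar> \<ge> R + 1" for x
    using green_identity(2)[OF f1 f2 c2 supp that] supp[of x] that by (simp add: w_def)
  have wm: "w \<in> borel_measurable borel" by (rule borel_measurable_continuous_onI[OF wc])
  have wi: "integrable lborel w" by (rule integrable_zero_outside_interval[OF wc wz])
  have wi2: "integrable lborel (\<lambda>x. (w x)\<^sup>2)"
    by (rule integrable_zero_outside_interval[of _ "R + 1"]) (auto intro!: continuous_intros wc simp: wz)
  have wk: "(\<integral>x. w x * \<Psi> k x \<partial>lborel) = - lam k * c k" for k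
    unfolding w_def c_def by (rule green_identity(1)[OF f1 f2 c2 supp])
  have "summable (\<lambda>k. (c k)\<^sup>2)"
    by (rule summableI_nonneg_bounded[where x = "\<integral>x. (f x)\<^sup>2 \<partial>lborel"]) (auto simp: c_def intro!: bessel fi fi2)
  moreover have "summable (\<lambda>k. (lam k * c k)\<^sup>2)"
    using bessel[OF _ wm wi wi2] unfolding wk
    by (intro summableI_nonneg_bounded[where x = "\<integral>x. (w x)\<^sup>2 \<partial>lborel"]) auto
  ultimately have sm: "summable (\<lambda>k. (4 * C + 3) * (c k)\<^sup>2 + 2 * (lam k * c k)\<^sup>2)"
    by (intro summable_add summable_mult)
  have uc: "uniformly_Cauchy_on UNIV S"
  proof (rule uniformly_Cauchy_onI')
    fix e :: real assume e: "e > 0"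
    hence "e\<^sup>2 > 0" by simp
    then obtain N where N: "\<And>m n. m \<ge> N \<Longrightarrow> norm (\<Sum>k=m..<n. (4 * C + 3) * (c k)\<^sup>2 + 2 * (lam k * c k)\<^sup>2) < e\<^sup>2"
      using sm unfolding summable_Cauchy by blast
    have "dist (S m x) (S n x) < e" if m: "m \<ge> N" and n: "n > m" for m n x
    proof -
      have "S n x - S m x = lincomb c {m..<n} x"
        using n sum.atLeastLessThan_concat[of 0 m n "\<lambda>k. c k * \<Psi> k x"] by (simp add: S_def lincomb_def atLeast0LessThan)
      moreover have "(lincomb c {m..<n} x)\<^sup>2 < e\<^sup>2"
        using lincomb_sup_bound[of "{m..<n}" c x] N[OF m, of n] by (simp add: sum.distrib sum_distrib_left)
      hence "\<bar>lincomb c {m..<n} x\<bar> < e" using e by (metis abs_of_pos power2_less_imp_less power2_abs less_imp_le)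
      ultimately show ?thesis by (simp add: dist_real_def abs_minus_commute)
    qed
    thus "\<exists>M. \<forall>x\<in>UNIV. \<forall>m\<ge>M. \<forall>n>m. dist (S m x) (S n x) < e" by blast
  qed
  hence "uniformly_convergent_on UNIV S" by (rule Cauchy_uniformly_convergent)
  then obtain g where g: "uniform_limit UNIV S g sequentially" by (auto simp: uniformly_convergent_on_def)
  have gc: "continuous_on UNIV g"
    by (rule uniform_limit_theorem[OF _ g]) (auto simp: S_def lincomb_continuous)
  have gm[measurable]: "g \<in> borel_measurable borel" by (rule borel_measurable_continuous_onI[OF gc])
  have Sm[measurable]: "S n \<in> borel_measurable borel" for n
    unfolding S_def by (rule borel_measurable_continuous_onI[OF lincomb_continuous])
  have Slim: "(\<lambda>n. S n x) \<longlonglongrightarrow> g x" for x using tendsto_uniform_limitI[OF g] by simp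
  \<comment> \<open>Completeness speaks of square integrable functions. The limit is one by Fatou's
    lemma and the Bessel bound on the partial sums.\<close>
  have gi2: "integrable lborel (\<lambda>x. (g x)\<^sup>2)"
  proof (rule integrableI_nonneg)
    have "(\<integral>\<^sup>+x. ennreal ((g x)\<^sup>2) \<partial>lborel) = (\<integral>\<^sup>+x. liminf (\<lambda>n. ennreal ((S n x)\<^sup>2)) \<partial>lborel)"
      by (intro nn_integral_cong lim_imp_Liminf[symmetric] tendsto_ennrealI tendsto_power Slim) simp
    also have "\<dots> \<le> liminf (\<lambda>n. \<integral>\<^sup>+x. ennreal ((S n x)\<^sup>2) \<partial>lborel)"
      by (rule nn_integral_liminf) simp
    also have "\<dots> \<le> liminf (\<lambda>n::nat. ennreal (\<integral>x. (f x)\<^sup>2 \<partial>lborel))"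
    proof (intro Liminf_mono always_eventually allI)
      fix n
      have "has_bochner_integral lborel (\<lambda>x. (S n x)\<^sup>2) (\<Sum>k<n. (c k)\<^sup>2)"
        unfolding S_def by (rule lincomb_square) simp
      hence "(\<integral>\<^sup>+x. ennreal ((S n x)\<^sup>2) \<partial>lborel) = ennreal (\<Sum>k<n. (c k)\<^sup>2)"
        by (simp add: has_bochner_integral_iff nn_integral_eq_integral)
      also have "\<dots> \<le> ennreal (\<integral>x. (f x)\<^sup>2 \<partial>lborel)"
        unfolding c_def by (intro ennreal_leI bessel fi fi2) auto
      finally show "(\<integral>\<^sup>+x. ennreal ((S n x)\<^sup>2) \<partial>lborel) \<le> ennreal (\<integral>x. (f x)\<^sup>2 \<partial>lborel)" .
    qed
    also have "\<dots> < \<infinity>" by (simp add: Liminf_const)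
    finally show "(\<integral>\<^sup>+x. ennreal ((g x)\<^sup>2) \<partial>lborel) < \<infinity>" .
  qed auto
  have gk: "(\<integral>x. g x * \<Psi> k x \<partial>lborel) = c k" and gki: "integrable lborel (\<lambda>x. g x * \<Psi> k x)" for k
  proof -
    obtain N where N: "\<And>n x. n \<ge> N \<Longrightarrow> \<bar>S n x - g x\<bar> < 1"
      using uniform_limitD[OF g, of 1] by (auto simp: eventually_sequentially dist_real_def)
    obtain D where D: "\<And>k x. \<bar>\<Psi> k x\<bar> \<le> D k" using \<Psi>_bounded by metis
    \<comment> \<open>From index N on, a partial sum differs from g by less than 1 and so from the
      N-th one by less than 2; K dominates them all.\<close>
    define K where "K = 2 + (\<Sum>k<N. \<bar>c k\<bar> * D k)"
    have Sb: "\<bar>S n x\<bar> \<le> K" if "n \<ge> N" for n x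
    proof -
      have "\<bar>S N x\<bar> \<le> (\<Sum>k<N. \<bar>c k\<bar> * D k)"
        unfolding S_def lincomb_def by (intro order_trans[OF sum_abs] sum_mono) (simp add: abs_mult D mult_left_mono)
      thus ?thesis using N[of N x] N[OF that, of x] by (simp add: K_def)
    qed
    have dom: "integrable lborel (\<lambda>x. K * \<bar>\<Psi> k x\<bar>)" using \<Psi>_integrable by (intro integrable_mult_right integrable_abs)
    have lim: "AE x in lborel. (\<lambda>n. S (n + N) x * \<Psi> k x) \<longlonglongrightarrow> g x * \<Psi> k x"
      by (intro AE_I2 tendsto_mult tendsto_const LIMSEQ_ignore_initial_segment Slim)
    have bnd: "AE x in lborel. norm (S (n + N) x * \<Psi> k x) \<le> K * \<bar>\<Psi> k x\<bar>" for n
      using Sb[of "n + N"] by (intro AE_I2) (simp add: abs_mult mult_right_mono)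
    show "integrable lborel (\<lambda>x. g x * \<Psi> k x)" by (rule integrable_dominated_convergence[OF _ _ dom lim bnd]) auto
    have 1: "(\<lambda>n. \<integral>x. S (n + N) x * \<Psi> k x \<partial>lborel) \<longlonglongrightarrow> (\<integral>x. g x * \<Psi> k x \<partial>lborel)" by (rule integral_dominated_convergence[OF _ _ dom lim bnd]) auto
    have "eventually (\<lambda>n. (\<integral>x. S (n + N) x * \<Psi> k x \<partial>lborel) = c k) sequentially"
      using eventually_gt_at_top[of k]
    proof eventually_elim
      case (elim n)
      show ?case unfolding S_def
        using has_bochner_integral_integral_eq[OF lincomb_mult_\<Psi>[of "{..<n+N}" c k]] elim by simp
    qed
    hence "(\<lambda>n. \<integral>x. S (n + N) x * \<Psi> k x \<partial>lborel) \<longlonglongrightarrow> c k" by (rule tendsto_eventually)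
    with 1 show "(\<integral>x. g x * \<Psi> k x \<partial>lborel) = c k" by (rule LIMSEQ_unique)
  qed
  have "AE x in lborel. f x - g x = 0"
  proof (rule complete)
    have "integrable lborel (\<lambda>x. (f x - g x)\<^sup>2)"
    proof (rule Bochner_Integration.integrable_bound[of _ "\<lambda>x. 2 * (f x)\<^sup>2 + 2 * (g x)\<^sup>2"])
      show "integrable lborel (\<lambda>x. 2 * (f x)\<^sup>2 + 2 * (g x)\<^sup>2)" using fi2 gi2 by simp
    qed (auto intro!: AE_I2 diff_square_le)
    thus "square_integrable (\<lambda>x. f x - g x)" by (simp add: square_integrable_def)
    show "(\<integral>x. (f x - g x) * \<Psi> k x \<partial>lborel) = 0" for k
      using gk[of k] gki[of k] mult_\<Psi>_integrable[OF fi, of k] by (simp add: left_diff_distrib c_def)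
  qed
  hence fg: "f x = g x" for x
    using continuous_AE_zero[of "\<lambda>x. f x - g x" x] by (auto intro!: continuous_intros cf gc)
  from uniform_limitD[OF g e] obtain N where "\<And>n x. n \<ge> N \<Longrightarrow> \<bar>S n x - g x\<bar> < \<epsilon>"
    by (auto simp: eventually_sequentially dist_real_def)
  thus ?thesis unfolding S_def c_def fg by (metis abs_minus_commute less_imp_le)
qed

end


section \<open>The ground state transform\<close>

text \<open>Membership in \<open>L_tilde\<close> gives the equation almost everywhere and the first
  derivative as an integral. The remaining terms are continuous, so the integrand may be replaced by
  the continuous function q, and the fundamental theorem of calculus makes the equation hold at
  every point.\<close>

lemma eigenfunction_second_derivative:
  assumes u: "(u, w) \<in> L_tilde a V" and C1: "deriv u C1_differentiable_on UNIV"
    and V: "continuous_on UNIV (V_tilde a V)" and cu: "continuous_on UNIV u" and cw: "continuous_on UNIV w"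
  shows "deriv (deriv u) x / 2 + V_tilde a V x * u x = w x"
proof -
  define q where "q = (\<lambda>x. 2 * (w x - V_tilde a V x * u x))"
  have cq: "continuous_on UNIV q" unfolding q_def by (intro continuous_intros V cu cw)
  have qm[measurable]: "q \<in> borel_measurable borel" by (rule borel_measurable_continuous_onI[OF cq])
  obtain d2u where d: "\<And>x. interval_lebesgue_integrable lborel 0 (ereal x) d2u"
    "\<And>x. deriv u x = deriv u 0 + (LBINT z=0..ereal x. d2u z)"
    "AE x in lborel. w x = d2u x / 2 + V_tilde a V x * u x"
    using u unfolding L_tilde_def by blast
  have eqAE: "AE x in lborel. d2u x = q x" using d(3) by eventually_elim (simp add: q_def)
  have int_eq: "(LBINT z=0..ereal x. d2u z) = (LBINT z=0..ereal x. q z)" for x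
  proof -
    have meas: "(\<lambda>z. indicator A z *\<^sub>R q z) \<in> borel_measurable lborel" if "A \<in> sets borel" for A using that by simp
    have "set_lebesgue_integral lborel A d2u = set_lebesgue_integral lborel A q"
      if "set_integrable lborel A d2u" "A \<in> sets borel" for A
      unfolding set_lebesgue_integral_def
    proof (rule integral_cong_AE)
      show "(\<lambda>z. indicator A z *\<^sub>R d2u z) \<in> borel_measurable lborel"
        using that(1) unfolding set_integrable_def by (rule borel_measurable_integrable)
      show "AE z in lborel. indicator A z *\<^sub>R d2u z = indicator A z *\<^sub>R q z" using eqAE by eventually_elim simp
    qed (rule meas[OF that(2)])
    thus ?thesis using d(1)[of x]
      unfolding interval_lebesgue_integral_def interval_lebesgue_integrable_def by (auto split: if_splits)
  qed
  have der: "(deriv u has_real_derivative q x) (at x)" for x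
  proof -
    define K where "K = \<bar>x\<bar> + 1"
    have "((\<lambda>v. LBINT y=(0::real)..v. q y) has_vector_derivative q x) (at x within {-K..K})"
      by (rule interval_integral_FTC2) (auto simp: K_def intro: continuous_on_subset[OF cq])
    hence "((\<lambda>v. LBINT y=(0::real)..v. q y) has_real_derivative q x) (at x within {-K..K})"
      by (simp add: has_real_derivative_iff_has_vector_derivative)
    hence "((\<lambda>v. LBINT y=(0::real)..v. q y) has_real_derivative q x) (at x)"
      by (subst (asm) at_within_interior) (auto simp: K_def interior_atLeastAtMost_real)
    hence "((\<lambda>v. deriv u 0 + (LBINT y=(0::real)..v. q y)) has_real_derivative q x) (at x)"
      by (auto intro!: derivative_eq_intros)
    moreover have "(\<lambda>v. deriv u 0 + (LBINT y=(0::real)..v. q y)) = deriv u"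
    proof
      fix v show "deriv u 0 + (LBINT y=(0::real)..v. q y) = deriv u v"
        unfolding d(2)[of v] int_eq by (simp add: zero_ereal_def)
    qed
    ultimately show ?thesis by simp
  qed
  from DERIV_imp_deriv[OF der] have "deriv (deriv u) x = q x" .
  thus ?thesis by (simp add: q_def field_simps)
qed

lemma C1_differentiable_deriv:
  fixes f :: "real \<Rightarrow> real"
  assumes "f C1_differentiable_on UNIV"
  shows "(f has_real_derivative deriv f x) (at x)" "continuous_on UNIV (deriv f)"
proof -
  obtain D where D: "\<And>y. (f has_vector_derivative D y) (at y)" "continuous_on UNIV D"
    using assms unfolding C1_differentiable_on_def by auto
  hence "(f has_real_derivative D y) (at y)" for y by (simp add: has_real_derivative_iff_has_vector_derivative)
  moreover from this have "deriv f = D" by (auto simp: fun_eq_iff intro: DERIV_imp_deriv)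
  ultimately show "(f has_real_derivative deriv f x) (at x)" "continuous_on UNIV (deriv f)" using D by auto
qed

lemma ell_derivative:
  assumes "continuous_on UNIV a"
  shows "(ell a has_real_derivative a x) (at x)"
proof -
  define K where "K = \<bar>x\<bar> + 1"
  have "((\<lambda>v. LBINT y=(0::real)..v. a y) has_vector_derivative a x) (at x within {-K..K})"
    by (rule interval_integral_FTC2) (auto simp: K_def intro: continuous_on_subset[OF assms])
  hence "((\<lambda>v. LBINT y=(0::real)..v. a y) has_real_derivative a x) (at x within {-K..K})"
    by (simp add: has_real_derivative_iff_has_vector_derivative)
  hence "((\<lambda>v. LBINT y=(0::real)..v. a y) has_real_derivative a x) (at x)"
    by (subst (asm) at_within_interior) (auto simp: K_def interior_atLeastAtMost_real)
  moreover have "(\<lambda>v. LBINT y=(0::real)..v. a y) = ell a" by (simp add: fun_eq_iff ell_def zero_ereal_def)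
  ultimately show ?thesis by simp
qed

text \<open>The little-o condition settles |x| \<ge> K with constant 1; on the compact rest
  continuity supplies the constant F.\<close>

lemma smallo_exp_decay_bound:
  fixes f :: "real \<Rightarrow> real"
  assumes f: "continuous_on UNIV f" and o: "f \<in> o[at_infinity](\<lambda>x. exp (- R * \<bar>x\<bar>))"
  shows "\<exists>D\<ge>0. \<forall>x. \<bar>f x\<bar> \<le> D * exp (- R * \<bar>x\<bar>)"
proof -
  have "eventually (\<lambda>x. \<bar>f x\<bar> \<le> exp (- R * \<bar>x\<bar>)) at_infinity"
    using landau_o.smallD[OF o, of 1] by simp
  then obtain K where K: "\<And>x. \<bar>x\<bar> \<ge> K \<Longrightarrow> \<bar>f x\<bar> \<le> exp (- R * \<bar>x\<bar>)"
    by (auto simp: eventually_at_infinity)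
  have "continuous_on {-K..K} (\<lambda>x. f x * exp (R * \<bar>x\<bar>))"
    by (intro continuous_intros continuous_on_subset[OF f]) auto
  from continuous_on_interval_bounded[OF this] obtain F where F: "\<And>x. \<bar>x\<bar> \<le> K \<Longrightarrow> \<bar>f x * exp (R * \<bar>x\<bar>)\<bar> \<le> F" by blast
  have "\<bar>f x\<bar> \<le> max 1 F * exp (- R * \<bar>x\<bar>)" for x
  proof (cases "\<bar>x\<bar> \<ge> K")
    case True
    have "\<bar>f x\<bar> \<le> 1 * exp (- R * \<bar>x\<bar>)" using K[OF True] by simp
    also have "\<dots> \<le> max 1 F * exp (- R * \<bar>x\<bar>)" by (intro mult_right_mono) auto
    finally show ?thesis .
  next
    case False
    hence "\<bar>f x\<bar> * exp (R * \<bar>x\<bar>) \<le> max 1 F" using F[of x] by (simp add: abs_mult)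
    from mult_right_mono[OF this, of "exp (- R * \<bar>x\<bar>)"] show ?thesis by (simp add: mult.assoc exp_add[symmetric])
  qed
  thus ?thesis by (intro exI[of _ "max 1 F"]) auto
qed

locale qsd_setting =
  fixes a V :: "real \<Rightarrow> real" and P :: "real \<Rightarrow> 'w measure" and B X :: "real \<Rightarrow> 'w \<Rightarrow> real"
    and lam :: "nat \<Rightarrow> real" and \<Psi> :: "nat \<Rightarrow> real \<Rightarrow> real"
  assumes std: "standing_assumptions a V"
    and bm: "\<And>x. brownian_motion (P x) B"
    and sde: "\<And>x. solves_sde a x (P x) B X"
    and spec: "spectral_data a V lam \<Psi>"
begin

lemma a_C1: "a C1_differentiable_on UNIV" and V_cont: "continuous_on UNIV V"
  using std by (auto simp: standing_assumptions_def)

lemmas a_deriv = C1_differentiable_deriv(1)[OF a_C1] and a'_cont = C1_differentiable_deriv(2)[OF a_C1]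

lemma a_cont: "continuous_on UNIV a"
  by (intro continuous_at_imp_continuous_on ballI DERIV_isCont[OF a_deriv])

lemmas ell_deriv = ell_derivative[OF a_cont]

lemma ell_cont: "continuous_on UNIV (ell a)"
  by (intro continuous_at_imp_continuous_on ballI DERIV_isCont[OF ell_deriv])

lemma ell_measurable[measurable]: "ell a \<in> borel_measurable borel"
  by (rule borel_measurable_continuous_onI[OF ell_cont])

lemma diffusion: "diffusion a x (P x) B X"
  using a_C1 bm sde by unfold_locales

lemma V_tilde_cont: "continuous_on UNIV (V_tilde a V)"
  unfolding V_tilde_def by (intro continuous_intros V_cont a'_cont a_cont) simp

definition vmax where "vmax = (SUP x. V x)"

lemma V_le: "V x \<le> vmax"
  using std unfolding vmax_def standing_assumptions_def by (intro cSUP_upper) auto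

text \<open>This bound on \<open>V_tilde\<close> serves twice: in the sup bound for combinations of
  eigenfunctions, which asks for a nonnegative constant, and as growth rate of exp ell under the
  semigroup.\<close>

definition C where "C = max 0 (vmax + (SUP x. deriv a x - (a x)\<^sup>2) / 2)"

lemma C_nonneg: "C \<ge> 0" and V_tilde_le: "V_tilde a V x \<le> C"
proof -
  have "deriv a x - (a x)\<^sup>2 \<le> (SUP x. deriv a x - (a x)\<^sup>2)"
    using std unfolding standing_assumptions_def by (intro cSUP_upper) auto
  hence "V x + (deriv a x - (a x)\<^sup>2) / 2 \<le> vmax + (SUP x. deriv a x - (a x)\<^sup>2) / 2"
    by (intro add_mono V_le divide_right_mono) auto
  thus "V_tilde a V x \<le> C" unfolding V_tilde_def C_def by (rule max.coboundedI2)
qed (simp add: C_def)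

lemma \<Psi>_C2: "\<Psi> k C1_differentiable_on UNIV" "deriv (\<Psi> k) C1_differentiable_on UNIV"
  using spec by (auto simp: spectral_data_def)

lemma \<Psi>_cont: "continuous_on UNIV (\<Psi> k)"
  by (intro continuous_at_imp_continuous_on ballI DERIV_isCont[OF C1_differentiable_deriv(1)[OF \<Psi>_C2(1)]])

lemma \<Psi>_exp_decay: "R > 0 \<Longrightarrow> \<exists>D\<ge>0. \<forall>x. \<bar>\<Psi> k x\<bar> \<le> D * exp (- R * \<bar>x\<bar>)"
  using spec by (intro smallo_exp_decay_bound \<Psi>_cont) (auto simp: spectral_data_def)

lemma \<Psi>0_pos: "\<Psi> 0 x > 0"
  using spec by (simp add: spectral_data_def)

sublocale schroedinger_eigenbasis "V_tilde a V" C lam \<Psi> "\<lambda>k. deriv (\<Psi> k)" "\<lambda>k. deriv (deriv (\<Psi> k))"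
proof
  show "deriv (deriv (\<Psi> k)) x / 2 + V_tilde a V x * \<Psi> k x = - lam k * \<Psi> k x" for k x
  proof (rule eigenfunction_second_derivative)
    show "(\<Psi> k, \<lambda>x. - lam k * \<Psi> k x) \<in> L_tilde a V" using spec by (auto simp: spectral_data_def)
    show "continuous_on UNIV (\<lambda>x. - lam k * \<Psi> k x)" by (intro continuous_intros \<Psi>_cont)
  qed (rule \<Psi>_C2 V_tilde_cont \<Psi>_cont)+
  show "AE x in lborel. f x = 0" if "square_integrable f" "\<And>k. (\<integral>x. f x * \<Psi> k x \<partial>lborel) = 0" for f
    using spec that by (auto simp: spectral_data_def)
  show "(\<integral>x. \<Psi> j x * \<Psi> k x \<partial>lborel) = (if j = k then 1 else 0)" for j k
    using spec by (auto simp: spectral_data_def)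
  show "\<exists>D. \<forall>x. \<bar>\<Psi> k x\<bar> \<le> D * exp (- \<bar>x\<bar>)" for k
    using \<Psi>_exp_decay[of 1 k] by auto
qed (use C1_differentiable_deriv[OF \<Psi>_C2(1)] C1_differentiable_deriv[OF \<Psi>_C2(2)] V_tilde_cont V_tilde_le C_nonneg in auto)

text \<open>Decay at rate |\<beta>| + 1 beats the growth exp (\<gamma> + |\<beta>| |x|) of the
  weight and leaves exp (-|x|). It is used with s = 1 to bound \<open>\<Theta> k\<close> and with s
  = -1 for the density of \<nu>.\<close>

lemma exp_ell_mult_\<Psi>_bound:
  assumes s: "\<bar>s\<bar> \<le> 1"
  shows "\<exists>D. \<forall>x. exp (s * ell a x) * \<bar>\<Psi> k x\<bar> \<le> D * exp (- \<bar>x\<bar>)"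
proof -
  obtain \<beta> \<gamma> where l: "\<And>x. \<bar>ell a x\<bar> \<le> \<gamma> + \<beta> * \<bar>x\<bar>" using std by (auto simp: standing_assumptions_def)
  define R where "R = \<bar>\<beta>\<bar> + 1"
  have R: "R > 0" by (simp add: R_def add_nonneg_pos)
  obtain D where D: "D \<ge> 0" "\<And>x. \<bar>\<Psi> k x\<bar> \<le> D * exp (- R * \<bar>x\<bar>)" using \<Psi>_exp_decay[of R k] R by blast
  have "exp (s * ell a x) * \<bar>\<Psi> k x\<bar> \<le> (D * exp \<gamma>) * exp (- \<bar>x\<bar>)" for x
  proof -
    have "s * ell a x \<le> \<bar>s\<bar> * \<bar>ell a x\<bar>" by (metis abs_ge_self abs_mult)
    also have "\<dots> \<le> 1 * \<bar>ell a x\<bar>" by (intro mult_right_mono s) simp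
    also have "\<dots> \<le> \<gamma> + \<bar>\<beta>\<bar> * \<bar>x\<bar>" using l[of x] mult_right_mono[OF abs_ge_self abs_ge_zero, of \<beta> x] by linarith
    finally have "exp (s * ell a x) * \<bar>\<Psi> k x\<bar> \<le> exp (\<gamma> + \<bar>\<beta>\<bar> * \<bar>x\<bar>) * (D * exp (- R * \<bar>x\<bar>))"
      by (intro mult_mono D) auto
    also have "\<dots> = (D * exp \<gamma>) * exp (- \<bar>x\<bar>)" by (simp add: exp_add[symmetric] R_def algebra_simps)
    finally show ?thesis .
  qed
  thus ?thesis by blast
qed

definition \<Theta> where "\<Theta> k x = exp (ell a x) * \<Psi> k x"

lemma exp_ell_mult_derivatives:
  assumes u: "\<And>x. (u has_real_derivative u1 x) (at x)" "\<And>x. (u1 has_real_derivative u2 x) (at x)"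
  shows "((\<lambda>x. exp (ell a x) * u x) has_real_derivative exp (ell a x) * (a x * u x + u1 x)) (at x)"
    and "((\<lambda>x. exp (ell a x) * (a x * u x + u1 x)) has_real_derivative
       exp (ell a x) * (a x * (a x * u x + u1 x) + (deriv a x * u x + a x * u1 x + u2 x))) (at x)"
  using u ell_deriv a_deriv by (auto intro!: derivative_eq_intros simp: algebra_simps)

text \<open>The ground state transform: conjugation by \<open>exp \<ell>\<close> turns the generator of \<open>X\<close> with potential \<open>V\<close> into \<open>L_tilde\<close>.\<close>

lemma generator_conjugation:
  "exp (ell a x) * (a x * (a x * u x + u1 x) + (deriv a x * u x + a x * u1 x + u2 x)) / 2
     - a x * (exp (ell a x) * (a x * u x + u1 x)) + V x * (exp (ell a x) * u x)
   = exp (ell a x) * (u2 x / 2 + V_tilde a V x * u x)"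
  by (simp add: V_tilde_def field_simps power2_eq_square)

context
  fixes t :: real assumes t: "t > 0"
begin

text \<open>\<open>\<Theta> k\<close> is bounded, because \<open>\<Psi> k\<close> decays faster than
  exp ell can grow; conjugation reduces the equation required of it to the eigenvalue
  equation.\<close>

lemma feynman_kac_\<Theta>: "feynman_kac V P X t (\<Theta> k) x = exp (- lam k * t) * \<Theta> k x"
proof -
  interpret diffusion a x "P x" B X by (rule diffusion)
  obtain D where D: "\<And>x. exp (ell a x) * \<bar>\<Psi> k x\<bar> \<le> D * exp (- \<bar>x\<bar>)"
    using exp_ell_mult_\<Psi>_bound[of 1 k] by auto
  have "0 \<le> exp (ell a 0) * \<bar>\<Psi> k 0\<bar>" by simp
  also have "\<dots> \<le> D" using D[of 0] by simp
  finally have "D \<ge> 0" .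
  hence D': "\<bar>\<Theta> k x\<bar> \<le> D" for x
    using order_trans[OF D[of x], of D] by (simp add: \<Theta>_def abs_mult mult_left_le)
  note dd = exp_ell_mult_derivatives[of "\<Psi> k" "deriv (\<Psi> k)" "deriv (deriv (\<Psi> k))", OF d1 d2]
  show ?thesis unfolding feynman_kac_def
  proof (rule bounded_eigenfunction[OF t V_cont V_le])
    show "(\<Theta> k has_real_derivative exp (ell a x) * (a x * \<Psi> k x + deriv (\<Psi> k) x)) (at x)" for x
      using dd(1) unfolding \<Theta>_def[abs_def] .
    show "((\<lambda>x. exp (ell a x) * (a x * \<Psi> k x + deriv (\<Psi> k) x)) has_real_derivative
       exp (ell a x) * (a x * (a x * \<Psi> k x + deriv (\<Psi> k) x) + (deriv a x * \<Psi> k x + a x * deriv (\<Psi> k) x + deriv (deriv (\<Psi> k)) x))) (at x)" for x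
      by (rule dd(2))
    show "continuous_on UNIV (\<lambda>x. exp (ell a x) * (a x * (a x * \<Psi> k x + deriv (\<Psi> k) x) + (deriv a x * \<Psi> k x + a x * deriv (\<Psi> k) x + deriv (deriv (\<Psi> k)) x)))"
      using C1_differentiable_deriv(2)[OF \<Psi>_C2(1)] C1_differentiable_deriv(2)[OF \<Psi>_C2(2)]
      by (intro continuous_intros ell_cont a_cont a'_cont \<Psi>_cont) auto
    show "exp (ell a y) * (a y * (a y * \<Psi> k y + deriv (\<Psi> k) y) + (deriv a y * \<Psi> k y + a y * deriv (\<Psi> k) y + deriv (deriv (\<Psi> k)) y)) / 2
       - a y * (exp (ell a y) * (a y * \<Psi> k y + deriv (\<Psi> k) y)) + V y * \<Theta> k y = - lam k * \<Theta> k y" for y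
      unfolding \<Theta>_def generator_conjugation eigen by simp
  qed (rule D')
qed

text \<open>Take u = 1 in the ground state transform: the generator with potential maps exp ell to
  \<open>V_tilde\<close> exp ell, which is at most C exp ell. As exp ell may be unbounded, its
  integrability is part of the claim.\<close>

lemma feynman_kac_exp_ell:
  "integrable (P x) (\<lambda>\<omega>. exp (LBINT s:{0..t}. V (X s \<omega>)) * exp (ell a (X t \<omega>)))"
  "feynman_kac V P X t (\<lambda>y. exp (ell a y)) x \<le> exp (C * t) * exp (ell a x)"
proof -
  interpret diffusion a x "P x" B X by (rule diffusion)
  note dd = exp_ell_mult_derivatives[of "\<lambda>_. 1" "\<lambda>_. 0" "\<lambda>_. 0", OF DERIV_const DERIV_const]
  have *: "((\<lambda>x. exp (ell a x)) has_real_derivative exp (ell a x) * (a x * 1 + 0)) (at x)" for x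
    using dd(1) by simp
  have **: "((\<lambda>x. exp (ell a x) * (a x * 1 + 0)) has_real_derivative exp (ell a x) * (a x * (a x * 1 + 0) + (deriv a x * 1 + a x * 0 + 0))) (at x)" for x
    by (rule dd(2))
  have c: "continuous_on UNIV (\<lambda>x. exp (ell a x) * (a x * (a x * 1 + 0) + (deriv a x * 1 + a x * 0 + 0)))"
    by (intro continuous_intros ell_cont a_cont a'_cont)
  have g: "exp (ell a y) * (a y * (a y * 1 + 0) + (deriv a y * 1 + a y * 0 + 0)) / 2 - a y * (exp (ell a y) * (a y * 1 + 0))
      + V y * exp (ell a y) \<le> C * exp (ell a y)" for y
    using generator_conjugation[of y "\<lambda>_. 1" "\<lambda>_. 0" "\<lambda>_. 0"] V_tilde_le[of y] by simp
  note ns = nonneg_supersolution[OF t V_cont V_le * ** c _ g]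
  show "integrable (P x) (\<lambda>\<omega>. exp (LBINT s:{0..t}. V (X s \<omega>)) * exp (ell a (X t \<omega>)))"
    by (rule ns(1)) simp
  show "feynman_kac V P X t (\<lambda>y. exp (ell a y)) x \<le> exp (C * t) * exp (ell a x)"
    unfolding feynman_kac_def by (rule ns(2)) simp
qed

end

end


section \<open>Determining test functions\<close>

definition C2_function :: "(real \<Rightarrow> real) \<Rightarrow> bool" where
  "C2_function f \<longleftrightarrow> (\<exists>f1 f2. (\<forall>x. (f has_real_derivative f1 x) (at x)) \<and>
     (\<forall>x. (f1 has_real_derivative f2 x) (at x)) \<and> continuous_on UNIV f2)"

lemma C2_functionI:
  assumes "\<And>x. (f has_real_derivative f1 x) (at x)" "\<And>x. (f1 has_real_derivative f2 x) (at x)" "continuous_on UNIV f2"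
  shows "C2_function f"
  using assms unfolding C2_function_def by blast

lemma C2_function_const: "C2_function (\<lambda>_. c)"
  by (rule C2_functionI[of _ "\<lambda>_. 0" "\<lambda>_. 0"]) auto

lemma C2_function_id: "C2_function (\<lambda>x. x)"
  by (rule C2_functionI[of _ "\<lambda>_. 1" "\<lambda>_. 0"]) auto

lemma C2_function_diff:
  assumes "C2_function f" "C2_function g" shows "C2_function (\<lambda>x. f x - g x)"
proof -
  obtain f1 f2 g1 g2 where *: "\<And>x. (f has_real_derivative f1 x) (at x)" "\<And>x. (f1 has_real_derivative f2 x) (at x)" "continuous_on UNIV f2"
    "\<And>x. (g has_real_derivative g1 x) (at x)" "\<And>x. (g1 has_real_derivative g2 x) (at x)" "continuous_on UNIV g2"
    using assms unfolding C2_function_def by metis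
  show ?thesis
    by (rule C2_functionI[of _ "\<lambda>x. f1 x - g1 x" "\<lambda>x. f2 x - g2 x"]) (intro derivative_intros continuous_intros *)+
qed

lemma C2_function_mult:
  assumes "C2_function f" "C2_function g" shows "C2_function (\<lambda>x. f x * g x)"
proof -
  obtain f1 f2 g1 g2 where *: "\<And>x. (f has_real_derivative f1 x) (at x)" "\<And>x. (f1 has_real_derivative f2 x) (at x)" "continuous_on UNIV f2"
    "\<And>x. (g has_real_derivative g1 x) (at x)" "\<And>x. (g1 has_real_derivative g2 x) (at x)" "continuous_on UNIV g2"
    using assms unfolding C2_function_def by metis
  have c: "continuous_on UNIV f" "continuous_on UNIV f1" "continuous_on UNIV g" "continuous_on UNIV g1"
    by (intro continuous_at_imp_continuous_on ballI; rule DERIV_isCont[OF *(1)] DERIV_isCont[OF *(2)] DERIV_isCont[OF *(4)] DERIV_isCont[OF *(5)])+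
  show ?thesis
  proof (rule C2_functionI[of _ "\<lambda>x. f1 x * g x + f x * g1 x" "\<lambda>x. f2 x * g x + f1 x * g1 x + (f1 x * g1 x + f x * g2 x)"])
    show "((\<lambda>x. f x * g x) has_real_derivative f1 x * g x + f x * g1 x) (at x)" for x
      using * by (auto intro!: derivative_eq_intros)
    show "((\<lambda>x. f1 x * g x + f x * g1 x) has_real_derivative f2 x * g x + f1 x * g1 x + (f1 x * g1 x + f x * g2 x)) (at x)" for x
      using * by (auto intro!: derivative_eq_intros)
  qed (intro continuous_intros c *)
qed

lemma C2_function_power: "C2_function f \<Longrightarrow> C2_function (\<lambda>x. f x ^ n)"
  by (induction n) (auto intro: C2_function_const C2_function_mult)

lemma positive_part_power_derivative:
  "((\<lambda>y. max 0 y ^ Suc (Suc n)) has_real_derivative real (Suc (Suc n)) * max 0 x ^ Suc n) (at x)"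
proof (cases x "0::real" rule: linorder_cases)
  case less
  have "((\<lambda>_. 0) has_real_derivative 0) (at x)" by simp
  from has_field_derivative_transform_within_open[OF this, of "{..<0}" "\<lambda>y. max 0 y ^ Suc (Suc n)"] less
  show ?thesis by (simp add: max_def)
next
  case greater
  have "((\<lambda>y. y ^ Suc (Suc n)) has_real_derivative real (Suc (Suc n)) * x ^ Suc n) (at x)"
    by (rule derivative_eq_intros | simp)+
  from has_field_derivative_transform_within_open[OF this, of "{0<..}" "\<lambda>y. max 0 y ^ Suc (Suc n)"] greater
  show ?thesis by (simp add: max_def)
next
  case equal
  have "((\<lambda>y::real. max 0 y ^ Suc n) \<longlongrightarrow> max 0 0 ^ Suc n) (at 0)"
    by (intro tendsto_intros)
  hence "((\<lambda>y::real. max 0 y ^ Suc n) \<longlongrightarrow> 0) (at 0)" by simp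
  \<comment> \<open>At 0 the difference quotient is again a power of the positive part, one degree
    lower, and so tends to 0.\<close>
  moreover have "eventually (\<lambda>y::real. max 0 y ^ Suc n = (max 0 y ^ Suc (Suc n) - max 0 0 ^ Suc (Suc n)) / (y - 0)) (at 0)"
    by (auto simp: eventually_at_filter max_def)
  ultimately have "((\<lambda>y::real. (max 0 y ^ Suc (Suc n) - max 0 0 ^ Suc (Suc n)) / (y - 0)) \<longlongrightarrow> 0) (at 0)"
    by (rule Lim_transform_eventually)
  thus ?thesis unfolding equal by (simp add: has_field_derivative_iff)
qed

text \<open>The cube is the lowest integer power of the positive part with a continuous second
  derivative.\<close>

lemma C2_function_positive_part_cube:
  assumes "C2_function f" shows "C2_function (\<lambda>x. max 0 (f x) ^ 3)"
proof -
  obtain f1 f2 where *: "\<And>x. (f has_real_derivative f1 x) (at x)" "\<And>x. (f1 has_real_derivative f2 x) (at x)" "continuous_on UNIV f2"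
    using assms unfolding C2_function_def by metis
  have c: "continuous_on UNIV f" "continuous_on UNIV f1"
    by (intro continuous_at_imp_continuous_on ballI; rule DERIV_isCont[OF *(1)] DERIV_isCont[OF *(2)])+
  have p3: "((\<lambda>x. max 0 (f x) ^ 3) has_real_derivative 3 * max 0 (f x) ^ 2 * f1 x) (at x)" for x
    using DERIV_chain2[OF positive_part_power_derivative[of 1] *(1)] by (simp add: numeral_3_eq_3 numeral_2_eq_2)
  have p2: "((\<lambda>x. max 0 (f x) ^ 2) has_real_derivative 2 * max 0 (f x) * f1 x) (at x)" for x
    using DERIV_chain2[OF positive_part_power_derivative[of 0] *(1)] by (simp add: numeral_2_eq_2)
  show ?thesis
  proof (rule C2_functionI[OF p3])
    show "((\<lambda>x. 3 * max 0 (f x) ^ 2 * f1 x) has_real_derivative 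
       (3 * (2 * max 0 (f x) * f1 x)) * f1 x + 3 * max 0 (f x) ^ 2 * f2 x) (at x)" for x
      by (rule DERIV_cong[OF DERIV_mult[OF DERIV_cmult[OF p2] *(2)]]) (simp add: algebra_simps)
    show "continuous_on UNIV (\<lambda>x. (3 * (2 * max 0 (f x) * f1 x)) * f1 x + 3 * max 0 (f x) ^ 2 * f2 x)"
      by (intro continuous_intros c *)
  qed
qed

lemma C2_function_continuous: "C2_function f \<Longrightarrow> continuous_on UNIV f"
  unfolding C2_function_def by (meson DERIV_isCont continuous_at_imp_continuous_on)

text \<open>For a bump b with values in (0, 1] inside the interval and 0 outside, 1 - (1 - b)^m
  tends to 1 exactly where b > 0, while every member stays supported in the interval and bounded by
  1.\<close>

lemma interval_indicator_C2_approximation: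
  fixes p q :: real
  shows "\<exists>s. (\<forall>m. C2_function (s m)) \<and> (\<forall>m x. x \<notin> {p<..<q} \<longrightarrow> s m x = 0) \<and> (\<forall>m x. \<bar>s m x\<bar> \<le> 1) \<and>
     (\<forall>x. (\<lambda>m. s m x) \<longlonglongrightarrow> indicator {p<..<q} x)"
proof (cases "p < q")
  case False
  thus ?thesis by (intro exI[of _ "\<lambda>_ _. 0"]) (auto simp: C2_function_const indicator_def)
next
  case True
  \<comment> \<open>The linear factors u and v are scaled to u + v = 2, so that u v = 1 - (u - 1)^2
    \<le> 1.\<close>
  define b where "b = (\<lambda>x. max 0 ((2 / (q - p)) * (x - p) * ((2 / (q - p)) * (q - x))) ^ 3)"
  define s where "s = (\<lambda>(m::nat) x. 1 - (1 - b x) ^ m)"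
  have C2b: "C2_function b" unfolding b_def
    by (intro C2_function_positive_part_cube C2_function_mult C2_function_diff C2_function_const C2_function_id)
  have b0: "b x = 0" if "x \<notin> {p<..<q}" for x
  proof -
    from that True consider "x - p \<le> 0" "0 \<le> q - x" | "0 \<le> x - p" "q - x \<le> 0" by fastforce
    hence "(2 / (q - p)) * (x - p) * ((2 / (q - p)) * (q - x)) \<le> 0"
    proof cases
      case 1 thus ?thesis using True by (intro mult_nonpos_nonneg mult_nonneg_nonpos mult_nonneg_nonneg) auto
    next
      case 2 thus ?thesis using True by (intro mult_nonneg_nonpos mult_nonneg_nonneg) auto
    qed
    thus ?thesis by (simp add: b_def max_def)
  qed
  have b1: "b x > 0" if "x \<in> {p<..<q}" for x
  proof -
    have "0 < (2 / (q - p)) * (x - p) * ((2 / (q - p)) * (q - x))" using that True by (intro mult_pos_pos) auto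
    thus ?thesis by (simp add: b_def max_def)
  qed
  have b2: "0 \<le> b x" "b x \<le> 1" for x
  proof -
    define u v where "u = (2 / (q - p)) * (x - p)" and "v = (2 / (q - p)) * (q - x)"
    have "u + v = (2 / (q - p)) * ((x - p) + (q - x))" unfolding u_def v_def by (simp only: distrib_left)
    also have "\<dots> = 2" using True by (simp add: field_simps)
    finally have v: "v = 2 - u" by simp
    have "u * v = 1 - (u - 1)\<^sup>2" unfolding v by (simp add: power2_eq_square algebra_simps)
    hence "u * v \<le> 1" by simp
    hence "max 0 (u * v) ^ 3 \<le> 1" by (intro power_le_one) auto
    thus "b x \<le> 1" by (simp add: b_def u_def v_def mult.assoc)
    show "0 \<le> b x" by (simp add: b_def)
  qed
  have "C2_function (s m)" for m
    unfolding s_def by (intro C2_function_diff C2_function_const C2_function_power C2b)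
  moreover have "\<bar>s m x\<bar> \<le> 1" for m x
  proof -
    have "0 \<le> (1 - b x) ^ m" "(1 - b x) ^ m \<le> 1" using b2[of x] by (auto intro!: power_le_one)
    thus ?thesis by (simp add: s_def)
  qed
  moreover have "s m x = 0" if "x \<notin> {p<..<q}" for m x using b0[OF that] by (simp add: s_def)
  moreover have "(\<lambda>m. s m x) \<longlonglongrightarrow> indicator {p<..<q} x" for x
  proof (cases "x \<in> {p<..<q}")
    case True
    have "(\<lambda>m. 1 - (1 - b x) ^ m) \<longlonglongrightarrow> 1 - 0"
      using b1[OF True] b2[of x] by (intro tendsto_intros LIMSEQ_realpow_zero) auto
    thus ?thesis using True by (simp add: s_def)
  qed (simp add: s_def b0)
  ultimately show ?thesis by blast
qed

section \<open>Integration against \<nu>\<close>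

context qsd_setting
begin

text \<open>Allows a C^2 test function to be written as exp ell times another C^2 function, the form
  to which the expansion applies.\<close>

lemma C2_function_exp_neg_ell: "C2_function (\<lambda>x. exp (- ell a x))"
proof (rule C2_functionI)
  show "((\<lambda>x. exp (- ell a x)) has_real_derivative exp (- ell a x) * - a x) (at x)" for x
    using ell_deriv by (auto intro!: derivative_eq_intros)
  show "((\<lambda>x. exp (- ell a x) * - a x) has_real_derivative (exp (- ell a x) * - a x) * - a x + exp (- ell a x) * - deriv a x) (at x)" for x
    using ell_deriv a_deriv by (auto intro!: derivative_eq_intros)
  show "continuous_on UNIV (\<lambda>x. (exp (- ell a x) * - a x) * - a x + exp (- ell a x) * - deriv a x)"
    by (intro continuous_intros ell_cont a_cont a'_cont)
qed

text \<open>The normalising constant of \<nu>, with \<open>Theta0\<close> exp (-2 ell) simplified to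
  exp (-ell) \<open>\<Psi> 0\<close>.\<close>

definition Z where "Z = (\<integral>x. exp (- ell a x) * \<Psi> 0 x \<partial>lborel)"

lemma qsd_weight_integrable: "integrable lborel (\<lambda>x. exp (- ell a x) * \<Psi> 0 x)"
proof -
  obtain D where D: "\<And>x. exp (- ell a x) * \<bar>\<Psi> 0 x\<bar> \<le> D * exp (- \<bar>x\<bar>)"
    using exp_ell_mult_\<Psi>_bound[of "-1" 0] by auto
  have "integrable lborel (\<lambda>x. D * exp (- \<bar>x\<bar>))" by (intro integrable_mult_right integrable_exp_neg_abs)
  thus ?thesis
    by (rule Bochner_Integration.integrable_bound) (auto intro!: AE_I2 order_trans[OF D] mult_right_mono simp: abs_mult)
qed

lemma Z_pos: "Z > 0"
proof -
  have "Z \<ge> 0" unfolding Z_def using \<Psi>0_pos by (intro Bochner_Integration.integral_nonneg) (simp add: less_imp_le)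
  moreover have "Z \<noteq> 0"
  proof
    assume "Z = 0"
    hence "AE x in lborel. exp (- ell a x) * \<Psi> 0 x = 0"
      using integral_nonneg_eq_0_iff_AE[OF qsd_weight_integrable] \<Psi>0_pos by (auto simp: Z_def less_imp_le)
    moreover have "continuous_on UNIV (\<lambda>x. exp (- ell a x) * \<Psi> 0 x)"
      by (intro continuous_intros ell_cont \<Psi>_cont)
    ultimately have "exp (- ell a 0) * \<Psi> 0 0 = 0" using continuous_AE_zero by blast
    thus False using \<Psi>0_pos[of 0] by simp
  qed
  ultimately show ?thesis by simp
qed

lemma qsd_eq: "qsd a \<Psi> = density lborel (\<lambda>x. ennreal (exp (- ell a x) * \<Psi> 0 x / Z))"
proof -
  have "Theta0 a \<Psi> x * exp (- 2 * ell a x) = exp (- ell a x) * \<Psi> 0 x" for x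
  proof -
    have "Theta0 a \<Psi> x * exp (- 2 * ell a x) = (exp (ell a x) * exp (- 2 * ell a x)) * \<Psi> 0 x"
      by (simp add: Theta0_def)
    also have "exp (ell a x) * exp (- 2 * ell a x) = exp (- ell a x)" by (simp add: exp_add[symmetric])
    finally show ?thesis .
  qed
  thus ?thesis by (simp add: qsd_def Z_def)
qed

lemma sets_qsd[simp, measurable_cong]: "sets (qsd a \<Psi>) = sets borel" and space_qsd[simp]: "space (qsd a \<Psi>) = UNIV"
  by (simp_all add: qsd_eq)

lemma prob_space_qsd: "prob_space (qsd a \<Psi>)"
proof
  have "emeasure (qsd a \<Psi>) (space (qsd a \<Psi>)) = (\<integral>\<^sup>+x. ennreal (exp (- ell a x) * \<Psi> 0 x / Z) \<partial>lborel)"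
    unfolding space_qsd unfolding qsd_eq by (simp add: emeasure_density)
  also have "\<dots> = ennreal (\<integral>x. exp (- ell a x) * \<Psi> 0 x / Z \<partial>lborel)"
    using \<Psi>0_pos Z_pos by (intro nn_integral_eq_integral) (auto simp: less_imp_le qsd_weight_integrable)
  also have "(\<integral>x. exp (- ell a x) * \<Psi> 0 x / Z \<partial>lborel) = 1"
    using Z_pos by (simp add: Z_def[symmetric])
  finally show "emeasure (qsd a \<Psi>) (space (qsd a \<Psi>)) = 1" by simp
qed

lemma qsd_integral:
  fixes g :: "real \<Rightarrow> real"
  assumes [measurable]: "g \<in> borel_measurable borel"
  shows "(\<integral>x. g x \<partial>qsd a \<Psi>) = (\<integral>x. exp (- ell a x) * \<Psi> 0 x * g x \<partial>lborel) / Z"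
    and "integrable (qsd a \<Psi>) g \<longleftrightarrow> integrable lborel (\<lambda>x. exp (- ell a x) * \<Psi> 0 x * g x)"
proof -
  have nn: "0 \<le> exp (- ell a x) * \<Psi> 0 x / Z" for x using \<Psi>0_pos[of x] Z_pos by simp
  show "(\<integral>x. g x \<partial>qsd a \<Psi>) = (\<integral>x. exp (- ell a x) * \<Psi> 0 x * g x \<partial>lborel) / Z"
    unfolding qsd_eq using nn by (subst integral_density) auto
  have "integrable (qsd a \<Psi>) g \<longleftrightarrow> integrable lborel (\<lambda>x. (exp (- ell a x) * \<Psi> 0 x * g x) / Z)"
    unfolding qsd_eq using nn by (subst integrable_density) auto
  thus "integrable (qsd a \<Psi>) g \<longleftrightarrow> integrable lborel (\<lambda>x. exp (- ell a x) * \<Psi> 0 x * g x)"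
    using Z_pos integrable_mult_left_iff[of lborel "1 / Z" "\<lambda>x. exp (- ell a x) * \<Psi> 0 x * g x"] by simp
qed

lemma \<Theta>_measurable[measurable]: "\<Theta> k \<in> borel_measurable borel"
  unfolding \<Theta>_def[abs_def] by measurable

lemma exp_neg_ell_cancel: "exp (- ell a x) * y * (exp (ell a x) * z) = y * z"
proof -
  have "exp (- ell a x) * y * (exp (ell a x) * z) = (exp (- ell a x) * exp (ell a x)) * (y * z)" by (simp only: mult_ac)
  also have "exp (- ell a x) * exp (ell a x) = 1" by (simp add: exp_add[symmetric])
  finally show ?thesis by simp
qed

text \<open>The factors exp (-ell) and exp ell cancel, so integrating \<open>\<Theta> k\<close>
  against \<nu> gives the L^2(dx) inner product of \<open>\<Psi> 0\<close> and
  \<open>\<Psi> k\<close>, divided by Z.\<close>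

lemma qsd_\<Theta>: "integrable (qsd a \<Psi>) (\<Theta> k)" "(\<integral>x. \<Theta> k x \<partial>qsd a \<Psi>) = (if k = 0 then 1 / Z else 0)"
  unfolding qsd_integral[OF \<Theta>_measurable] unfolding \<Theta>_def exp_neg_ell_cancel ortho
  by (auto simp: \<Psi>_mult_integrable)

text \<open>The same cancellation leaves \<open>\<Psi> 0\<close>, which is integrable; pointwise
  errors of size exp ell can thus be integrated against \<nu>.\<close>

lemma qsd_exp_ell: "integrable (qsd a \<Psi>) (\<lambda>x. exp (ell a x))"
proof (subst qsd_integral(2))
  have "exp (- ell a x) * \<Psi> 0 x * exp (ell a x) = \<Psi> 0 x" for x
    using exp_neg_ell_cancel[of x "\<Psi> 0 x" 1] by (simp only: mult_1_right)
  thus "integrable lborel (\<lambda>x. exp (- ell a x) * \<Psi> 0 x * exp (ell a x))"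
    using \<Psi>_integrable[of 0] by (simp only:)
qed measurable

end

section \<open>The class of functions satisfying the quasi-stationarity identity\<close>

context qsd_setting
begin

context
  fixes t :: real assumes t: "t > 0"
begin

abbreviation fk :: "(real \<Rightarrow> real) \<Rightarrow> real \<Rightarrow> real" where
  "fk \<equiv> feynman_kac V P X t"

lemma feynman_kac_integrand:
  fixes \<phi> :: "real \<Rightarrow> real"
  assumes [measurable]: "\<phi> \<in> borel_measurable borel"
  shows "(\<lambda>\<omega>. exp (LBINT s:{0..t}. V (X s \<omega>)) * \<phi> (X t \<omega>)) \<in> borel_measurable (P x)"
    and "\<omega> \<in> space (P x) \<Longrightarrow> \<bar>\<phi> (X t \<omega>)\<bar> \<le> K \<Longrightarrow>
      \<bar>exp (LBINT s:{0..t}. V (X s \<omega>)) * \<phi> (X t \<omega>)\<bar> \<le> exp (vmax * t) * K"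
proof -
  interpret diffusion a x "P x" B X by (rule diffusion)
  have [measurable]: "X t \<in> borel_measurable (P x)" "(\<lambda>\<omega>. LBINT s:{0..t}. V (X s \<omega>)) \<in> borel_measurable (P x)"
    using t V_cont by auto
  show "(\<lambda>\<omega>. exp (LBINT s:{0..t}. V (X s \<omega>)) * \<phi> (X t \<omega>)) \<in> borel_measurable (P x)" by measurable
  assume "\<omega> \<in> space (P x)" "\<bar>\<phi> (X t \<omega>)\<bar> \<le> K"
  with weight_le[OF V_cont V_le _ this(1), of t] t
  show "\<bar>exp (LBINT s:{0..t}. V (X s \<omega>)) * \<phi> (X t \<omega>)\<bar> \<le> exp (vmax * t) * K"
    unfolding abs_mult by (intro mult_mono) auto
qed

lemma feynman_kac_integrable:
  assumes "\<phi> \<in> borel_measurable borel" "\<And>y. \<bar>\<phi> y\<bar> \<le> K"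
  shows "integrable (P x) (\<lambda>\<omega>. exp (LBINT s:{0..t}. V (X s \<omega>)) * \<phi> (X t \<omega>))"
proof -
  interpret diffusion a x "P x" B X by (rule diffusion)
  show ?thesis
    using feynman_kac_integrand[OF assms(1)] assms(2)
    by (intro integrable_const_bound[of _ "exp (vmax * t) * K"] AE_I2) auto
qed

lemma feynman_kac_bound:
  assumes "\<phi> \<in> borel_measurable borel" "\<And>y. \<bar>\<phi> y\<bar> \<le> K"
  shows "\<bar>fk \<phi> x\<bar> \<le> exp (vmax * t) * K"
proof -
  interpret diffusion a x "P x" B X by (rule diffusion)
  have "\<bar>fk \<phi> x\<bar> \<le> expectation (\<lambda>\<omega>. \<bar>exp (LBINT s:{0..t}. V (X s \<omega>)) * \<phi> (X t \<omega>)\<bar>)"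
    unfolding feynman_kac_def by (rule integral_abs_bound)
  also have "\<dots> \<le> expectation (\<lambda>_. exp (vmax * t) * K)"
    using feynman_kac_integrand(2)[OF assms(1)] assms(2)
    by (intro integral_mono integrable_abs feynman_kac_integrable[OF assms]) auto
  finally show ?thesis by (simp add: prob_space)
qed

text \<open>Nothing is assumed about how \<open>P x\<close> depends on x, so measurability of
  \<open>fk \<phi>\<close> has to be carried along with the identity; the integral of a
  nonmeasurable function would be 0 by default.\<close>

definition admissible :: "(real \<Rightarrow> real) \<Rightarrow> bool" where
  "admissible \<phi> \<longleftrightarrow> \<phi> \<in> borel_measurable borel \<and> (\<exists>K. \<forall>y. \<bar>\<phi> y\<bar> \<le> K) \<and> fk \<phi> \<in> borel_measurable borel \<and>
     (\<integral>x. fk \<phi> x \<partial>qsd a \<Psi>) = exp (- lam 0 * t) * (\<integral>x. \<phi> x \<partial>qsd a \<Psi>)"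

lemma admissible_linear:
  assumes "admissible \<phi>" "admissible \<psi>"
  shows "admissible (\<lambda>x. c * \<phi> x + \<psi> x)"
proof -
  interpret nu: prob_space "qsd a \<Psi>" by (rule prob_space_qsd)
  obtain K L where K: "\<And>y. \<bar>\<phi> y\<bar> \<le> K" and L: "\<And>y. \<bar>\<psi> y\<bar> \<le> L"
    using assms by (auto simp: admissible_def)
  have m[measurable]: "\<phi> \<in> borel_measurable borel" "\<psi> \<in> borel_measurable borel"
    "fk \<phi> \<in> borel_measurable borel" "fk \<psi> \<in> borel_measurable borel" using assms by (auto simp: admissible_def)
  have lin: "fk (\<lambda>x. c * \<phi> x + \<psi> x) x = c * fk \<phi> x + fk \<psi> x" for x
    unfolding feynman_kac_def using feynman_kac_integrable[OF m(1) K] feynman_kac_integrable[OF m(2) L]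
    by (simp add: distrib_left mult.left_commute[of _ c])
  have bd: "\<bar>c * \<phi> y + \<psi> y\<bar> \<le> \<bar>c\<bar> * K + L" for y
    using K[of y] L[of y] mult_left_mono[OF K[of y], of "\<bar>c\<bar>"] abs_triangle_ineq[of "c * \<phi> y" "\<psi> y"] by (simp add: abs_mult)
  have i: "integrable (qsd a \<Psi>) \<phi>" "integrable (qsd a \<Psi>) \<psi>"
    "integrable (qsd a \<Psi>) (fk \<phi>)" "integrable (qsd a \<Psi>) (fk \<psi>)"
    using K L feynman_kac_bound[OF m(1) K] feynman_kac_bound[OF m(2) L]
    by (auto intro!: nu.integrable_const_bound AE_I2)
  have "(\<integral>x. c * fk \<phi> x + fk \<psi> x \<partial>qsd a \<Psi>) = exp (- lam 0 * t) * (\<integral>x. c * \<phi> x + \<psi> x \<partial>qsd a \<Psi>)"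
    using i assms by (simp add: admissible_def algebra_simps)
  moreover have "(\<lambda>x. c * fk \<phi> x + fk \<psi> x) \<in> borel_measurable borel" by measurable
  moreover have "fk (\<lambda>x. c * \<phi> x + \<psi> x) = (\<lambda>x. c * fk \<phi> x + fk \<psi> x)" using lin by (simp add: fun_eq_iff)
  ultimately show ?thesis unfolding admissible_def using bd by auto
qed

text \<open>Dominated convergence twice: under each \<open>P x\<close>, where V \<le>
  \<open>vmax\<close> bounds the weight, and then under \<nu>. Pointwise limits preserve
  measurability in the starting point.\<close>

lemma admissible_bounded_limit:
  assumes \<phi>: "\<And>n. admissible (\<phi> n)" "\<And>n y. \<bar>\<phi> n y\<bar> \<le> K" and lim: "\<And>y. (\<lambda>n. \<phi> n y) \<longlonglongrightarrow> \<psi> y"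
  shows "admissible \<psi>"
proof -
  interpret nu: prob_space "qsd a \<Psi>" by (rule prob_space_qsd)
  have m[measurable]: "\<phi> n \<in> borel_measurable borel" "fk (\<phi> n) \<in> borel_measurable borel" for n
    using \<phi>(1) by (auto simp: admissible_def)
  have \<psi>m[measurable]: "\<psi> \<in> borel_measurable borel" by (rule borel_measurable_LIMSEQ_real[OF lim m(1)])
  have \<psi>K: "\<bar>\<psi> y\<bar> \<le> K" for y
    by (rule LIMSEQ_le_const2[OF tendsto_rabs[OF lim]]) (auto simp: \<phi>(2))
  have fklim: "(\<lambda>n. fk (\<phi> n) x) \<longlonglongrightarrow> fk \<psi> x" for x
  proof -
    interpret diffusion a x "P x" B X by (rule diffusion)
    show ?thesis unfolding feynman_kac_def
    proof (rule integral_dominated_convergence[where w = "\<lambda>_. exp (vmax * t) * K"])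
      show "AE \<omega> in P x. (\<lambda>n. exp (LBINT s:{0..t}. V (X s \<omega>)) * \<phi> n (X t \<omega>)) \<longlonglongrightarrow> exp (LBINT s:{0..t}. V (X s \<omega>)) * \<psi> (X t \<omega>)"
        by (intro AE_I2 tendsto_intros lim)
      show "AE \<omega> in P x. norm (exp (LBINT s:{0..t}. V (X s \<omega>)) * \<phi> n (X t \<omega>)) \<le> exp (vmax * t) * K" for n
        using feynman_kac_integrand(2)[OF m(1)] \<phi>(2) by (intro AE_I2) simp
    qed (auto intro!: feynman_kac_integrand(1) m \<psi>m)
  qed
  have fkm[measurable]: "fk \<psi> \<in> borel_measurable borel" by (rule borel_measurable_LIMSEQ_real[OF fklim m(2)])
  have 1: "(\<lambda>n. \<integral>x. fk (\<phi> n) x \<partial>qsd a \<Psi>) \<longlonglongrightarrow> (\<integral>x. fk \<psi> x \<partial>qsd a \<Psi>)"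
    by (rule integral_dominated_convergence[where w = "\<lambda>_. exp (vmax * t) * K"])
       (use fklim feynman_kac_bound[OF m(1) \<phi>(2)] in \<open>auto intro!: AE_I2\<close>)
  have "(\<lambda>n. \<integral>x. \<phi> n x \<partial>qsd a \<Psi>) \<longlonglongrightarrow> (\<integral>x. \<psi> x \<partial>qsd a \<Psi>)"
    by (rule integral_dominated_convergence[where w = "\<lambda>_. K"]) (use lim \<phi>(2) in \<open>auto intro!: AE_I2\<close>)
  hence "(\<lambda>n. exp (- lam 0 * t) * (\<integral>x. \<phi> n x \<partial>qsd a \<Psi>)) \<longlonglongrightarrow> exp (- lam 0 * t) * (\<integral>x. \<psi> x \<partial>qsd a \<Psi>)"
    by (rule tendsto_mult_left)
  moreover have "(\<lambda>n. exp (- lam 0 * t) * (\<integral>x. \<phi> n x \<partial>qsd a \<Psi>)) = (\<lambda>n. \<integral>x. fk (\<phi> n) x \<partial>qsd a \<Psi>)"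
    using \<phi>(1) by (simp add: admissible_def)
  ultimately have "(\<integral>x. fk \<psi> x \<partial>qsd a \<Psi>) = exp (- lam 0 * t) * (\<integral>x. \<psi> x \<partial>qsd a \<Psi>)"
    using 1 LIMSEQ_unique by metis
  thus ?thesis unfolding admissible_def using \<psi>K \<psi>m fkm by blast
qed

text \<open>Expanding \<open>f\<close> in the \<open>\<Psi> k\<close> expands \<open>exp \<ell> * f\<close> in the \<open>\<Theta> k\<close>, with error at most \<open>\<epsilon> exp \<ell>\<close>; the
  semigroup enlarges such an error by at most \<open>exp (C t)\<close>, and \<open>\<nu>\<close> annihilates every \<open>\<Theta> k\<close> except \<open>\<Theta> 0\<close>.\<close>

lemma admissible_exp_ell_mult:
  assumes f: "C2_function f" and supp: "\<And>x. \<bar>x\<bar> \<ge> R \<Longrightarrow> f x = 0"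
  shows "admissible (\<lambda>x. exp (ell a x) * f x)"
proof -
  interpret nu: prob_space "qsd a \<Psi>" by (rule prob_space_qsd)
  define \<phi> where "\<phi> = (\<lambda>x. exp (ell a x) * f x)"
  obtain f1 f2 where f': "\<And>x. (f has_real_derivative f1 x) (at x)" "\<And>x. (f1 has_real_derivative f2 x) (at x)" "continuous_on UNIV f2"
    using f unfolding C2_function_def by blast
  have \<phi>c: "continuous_on UNIV \<phi>" unfolding \<phi>_def by (intro continuous_intros ell_cont C2_function_continuous[OF f])
  have \<phi>m[measurable]: "\<phi> \<in> borel_measurable borel" by (rule borel_measurable_continuous_onI[OF \<phi>c])
  obtain F where F: "\<And>x. \<bar>x\<bar> \<le> R \<Longrightarrow> \<bar>\<phi> x\<bar> \<le> F"
    using continuous_on_interval_bounded[OF continuous_on_subset[OF \<phi>c subset_UNIV], of R] by blast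
  have \<phi>b: "\<bar>\<phi> x\<bar> \<le> max F 0" for x
    using F[of x] supp[of x] by (cases "\<bar>x\<bar> \<le> R") (auto simp: \<phi>_def)
  define c where "c = (\<lambda>k. \<integral>y. f y * \<Psi> k y \<partial>lborel)"
  \<comment> \<open>The semigroup applied term by term to the n-th partial sum of exp ell times the
    expansion of f.\<close>
  define G where "G = (\<lambda>n x. \<Sum>k<n. c k * (exp (- lam k * t) * \<Theta> k x))"
  have Gm[measurable]: "G n \<in> borel_measurable borel" for n unfolding G_def by measurable
  have fkG: "\<exists>N. \<forall>n\<ge>N. \<forall>x. \<bar>fk \<phi> x - G n x\<bar> \<le> \<epsilon> * (exp (C * t) * exp (ell a x))" if e: "\<epsilon> > 0" for \<epsilon>
  proof -
    obtain N where N: "\<And>n x. n \<ge> N \<Longrightarrow> \<bar>f x - lincomb c {..<n} x\<bar> \<le> \<epsilon>"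
      using eigen_expansion_uniform[OF f' supp e] unfolding c_def by blast
    have "\<bar>fk \<phi> x - G n x\<bar> \<le> \<epsilon> * (exp (C * t) * exp (ell a x))" if n: "n \<ge> N" for n x
    proof -
      interpret diffusion a x "P x" B X by (rule diffusion)
      define D where "D = (\<lambda>\<omega>. exp (LBINT s:{0..t}. V (X s \<omega>)))"
      have \<Theta>b: "\<exists>K. \<forall>x. \<bar>\<Theta> k x\<bar> \<le> K" for k
      proof -
        obtain A where A: "\<And>x. exp (ell a x) * \<bar>\<Psi> k x\<bar> \<le> A * exp (- \<bar>x\<bar>)"
          using exp_ell_mult_\<Psi>_bound[of 1 k] by auto
        have "\<bar>\<Theta> k x\<bar> \<le> \<bar>A\<bar>" for x
        proof -
          have "\<bar>\<Theta> k x\<bar> \<le> A * exp (- \<bar>x\<bar>)" using A[of x] by (simp add: \<Theta>_def abs_mult)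
          also have "\<dots> \<le> \<bar>A\<bar> * 1" by (intro mult_mono) auto
          finally show ?thesis by simp
        qed
        thus ?thesis by blast
      qed
      have i\<Theta>: "integrable (P x) (\<lambda>\<omega>. D \<omega> * \<Theta> k (X t \<omega>))" for k
        using \<Theta>b[of k] feynman_kac_integrable[OF \<Theta>_measurable] unfolding D_def by blast
      have e\<Theta>: "expectation (\<lambda>\<omega>. D \<omega> * \<Theta> k (X t \<omega>)) = exp (- lam k * t) * \<Theta> k x" for k
        using feynman_kac_\<Theta>[OF t, of k x] by (simp add: feynman_kac_def D_def)
      have i\<phi>: "integrable (P x) (\<lambda>\<omega>. D \<omega> * \<phi> (X t \<omega>))"
        using feynman_kac_integrable[OF \<phi>m \<phi>b] by (simp add: D_def)
      have iS: "integrable (P x) (\<lambda>\<omega>. \<Sum>k<n. c k * (D \<omega> * \<Theta> k (X t \<omega>)))"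
        by (intro Bochner_Integration.integrable_sum integrable_mult_right i\<Theta>)
      have "expectation (\<lambda>\<omega>. \<Sum>k<n. c k * (D \<omega> * \<Theta> k (X t \<omega>))) = G n x"
        using i\<Theta> by (simp add: Bochner_Integration.integral_sum e\<Theta> G_def)
      hence eq: "fk \<phi> x - G n x = expectation (\<lambda>\<omega>. D \<omega> * \<phi> (X t \<omega>) - (\<Sum>k<n. c k * (D \<omega> * \<Theta> k (X t \<omega>))))"
        using i\<phi> iS by (simp add: feynman_kac_def D_def)
      have "\<bar>fk \<phi> x - G n x\<bar> \<le> expectation (\<lambda>\<omega>. \<bar>D \<omega> * \<phi> (X t \<omega>) - (\<Sum>k<n. c k * (D \<omega> * \<Theta> k (X t \<omega>)))\<bar>)"
        unfolding eq by (rule integral_abs_bound)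
      also have "\<dots> \<le> expectation (\<lambda>\<omega>. \<epsilon> * (D \<omega> * exp (ell a (X t \<omega>))))"
      proof (rule integral_mono)
        show "integrable (P x) (\<lambda>\<omega>. \<epsilon> * (D \<omega> * exp (ell a (X t \<omega>))))"
          using feynman_kac_exp_ell(1)[OF t, of x] by (simp add: D_def)
        fix \<omega>
        have "D \<omega> * \<phi> (X t \<omega>) - (\<Sum>k<n. c k * (D \<omega> * \<Theta> k (X t \<omega>))) =
           D \<omega> * exp (ell a (X t \<omega>)) * (f (X t \<omega>) - lincomb c {..<n} (X t \<omega>))"
          by (simp add: \<phi>_def \<Theta>_def lincomb_def right_diff_distrib sum_distrib_left mult_ac)
        also have "\<bar>\<dots>\<bar> \<le> D \<omega> * exp (ell a (X t \<omega>)) * \<epsilon>"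
          using N[OF n, of "X t \<omega>"] by (simp add: abs_mult D_def)
        finally show "\<bar>D \<omega> * \<phi> (X t \<omega>) - (\<Sum>k<n. c k * (D \<omega> * \<Theta> k (X t \<omega>)))\<bar> \<le> \<epsilon> * (D \<omega> * exp (ell a (X t \<omega>)))"
          by (simp add: mult_ac)
      qed (use i\<phi> iS in auto)
      also have "\<dots> = \<epsilon> * fk (\<lambda>y. exp (ell a y)) x" by (simp add: feynman_kac_def D_def)
      also have "\<dots> \<le> \<epsilon> * (exp (C * t) * exp (ell a x))"
        using e feynman_kac_exp_ell(2)[OF t] by (intro mult_left_mono) auto
      finally show ?thesis .
    qed
    thus ?thesis by blast
  qed
  \<comment> \<open>At a fixed x the factor exp (ell x) is a constant, so the error bound relative
    to exp ell gives pointwise convergence and with it measurability of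
    \<open>fk \<phi>\<close>.\<close>
  have Glim: "(\<lambda>n. G n x) \<longlonglongrightarrow> fk \<phi> x" for x
  proof (rule LIMSEQ_I)
    fix r :: real assume r: "r > 0"
    define E where "E = exp (C * t) * exp (ell a x)"
    have E: "E > 0" by (simp add: E_def)
    have "r / (2 * E) > 0" using r E by simp
    from fkG[OF this] obtain N where N: "\<And>n y. n \<ge> N \<Longrightarrow> \<bar>fk \<phi> y - G n y\<bar> \<le> (r / (2 * E)) * (exp (C * t) * exp (ell a y))"
      by blast
    have "norm (G n x - fk \<phi> x) < r" if "n \<ge> N" for n
    proof -
      have "\<bar>fk \<phi> x - G n x\<bar> \<le> (r / (2 * E)) * E" unfolding E_def using N[OF that, of x] by (simp only: E_def)
      also have "\<dots> < r" using r E by simp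
      finally show ?thesis by (simp add: abs_minus_commute)
    qed
    thus "\<exists>no. \<forall>n\<ge>no. norm (G n x - fk \<phi> x) < r" by blast
  qed
  have fkm[measurable]: "fk \<phi> \<in> borel_measurable borel" by (rule borel_measurable_LIMSEQ_real[OF Glim Gm])
  have i\<phi>: "integrable (qsd a \<Psi>) (fk \<phi>)"
    using feynman_kac_bound[OF \<phi>m \<phi>b] by (intro nu.integrable_const_bound AE_I2) auto
  have iG: "integrable (qsd a \<Psi>) (G n)" for n
    unfolding G_def by (intro Bochner_Integration.integrable_sum integrable_mult_right qsd_\<Theta>)
  have eG: "(\<integral>x. G n x \<partial>qsd a \<Psi>) = exp (- lam 0 * t) * c 0 / Z" if "n > 0" for n
  proof -
    have "(\<integral>x. G n x \<partial>qsd a \<Psi>) = (\<Sum>k<n. c k * (exp (- lam k * t) * (if k = 0 then 1 / Z else 0)))"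
      unfolding G_def using qsd_\<Theta> by (simp add: Bochner_Integration.integral_sum)
    also have "\<dots> = (\<Sum>k<n. if k = 0 then exp (- lam 0 * t) * c 0 / Z else 0)"
      by (intro sum.cong) auto
    finally show ?thesis using that by simp
  qed
  have e\<phi>: "(\<integral>x. \<phi> x \<partial>qsd a \<Psi>) = c 0 / Z"
    unfolding qsd_integral(1)[OF \<phi>m] unfolding \<phi>_def exp_neg_ell_cancel c_def by (simp add: mult.commute)
  have "(\<integral>x. fk \<phi> x \<partial>qsd a \<Psi>) = exp (- lam 0 * t) * c 0 / Z"
  proof (rule ccontr)
    define r where "r = \<bar>(\<integral>x. fk \<phi> x \<partial>qsd a \<Psi>) - exp (- lam 0 * t) * c 0 / Z\<bar>"
    define E where "E = (\<integral>x. exp (C * t) * exp (ell a x) \<partial>qsd a \<Psi>)"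
    assume "(\<integral>x. fk \<phi> x \<partial>qsd a \<Psi>) \<noteq> exp (- lam 0 * t) * c 0 / Z"
    hence r: "r > 0" by (simp add: r_def)
    have iE: "integrable (qsd a \<Psi>) (\<lambda>x. exp (C * t) * exp (ell a x))" by (intro integrable_mult_right qsd_exp_ell)
    have E0: "E \<ge> 0" unfolding E_def by (intro Bochner_Integration.integral_nonneg) auto
    \<comment> \<open>Integrated against \<nu> the error is at most \<epsilon> E < r, whereas for n
      > 0 the integral of \<open>G n\<close> already has its final value. E + 1 spares an argument
      for E > 0.\<close>
    define \<epsilon> where "\<epsilon> = r / (2 * (E + 1))"
    have "\<epsilon> > 0" using r E0 by (simp add: \<epsilon>_def)
    from fkG[OF this] obtain N where N: "\<And>n x. n \<ge> N \<Longrightarrow> \<bar>fk \<phi> x - G n x\<bar> \<le> \<epsilon> * (exp (C * t) * exp (ell a x))" by blast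
    define n where "n = max N 1"
    have n: "n \<ge> N" "n > 0" by (auto simp: n_def)
    have "r = \<bar>\<integral>x. fk \<phi> x - G n x \<partial>qsd a \<Psi>\<bar>"
      using i\<phi> iG by (simp add: r_def eG[OF n(2)])
    also have "\<dots> \<le> (\<integral>x. \<bar>fk \<phi> x - G n x\<bar> \<partial>qsd a \<Psi>)" by (rule integral_abs_bound)
    also have "\<dots> \<le> (\<integral>x. \<epsilon> * (exp (C * t) * exp (ell a x)) \<partial>qsd a \<Psi>)"
      by (intro integral_mono integrable_abs Bochner_Integration.integrable_diff i\<phi> iG integrable_mult_right[OF iE] N[OF n(1)])
    also have "\<dots> = \<epsilon> * E" unfolding E_def by (rule integral_mult_right_zero)
    also have "\<dots> < \<epsilon> * (2 * (E + 1))" using \<open>\<epsilon> > 0\<close> E0 by (intro mult_strict_left_mono) auto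
    also have "\<dots> = r" using E0 by (simp add: \<epsilon>_def)
    finally show False by simp
  qed
  thus ?thesis using \<phi>m \<phi>b fkm e\<phi> unfolding admissible_def \<phi>_def[symmetric] by auto
qed

text \<open>With f = exp (-ell) times a C^2 approximation of the indicator, the outer exp ell
  cancels, so the approximations themselves lie in the class; a bounded limit does the rest.\<close>

lemma admissible_interval: "admissible (indicator {p<..<q})"
proof -
  obtain s where s: "\<And>m. C2_function (s m)" "\<And>m x. x \<notin> {p<..<q} \<Longrightarrow> s m x = 0" "\<And>m x. \<bar>s m x\<bar> \<le> 1"
    "\<And>x. (\<lambda>m. s m x) \<longlonglongrightarrow> indicator {p<..<q} x"
    using interval_indicator_C2_approximation[of p q] by blast
  have "admissible (\<lambda>x. exp (ell a x) * (exp (- ell a x) * s m x))" for m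
  proof (rule admissible_exp_ell_mult)
    show "C2_function (\<lambda>x. exp (- ell a x) * s m x)" by (intro C2_function_mult C2_function_exp_neg_ell s)
    show "exp (- ell a x) * s m x = 0" if "\<bar>x\<bar> \<ge> max \<bar>p\<bar> \<bar>q\<bar>" for x
    proof -
      have "x \<notin> {p<..<q}" using that by (auto simp: abs_if split: if_splits)
      thus ?thesis using s(2) by simp
    qed
  qed
  moreover have "(\<lambda>x. exp (ell a x) * (exp (- ell a x) * s m x)) = s m" for m
    by (simp add: mult.assoc[symmetric] exp_add[symmetric])
  ultimately have "admissible (s m)" for m by simp
  thus ?thesis using s(3,4) by (rule admissible_bounded_limit)
qed

lemma admissible_zero: "admissible (\<lambda>_. 0)"
proof -
  have "(\<lambda>_. 0) = indicat_real {0<..<0::real}" by (simp add: fun_eq_iff)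
  thus ?thesis using admissible_interval[of 0 0] by metis
qed

text \<open>The constant 1 lacks compact support and is reached along growing intervals; complements
  and shifts by constants rely on it.\<close>

lemma admissible_UNIV: "admissible (\<lambda>_. 1)"
proof (rule admissible_bounded_limit)
  show "admissible (indicator {- real n<..<real n})" for n by (rule admissible_interval)
  show "\<bar>indicator {- real n<..<real n} y\<bar> \<le> (1::real)" for n y by (simp add: indicator_def)
  show "(\<lambda>n. indicator {- real n<..<real n} y :: real) \<longlonglongrightarrow> 1" for y
  proof (rule tendsto_eventually)
    show "eventually (\<lambda>n. indicator {- real n<..<real n} y = (1::real)) sequentially"
      using eventually_gt_at_top[of "nat \<lceil>\<bar>y\<bar>\<rceil>"]
    proof eventually_elim
      case (elim n)
      hence "\<bar>y\<bar> < real n" by linarith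
      thus ?case by (auto simp: indicator_def)
    qed
  qed
qed

text \<open>Dynkin's argument: open intervals are stable under intersection and generate the Borel
  sets, while linearity and bounded limits close the class under complements and countable disjoint
  unions.\<close>

lemma admissible_indicator:
  assumes "A \<in> sets borel"
  shows "admissible (indicator A)"
proof -
  define G where "G = range (\<lambda>(p, q). {p<..<q::real})"
  have gen: "A \<in> sigma_sets UNIV G"
    using assms unfolding borel_eq_box G_def box_real by simp
  have "Int_stable G"
  proof (rule Int_stableI)
    fix S T assume "S \<in> G" "T \<in> G"
    then obtain p q r s where "S = {p<..<q}" "T = {r<..<s}" by (auto simp: G_def)
    hence "S \<inter> T = {max p r<..<min q s}" by auto
    thus "S \<inter> T \<in> G" unfolding G_def by (intro range_eqI[of _ _ "(max p r, min q s)"]) simp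
  qed
  moreover have "G \<subseteq> Pow UNIV" by simp
  ultimately show ?thesis using gen
  proof (induction rule: sigma_sets_induct_disjoint)
    case (basic A)
    then show ?case by (auto simp: G_def admissible_interval)
  next
    case empty
    then show ?case using admissible_zero by simp
  next
    case (compl A)
    have "indicator (UNIV - A) = (\<lambda>x. (- 1) * indicator A x + (1::real))" by (auto simp: indicator_def fun_eq_iff)
    thus ?case using admissible_linear[OF compl.IH admissible_UNIV, of "- 1"] by simp
  next
    case (union A)
    have part: "admissible (\<lambda>x. \<Sum>i<n. indicator (A i) x)" for n
    proof (induction n)
      case 0
      show ?case using admissible_zero by simp
    next
      case (Suc n)
      show ?case using admissible_linear[OF union.IH[of n] Suc, of 1] by (simp add: add.commute)
    qed
    have eq: "(\<Sum>i<n. indicator (A i) x) = (indicator (\<Union>i<n. A i) x :: real)" for n x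
      by (rule indicator_UN_disjoint[symmetric]) (use union.hyps in \<open>auto simp: disjoint_family_on_def\<close>)
    show ?case
    proof (rule admissible_bounded_limit[OF part])
      show "\<bar>\<Sum>i<n. indicator (A i) y\<bar> \<le> (1::real)" for n y unfolding eq by (simp add: indicator_def)
      show "(\<lambda>n. \<Sum>i<n. indicator (A i) y) \<longlonglongrightarrow> (indicator (\<Union>i. A i) y :: real)" for y
        unfolding eq by (rule LIMSEQ_indicator_UN)
    qed
  qed
qed

lemma admissible_bounded:
  assumes \<phi>: "\<phi> \<in> borel_measurable borel" "\<And>y. \<bar>\<phi> y\<bar> \<le> K"
  shows "admissible \<phi>"
proof -
  \<comment> \<open>The bound enters as a premise of the induction claim, since only bounded limits
    stay in the class; nonnegativity passes a bound on the whole down to its pieces.\<close>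
  have nonneg: "(\<exists>L. \<forall>y. u y \<le> L) \<longrightarrow> admissible u" if "u \<in> borel_measurable borel" "\<And>y. 0 \<le> u y" for u :: "real \<Rightarrow> real"
    using that
  proof (induction u rule: borel_measurable_induct_real)
    case (set A)
    then show ?case by (simp add: admissible_indicator)
  next
    case (mult u c)
    show ?case
    proof (intro impI)
      assume "\<exists>L. \<forall>y. c * u y \<le> L"
      then obtain L where L: "\<And>y. c * u y \<le> L" by blast
      show "admissible (\<lambda>y. c * u y)"
      proof (cases "c = 0")
        case True thus ?thesis using admissible_zero by simp
      next
        case False
        hence "\<forall>y. u y \<le> L / c" using mult.hyps L by (simp add: field_simps)
        with mult.IH have "admissible u" by blast
        from admissible_linear[OF this admissible_zero, of c] show ?thesis by simp
      qed
    qed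
  next
    case (add u v)
    show ?case
    proof (intro impI)
      assume "\<exists>L. \<forall>y. v y + u y \<le> L"
      then obtain L where L: "\<And>y. v y + u y \<le> L" by blast
      have "u y \<le> L" "v y \<le> L" for y using L[of y] add.hyps(2)[of y] add.hyps(4)[of y] by linarith+
      hence "admissible u" "admissible v" using add.IH by blast+
      from admissible_linear[OF this(2,1), of 1] show "admissible (\<lambda>y. v y + u y)" by simp
    qed
  next
    case (seq U)
    show ?case
    proof (intro impI)
      assume "\<exists>L. \<forall>y. u y \<le> L"
      then obtain L where L: "\<And>y. u y \<le> L" by blast
      have U: "U i y \<le> L" for i y
      proof -
        have "incseq (\<lambda>i. U i y)" using seq.hyps(3) by (auto simp: incseq_def le_fun_def)
        hence "U i y \<le> u y" by (rule incseq_le) (use seq.hyps(4) in simp)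
        from this L[of y] show ?thesis by (rule order_trans)
      qed
      show "admissible u"
      proof (rule admissible_bounded_limit)
        show "admissible (U i)" for i using seq.IH U by blast
        show "\<bar>U i y\<bar> \<le> L" for i y using U seq.hyps(2) by simp
        show "(\<lambda>i. U i y) \<longlonglongrightarrow> u y" for y using seq.hyps(4) by simp
      qed
    qed
  qed
  \<comment> \<open>Shift to a nonnegative function; K times the constant 1 is subtracted
    afterwards.\<close>
  have "admissible (\<lambda>y. \<phi> y + K)"
  proof (rule nonneg[rule_format])
    show "(\<lambda>y. \<phi> y + K) \<in> borel_measurable borel" using \<phi>(1) by simp
    show "0 \<le> \<phi> y + K" for y using \<phi>(2)[of y] by linarith
    show "\<exists>L. \<forall>y. \<phi> y + K \<le> L" using \<phi>(2)[THEN abs_le_D1] by (intro exI[of _ "K + K"] allI add_right_mono)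
  qed
  from admissible_linear[OF admissible_UNIV this, of "- K"] show ?thesis by simp
qed

end

theorem quasi_stationary:
  assumes t: "t > 0" and \<phi>: "\<phi> \<in> borel_measurable borel" "bounded (range \<phi>)"
  shows "(\<integral>x. feynman_kac V P X t \<phi> x \<partial>qsd a \<Psi>) = exp (- lam 0 * t) * (\<integral>x. \<phi> x \<partial>qsd a \<Psi>)"
proof -
  obtain K where K: "\<And>y. \<bar>\<phi> y\<bar> \<le> K" using \<phi>(2) by (auto simp: bounded_iff)
  from admissible_bounded[OF t \<phi>(1) K] show ?thesis by (simp add: admissible_def[OF t])
qed

end

theorem theorem2p2:
  fixes a V :: "real \<Rightarrow> real"
    and P :: "real \<Rightarrow> 'w measure"
    and B X :: "real \<Rightarrow> 'w \<Rightarrow> real"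
    and lam :: "nat \<Rightarrow> real"
    and \<Psi> :: "nat \<Rightarrow> real \<Rightarrow> real"
  assumes "standing_assumptions a V"
    and "\<And>x. brownian_motion (P x) B"
    and "\<And>x. solves_sde a x (P x) B X"
    and "spectral_data a V lam \<Psi>"
  shows "prob_space (qsd a \<Psi>) \<and>
    (\<forall>t>0. \<forall>\<phi>. \<phi> \<in> borel_measurable borel \<and> bounded (range \<phi>) \<longrightarrow>
       (\<integral>x. feynman_kac V P X t \<phi> x \<partial>qsd a \<Psi>) = exp (- lam 0 * t) * (\<integral>x. \<phi> x \<partial>qsd a \<Psi>) \<and>
       (\<integral>x. feynman_kac V P X t \<phi> x \<partial>qsd a \<Psi>) /
         (\<integral>x. feynman_kac V P X t (\<lambda>_. 1) x \<partial>qsd a \<Psi>) = (\<integral>x. \<phi> x \<partial>qsd a \<Psi>))"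
proof -
  interpret qsd_setting a V P B X lam \<Psi>
    using assms by unfold_locales
  interpret nu: prob_space "qsd a \<Psi>" by (rule prob_space_qsd)
  \<comment> \<open>The case \<phi> = 1, where \<nu> has mass 1, identifies the denominator as a
    positive number, so that division leaves the mean of \<phi>.\<close>
  have "(\<integral>x. feynman_kac V P X t (\<lambda>_. 1) x \<partial>qsd a \<Psi>) = exp (- lam 0 * t)" if "t > 0" for t
    using quasi_stationary[OF that, of "\<lambda>_. 1"] nu.prob_space by simp
  then show ?thesis
    using quasi_stationary prob_space_qsd by auto
qed

end
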